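(* There is a randomized combinatorial algorithm for Node-Weighted Correlation Clustering which computes a clustering whose expected cost is at most $3$ times the optimum, and which runs in time $O(n+m)$ with high probability $1-1/\mathrm{poly}(n)$, where $n=|V|$ and $m=|E|$.
   Context: Node-Weighted Correlation Clustering: given a graph $G=(V,E)$ and positive integer weights $\{\omega_u\}_{u\in V}$ on the nodes (assumed bounded by $\mathrm{poly}(n)$, so each fits in a constant number of machine words of $\Theta(\log n)$ bits), compute a clustering (partition) $C=\{C_1,\dots,C_k\}$ of $V$ with edge set $E_C=\bigcup_i\binom{C_i}{2}$ minimizing $\sum_{uv\in E\triangle E_C}\omega_u\omega_v$. *)

theory Defs
  imports "HOL-Probability.SPMF" "HOL-Library.Disjoint_Sets"
begin

definition simple_graph :: "'a set \<Rightarrow> 'a set set \<Rightarrow> bool" where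
  "simple_graph V E \<longleftrightarrow> finite V \<and> E \<subseteq> {e. e \<subseteq> V \<and> card e = 2}"

definition cluster_edges :: "'a set set \<Rightarrow> 'a set set" where
  "cluster_edges C = (\<Union>X\<in>C. {e. e \<subseteq> X \<and> card e = 2})"

text \<open>The summand of an edge \<open>e = {u, v}\<close> is \<open>\<omega> u * \<omega> v\<close>.\<close>

definition clustering_cost ::
  "'a set set \<Rightarrow> ('a \<Rightarrow> nat) \<Rightarrow> 'a set set \<Rightarrow> nat" where
  "clustering_cost E \<omega> C =
     (\<Sum>e\<in>(E - cluster_edges C) \<union> (cluster_edges C - E). \<Prod>u\<in>e. \<omega> u)"

definition opt_cost :: "'a set \<Rightarrow> 'a set set \<Rightarrow> ('a \<Rightarrow> nat) \<Rightarrow> nat" where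
  "opt_cost V E \<omega> = Min {clustering_cost E \<omega> C | C. partition_on V C}"

text \<open>
  Programs work on finitely many registers and arrays of \<open>w\<close>-bit words, where \<open>w\<close> is a
  parameter of the machine and not of the program. Arithmetic is modulo \<open>2 ^ w\<close>.
  Constantly many arrays are equivalent to one interleaved memory.
\<close>

datatype binop = Add | Sub | Mul | Div | Mod | Less | Equal

datatype expr =
    Const nat
  | Reg nat
  | Read nat expr  \<comment> \<open>array name and index\<close>
  | Bin binop expr expr

datatype com =
    Skip
  | Assign nat expr
  | Store nat expr expr  \<comment> \<open>array name, index and value\<close>
  | Random nat  \<comment> \<open>a fresh uniformly random word, into a register\<close>
  | Seq com com
  | Cond expr com com
  | While expr com

record state =
  reg :: "nat \<Rightarrow> nat"
  arr :: "nat \<Rightarrow> nat \<Rightarrow> nat"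

fun eval_binop :: "nat \<Rightarrow> binop \<Rightarrow> nat \<Rightarrow> nat \<Rightarrow> nat" where
  "eval_binop w Add a b = (a + b) mod 2 ^ w"
| "eval_binop w Sub a b = nat ((int a - int b) mod 2 ^ w)"
| "eval_binop w Mul a b = (a * b) mod 2 ^ w"
| "eval_binop w Div a b = a div b"
| "eval_binop w Mod a b = a mod b"
| "eval_binop w Less a b = (if a < b then 1 else 0)"
| "eval_binop w Equal a b = (if a = b then 1 else 0)"

primrec eval :: "nat \<Rightarrow> state \<Rightarrow> expr \<Rightarrow> nat" where
  "eval w s (Const k) = k mod 2 ^ w"
| "eval w s (Reg x) = reg s x"
| "eval w s (Read a e) = arr s a (eval w s e)"
| "eval w s (Bin f e1 e2) = eval_binop w f (eval w s e1) (eval w s e2)"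

partial_function (spmf) loop ::
  "('s \<Rightarrow> bool) \<Rightarrow> ('s \<Rightarrow> ('s \<times> nat) spmf) \<Rightarrow> 's \<Rightarrow> ('s \<times> nat) spmf" where
  "loop g body s =
     (if g s
      then bind_spmf (body s) (\<lambda>(s1, t1).
             bind_spmf (loop g body s1) (\<lambda>(s2, t2). return_spmf (s2, 1 + t1 + t2)))
      else return_spmf (s, 1))"

text \<open>
  The joint distribution of the final state and the running time; missing probability mass is
  the probability of divergence. Every elementary command and every evaluation of a guard takes
  one time unit. The expressions of a fixed program have bounded size, so charging for the single
  operations inside them would change running times by a constant factor only.
\<close>

primrec exec :: "nat \<Rightarrow> com \<Rightarrow> state \<Rightarrow> (state \<times> nat) spmf" where
  "exec w Skip = (\<lambda>s. return_spmf (s, 1))"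
| "exec w (Assign x e) = (\<lambda>s. return_spmf (s\<lparr>reg := (reg s)(x := eval w s e)\<rparr>, 1))"
| "exec w (Store a i e) =
     (\<lambda>s. return_spmf
        (s\<lparr>arr := (arr s)(a := (arr s a)(eval w s i := eval w s e))\<rparr>, 1))"
| "exec w (Random x) =
     (\<lambda>s. map_spmf (\<lambda>r. (s\<lparr>reg := (reg s)(x := r)\<rparr>, 1)) (spmf_of_set {0..<2 ^ w}))"
| "exec w (Seq p q) =
     (\<lambda>s. bind_spmf (exec w p s) (\<lambda>(s1, t1).
             bind_spmf (exec w q s1) (\<lambda>(s2, t2). return_spmf (s2, t1 + t2))))"
| "exec w (Cond e p q) =
     (\<lambda>s. map_spmf (\<lambda>(s1, t). (s1, 1 + t)) ((if eval w s e \<noteq> 0 then exec w p else exec w q) s))"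
| "exec w (While e p) = loop (\<lambda>s. eval w s e \<noteq> 0) (exec w p)"

text \<open>
  Adjacency lists of a graph on \<open>{0..<n}\<close>, stored one after the other: the neighbours of \<open>u\<close>
  are \<open>nbr i\<close> for \<open>off u \<le> i < off (u + 1)\<close>, in any order and without repetition. Thus
  \<open>off n\<close> is twice the number of edges.
\<close>

definition adjacency_lists ::
  "nat \<Rightarrow> nat set set \<Rightarrow> (nat \<Rightarrow> nat) \<Rightarrow> (nat \<Rightarrow> nat) \<Rightarrow> bool" where
  "adjacency_lists n E off nbr \<longleftrightarrow>
     off 0 = 0 \<and>
     (\<forall>u<n. off u \<le> off (Suc u) \<and>
            bij_betw nbr {off u..<off (Suc u)} {v. {u, v} \<in> E})"

text \<open>
  Register 0 holds \<open>n\<close>; arrays 0, 1 and 2 hold weights, offsets and neighbours; everything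
  else is zero.
\<close>

definition input_state ::
  "nat \<Rightarrow> (nat \<Rightarrow> nat) \<Rightarrow> (nat \<Rightarrow> nat) \<Rightarrow> (nat \<Rightarrow> nat) \<Rightarrow> state" where
  "input_state n \<omega> off nbr =
     \<lparr>reg = (\<lambda>_. 0)(0 := n),
      arr = (\<lambda>_ _. 0)
        (0 := (\<lambda>i. if i < n then \<omega> i else 0),
         1 := (\<lambda>i. if i \<le> n then off i else 0),
         2 := (\<lambda>i. if i < off n then nbr i else 0))\<rparr>"

text \<open>
  On termination array 3 holds a cluster label for every vertex; the clusters are the classes
  of vertices with equal label.
\<close>

definition output_clustering :: "nat \<Rightarrow> state \<Rightarrow> nat set set" where
  "output_clustering n s = (\<lambda>u. {v \<in> {0..<n}. arr s 3 v = arr s 3 u}) ` {0..<n}"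

end

theory Submission
  imports Defs
begin

text \<open>
  Pivot with pivots drawn proportionally to their weight: the next cluster consists of an unlabelled
  vertex and its unlabelled neighbours. If \<open>v\<close> becomes the pivot, then the pair \<open>x y\<close>
  is charged \<open>\<omega> x * \<omega> y\<close> exactly if \<open>v x y\<close> is a bad triangle, that is, has two edges. Hence
  a bad triangle is charged the symmetric amount \<open>\<omega> v * \<omega> x * \<omega> y\<close> (up to normalization) for each
  choice of its pivot, while an optimal clustering errs on at least one of its three pairs. So the cost
  paid so far, plus three times the cost of the optimal clustering on the pairs that are still
  undecided, is a supermartingale.

  For sampling in constant time, vertices are grouped by the bit length \<open>i\<close> of their weight, and every
  vertex has a slot of width \<open>2 ^ i\<close>, at most twice its weight. A random word is mapped to a point in
  a layout of all slots; it selects the vertex if it falls below the weight of the vertex and the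
  vertex is unlabelled, which makes the sampling exact. If the vertex is labelled, its slot is deleted.
  To locate the class of a point, the layout is divided into at most \<open>2 * L\<close> cells for \<open>L\<close> classes, each
  belonging to one class, and it is rebuilt in time \<open>O(L)\<close> when the total width of the slots has
  halved. Thus a constant fraction of the words chooses a pivot or deletes a slot, and an exponential
  moment bounds the number of iterations. Rebuilding costs \<open>O(w\<^sup>2)\<close> in total, which is
  \<open>O(log\<^sup>2 n)\<close>.
\<close>

section \<open>Semantics of loops and deterministic programs\<close>

text \<open>Two demands shape the construction. The pivot must be distributed exactly in proportion
  to the weights, because the charging argument uses exact symmetry in the corners of a bad
  triangle. So words are rejected rather than rounded, and every point of the layout is reached by
  the same number \<open>reg s x_quot\<close> of words. On the other hand the time must be linear
  although labelled vertices, pivots included, keep their slots until a word happens to hit them.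
  Hence \<open>progress\<close> counts the remaining slots together with the unlabelled vertices. It
  is at most \<open>2 * n\<close> initially, and at least one word in 24 lowers it, so the mean of
  \<open>2 ^ progress\<close> shrinks by the factor \<open>1 - 1 / 48\<close> in every iteration.
  This pays for the growth \<open>z ^ 16\<close> of an exponential moment of the running time, 16
  being the amortized cost of an iteration. Cost and time are bounded by two separate potentials of
  the same loop. Averages are always taken over all words, including those that choose no pivot, so
  neither conditioning nor independence enters.\<close>

lemma nn_integral_bind_spmf:
  "(\<integral>\<^sup>+ x. f x \<partial>measure_spmf (bind_spmf p g)) =
   (\<integral>\<^sup>+ y. (\<integral>\<^sup>+ x. f x \<partial>measure_spmf (g y)) \<partial>measure_spmf p)"
  unfolding measure_spmf_bind
  by (subst nn_integral_bind[where B = "count_space UNIV"])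
     (auto simp: space_subprob_algebra subprob_space_measure_spmf)

lemma nn_integral_return_spmf: "(\<integral>\<^sup>+ x. f x \<partial>measure_spmf (return_spmf y)) = f y"
  by (simp add: measure_spmf_return_spmf nn_integral_return)

lemma nn_integral_measure_spmf_mono:
  assumes "\<And>x. x \<in> set_spmf p \<Longrightarrow> f x \<le> g x"
  shows "(\<integral>\<^sup>+ x. f x \<partial>measure_spmf p) \<le> (\<integral>\<^sup>+ x. g x \<partial>measure_spmf p)"
  by (intro nn_integral_mono_AE) (auto intro: assms)

text \<open>Point masses increase along the chain, so monotone convergence applies. The chain may be
  uncountable; restricting to the countable support of the limit is what allows supremum and
  integral to be exchanged.\<close>

lemma nn_integral_lub_spmf_le:
  assumes chain: "Complete_Partial_Order.chain (ord_spmf (=)) Y"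
    and Y: "Y \<noteq> {}" and le: "\<And>p. p \<in> Y \<Longrightarrow> (\<integral>\<^sup>+ x. f x \<partial>measure_spmf p) \<le> c"
  shows "(\<integral>\<^sup>+ x. f x \<partial>measure_spmf (lub_spmf Y)) \<le> c"
proof -
  have chain': "Complete_Partial_Order.chain (\<le>) ((\<lambda>p x. ennreal (spmf p x) * f x) ` Y)"
    using chain by (rule chain_imageI) (auto simp: le_fun_def intro!: mult_right_mono dest: ord_spmf_eq_leD)
  let ?S = "set_spmf (lub_spmf Y)"
  have "(\<integral>\<^sup>+ x. f x \<partial>measure_spmf (lub_spmf Y)) =
    (\<integral>\<^sup>+ x. (SUP p\<in>Y. ennreal (spmf p x) * f x) \<partial>count_space ?S)"
    by (simp add: nn_integral_measure_spmf' ennreal_spmf_lub_spmf[OF chain Y]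
        SUP_mult_right_ennreal Y)
  also have "\<dots> = (SUP p\<in>Y. \<integral>\<^sup>+ x. ennreal (spmf p x) * f x \<partial>count_space ?S)"
    using chain' Y by (intro nn_integral_monotone_convergence_SUP_countable)
       (auto simp: countable_set_spmf)
  also have "\<dots> \<le> c"
  proof (rule SUP_least)
    fix p assume p: "p \<in> Y"
    have "(\<integral>\<^sup>+ x. ennreal (spmf p x) * f x \<partial>count_space ?S) \<le>
       (\<integral>\<^sup>+ x. ennreal (spmf p x) * f x \<partial>count_space UNIV)"
      by (auto simp: nn_integral_count_space_indicator intro!: nn_integral_mono split: split_indicator)
    also have "\<dots> \<le> c" using le[OF p] by (simp add: nn_integral_measure_spmf)
    finally show "(\<integral>\<^sup>+ x. ennreal (spmf p x) * f x \<partial>count_space ?S) \<le> c" .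
  qed
  finally show ?thesis .
qed

text \<open>Prepared for fixed point induction on \<open>loop\<close>: the map \<open>h\<close>
  packs a state into the tuple \<open>((g, body), s)\<close> over which the fixed point is
  taken.\<close>

lemma admissible_nn_integral_le:
  "spmf.admissible (\<lambda>f. \<forall>s t. P s \<longrightarrow> (\<integral>\<^sup>+ x. F t x \<partial>measure_spmf (f (h s))) \<le> \<Phi> s t)"
proof (rule ccpo.admissibleI, intro allI impI)
  fix A s t
  assume chain: "Complete_Partial_Order.chain (fun_ord (ord_spmf (=))) A" and ne: "A \<noteq> {}"
    and le: "\<forall>f\<in>A. \<forall>s t. P s \<longrightarrow> (\<integral>\<^sup>+ x. F t x \<partial>measure_spmf (f (h s))) \<le> \<Phi> s t" and s: "P s"
  have "Complete_Partial_Order.chain (ord_spmf (=)) {y. \<exists>f\<in>A. y = f (h s)}"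
    by (rule chain_fun[OF chain])
  then show "(\<integral>\<^sup>+ x. F t x \<partial>measure_spmf (fun_lub lub_spmf A (h s))) \<le> \<Phi> s t"
    unfolding fun_lub_def
    by (rule nn_integral_lub_spmf_le) (use ne le s in auto)
qed

text \<open>Supermartingale rule. The argument \<open>t\<close> is the time spent before the loop,
  so \<open>F\<close> may depend on the total time. Divergent runs contribute nothing to the
  integral, so fixed point induction proves the bound without a termination argument.\<close>

lemma nn_integral_loop_le:
  fixes \<Phi> :: "'s \<Rightarrow> nat \<Rightarrow> ennreal"
  assumes step: "\<And>s t. P s \<Longrightarrow> g s \<Longrightarrow>
      (\<integral>\<^sup>+ (s1, t1). \<Phi> s1 (1 + t + t1) \<partial>measure_spmf (body s)) \<le> \<Phi> s t"
    and inv: "\<And>s s1 t1. P s \<Longrightarrow> g s \<Longrightarrow> (s1, t1) \<in> set_spmf (body s) \<Longrightarrow> P s1"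
    and final: "\<And>s t. P s \<Longrightarrow> \<not> g s \<Longrightarrow> F s (1 + t) \<le> \<Phi> s t"
    and P: "P s"
  shows "(\<integral>\<^sup>+ (s', t'). F s' (t + t') \<partial>measure_spmf (loop g body s)) \<le> \<Phi> s t"
proof -
  let ?F = "\<lambda>t (s', t'). F s' (t + t')"
  have "\<forall>s t. P s \<longrightarrow> (\<integral>\<^sup>+ x. ?F t x \<partial>measure_spmf (loop g body s)) \<le> \<Phi> s t"
  proof (induction rule: loop.fixp_induct)
    case 1
    show ?case
      using admissible_nn_integral_le[where F = ?F and P = P and h = "\<lambda>s. ((g, body), s)" and \<Phi> = \<Phi>]
      by simp
  next
    case 2
    show ?case by simp
  next
    case (3 f)
    show ?case
    proof (intro allI impI)
      fix s t assume s: "P s"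
      show "(\<integral>\<^sup>+ x. ?F t x \<partial>measure_spmf (if g s
        then bind_spmf (body s) (\<lambda>(s1, t1). bind_spmf (f g body s1)
               (\<lambda>(s2, t2). return_spmf (s2, 1 + t1 + t2)))
        else return_spmf (s, 1))) \<le> \<Phi> s t"
      proof (cases "g s")
        case False
        then show ?thesis using final[OF s False, of t]
          by (simp add: nn_integral_return_spmf)
      next
        case True
        have "(\<integral>\<^sup>+ x. ?F t x \<partial>measure_spmf (bind_spmf (body s) (\<lambda>(s1, t1). bind_spmf (f g body s1)
               (\<lambda>(s2, t2). return_spmf (s2, 1 + t1 + t2))))) =
           (\<integral>\<^sup>+ (s1, t1). (\<integral>\<^sup>+ x. ?F (1 + t + t1) x \<partial>measure_spmf (f g body s1)) \<partial>measure_spmf (body s))"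
          by (simp add: nn_integral_bind_spmf case_prod_beta' nn_integral_return_spmf add_ac)
        also have "\<dots> \<le> (\<integral>\<^sup>+ (s1, t1). \<Phi> s1 (1 + t + t1) \<partial>measure_spmf (body s))"
          using 3 inv[OF s True] by (intro nn_integral_measure_spmf_mono) (auto simp del: One_nat_def)
        also have "\<dots> \<le> \<Phi> s t" by (rule step[OF s True])
        finally show ?thesis using True by simp
      qed
    qed
  qed
  then show ?thesis using P by blast
qed

text \<open>Upper bounds on integrals cannot show termination, so the probability \<open>u\<close>
  of divergence is bounded directly: an iteration contracts \<open>\<Phi>\<close> by
  \<open>\<beta>\<close> in the mean, hence \<open>u s\<close> is at most
  \<open>\<beta> ^ N * \<Phi> s\<close> for every \<open>N\<close>.\<close>

lemma lossless_loop:
  fixes \<Phi> :: "'s \<Rightarrow> ennreal" and \<beta> :: real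
  assumes step: "\<And>s. P s \<Longrightarrow> g s \<Longrightarrow>
      (\<integral>\<^sup>+ (s1, t1). \<Phi> s1 \<partial>measure_spmf (body s)) \<le> ennreal \<beta> * \<Phi> s"
    and inv: "\<And>s s1 t1. P s \<Longrightarrow> g s \<Longrightarrow> (s1, t1) \<in> set_spmf (body s) \<Longrightarrow> P s1"
    and lossless: "\<And>s. P s \<Longrightarrow> g s \<Longrightarrow> lossless_spmf (body s)"
    and ge1: "\<And>s. P s \<Longrightarrow> 1 \<le> \<Phi> s" and fin: "\<Phi> s < \<top>"
    and \<beta>: "0 \<le> \<beta>" "\<beta> < 1" and P: "P s"
  shows "lossless_spmf (loop g body s)"
proof -
  define u where "u s = 1 - emeasure (measure_spmf (loop g body s)) UNIV" for s
  have le: "u s \<le> ennreal (\<beta> ^ N) * \<Phi> s" if "P s" for s N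
    using that
  proof (induction N arbitrary: s)
    case 0
    have "u s \<le> 1" unfolding u_def by (rule diff_le_self_ennreal)
    then show ?case using ge1[OF 0] by simp
  next
    case (Suc N)
    show ?case
    proof (cases "g s")
      case False
      then show ?thesis
        by (simp add: u_def loop.simps measure_spmf_return_spmf)
    next
      case True
      let ?e = "\<lambda>s. emeasure (measure_spmf (loop g body s)) UNIV"
      have le1: "?e s \<le> 1" for s
        by (metis measure_spmf.emeasure_space_le_1 space_measure_spmf)
      have e: "?e s = (\<integral>\<^sup>+ (s1, t1). ?e s1 \<partial>measure_spmf (body s))"
      proof -
        have "?e s = (\<integral>\<^sup>+ x. 1 \<partial>measure_spmf (loop g body s))"
          by (simp add: space_measure_spmf)
        also have "\<dots> = (\<integral>\<^sup>+ (s1, t1). ?e s1 \<partial>measure_spmf (body s))"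
          using True
          by (subst loop.simps) (simp add: nn_integral_bind_spmf case_prod_beta' nn_integral_return_spmf
               del: nn_integral_const, simp add: space_measure_spmf case_prod_beta')
        finally show ?thesis .
      qed
      \<comment> \<open>As the body never diverges, the constant 1 is an integral over its outcomes,
        and the complement can be moved under the integral.\<close>
      have one: "(\<integral>\<^sup>+ x. 1 \<partial>measure_spmf (body s)) = 1"
        using lossless[OF Suc.prems True] by (simp add: lossless_spmf_def weight_spmf_def
            measure_spmf.emeasure_eq_measure)
      have "u s = (\<integral>\<^sup>+ x. 1 \<partial>measure_spmf (body s)) - (\<integral>\<^sup>+ (s1, t1). ?e s1 \<partial>measure_spmf (body s))"
        unfolding u_def e one ..
      also have "\<dots> = (\<integral>\<^sup>+ (s1, t1). u s1 \<partial>measure_spmf (body s))"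
        unfolding u_def
      proof (subst nn_integral_diff[symmetric])
        have "(\<integral>\<^sup>+ (s1, t1). ?e s1 \<partial>measure_spmf (body s)) \<le> 1"
          using le1[of s] e by simp
        then show "(\<integral>\<^sup>+ (s1, t1). ?e s1 \<partial>measure_spmf (body s)) \<noteq> \<infinity>"
          by (metis ennreal_one_less_top infinity_ennreal_def not_less)
      qed (use le1 in \<open>auto simp: case_prod_beta'\<close>)
      also have "\<dots> \<le> (\<integral>\<^sup>+ (s1, t1). ennreal (\<beta> ^ N) * \<Phi> s1 \<partial>measure_spmf (body s))"
        using Suc.IH inv[OF Suc.prems True]
        by (intro nn_integral_measure_spmf_mono) auto
      also have "\<dots> = ennreal (\<beta> ^ N) * (\<integral>\<^sup>+ (s1, t1). \<Phi> s1 \<partial>measure_spmf (body s))"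
        by (subst nn_integral_cmult[symmetric]) (auto simp: case_prod_beta')
      also have "\<dots> \<le> ennreal (\<beta> ^ N) * (ennreal \<beta> * \<Phi> s)"
        by (intro mult_left_mono step Suc.prems True) simp
      also have "\<dots> = ennreal (\<beta> ^ Suc N) * \<Phi> s"
        using \<beta> by (simp add: ennreal_mult mult_ac)
      finally show ?thesis .
    qed
  qed
  have "(\<lambda>N. ennreal (\<beta> ^ N) * \<Phi> s) \<longlonglongrightarrow> ennreal 0 * \<Phi> s"
    by (rule tendsto_mult_ennreal)
       (use \<beta> fin in \<open>auto intro!: LIMSEQ_power_zero simp flip: ennreal_0\<close>)
  then have "u s \<le> 0"
    using LIMSEQ_le_const le[OF P] by fastforce
  then have "1 \<le> emeasure (measure_spmf (loop g body s)) UNIV"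
    unfolding u_def by (simp add: diff_eq_0_iff_ennreal)
  then have "1 \<le> weight_spmf (loop g body s)"
    by (simp add: weight_spmf_def measure_spmf.emeasure_eq_measure)
  then show ?thesis unfolding lossless_spmf_def using weight_spmf_le_1 by (metis antisym)
qed

text \<open>Apart from \<open>Random\<close>, terminating code yields a point mass. This predicate
  gives such code a calculus of postconditions with running times, so that probabilities enter only
  once per iteration.\<close>

definition runs :: "nat \<Rightarrow> com \<Rightarrow> state \<Rightarrow> (state \<Rightarrow> nat \<Rightarrow> bool) \<Rightarrow> bool" where
  "runs w p s Q \<longleftrightarrow> (\<exists>s' t. exec w p s = return_spmf (s', t) \<and> Q s' t)"

lemma runs_mono: "runs w p s Q \<Longrightarrow> (\<And>s' t. Q s' t \<Longrightarrow> Q' s' t) \<Longrightarrow> runs w p s Q'"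
  unfolding runs_def by blast

lemma runs_Skip: "runs w Skip s Q \<longleftrightarrow> Q s 1"
  by (auto simp: runs_def)

lemma runs_Seq:
  assumes "runs w p s (\<lambda>s1 t1. runs w q s1 (\<lambda>s2 t2. Q s2 (t1 + t2)))"
  shows "runs w (Seq p q) s Q"
  using assms by (auto simp: runs_def)

text \<open>The measure \<open>m\<close> serves both as termination argument and as bound on the running time.\<close>

lemma runs_While:
  assumes step: "\<And>s. I s \<Longrightarrow> eval w s e \<noteq> 0 \<Longrightarrow> runs w p s (\<lambda>s' t. I s' \<and> m s' + t + 1 \<le> m s)"
    and final: "\<And>s' t. I s' \<Longrightarrow> eval w s' e = 0 \<Longrightarrow> t + m s' \<le> m s + 1 \<Longrightarrow> Q s' t"
    and I: "I s"
  shows "runs w (While e p) s Q"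
proof -
  have "runs w (While e p) s (\<lambda>s' t. I s' \<and> eval w s' e = 0 \<and> t + m s' \<le> m s + (1::nat))"
    using I
  proof (induction "m s" arbitrary: s rule: less_induct)
    case less
    show ?case
    proof (cases "eval w s e = 0")
      case True
      then show ?thesis using less.prems by (simp add: runs_def loop.simps)
    next
      case False
      obtain s1 t1 where 1: "exec w p s = return_spmf (s1, t1)" "I s1" "m s1 + t1 + 1 \<le> m s"
        using step[OF less.prems False] unfolding runs_def by blast
      obtain s2 t2 where 2: "exec w (While e p) s1 = return_spmf (s2, t2)" "I s2" "eval w s2 e = 0"
          "t2 + m s2 \<le> m s1 + 1"
        using less.hyps[of s1] 1 unfolding runs_def by auto
      have "exec w (While e p) s = return_spmf (s2, 1 + t1 + t2)"
        using False 1 2 by (simp add: loop.simps[of _ _ s])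
      then show ?thesis using 1 2 unfolding runs_def by auto
    qed
  qed
  then show ?thesis using final by (auto intro: runs_mono)
qed

section \<open>Charging the cost to bad triangles\<close>

lemma finite_edge_set: "finite V \<Longrightarrow> F \<subseteq> {e. e \<subseteq> V \<and> card e = 2} \<Longrightarrow> finite F"
  by (rule finite_subset[of _ "Pow V"]) auto

text \<open>Each edge arises from two ordered pairs. Charging works with ordered pairs and triples,
  which treat all corners alike; this is the bridge to sums over edges.\<close>

lemma sum_ordered_pairs:
  fixes f :: "'a \<Rightarrow> nat"
  assumes V: "finite V" and F: "F \<subseteq> {e. e \<subseteq> V \<and> card e = 2}"
  shows "(\<Sum>x\<in>V. \<Sum>y\<in>V - {x}. f x * f y * of_bool ({x, y} \<in> F)) = 2 * (\<Sum>e\<in>F. \<Prod>u\<in>e. f u)"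
proof -
  have "finite F" by (rule finite_edge_set[OF V F])
  then show ?thesis using F
  proof (induction F)
    case empty
    then show ?case by simp
  next
    case (insert e F)
    obtain a b where e: "e = {a, b}" "a \<noteq> b"
      using insert.prems by (auto simp: card_2_iff)
    have ab: "a \<in> V" "b \<in> V" using insert.prems e by auto
    have "(\<Sum>x\<in>V. \<Sum>y\<in>V - {x}. f x * f y * of_bool ({x, y} \<in> insert e F)) =
      (\<Sum>x\<in>V. \<Sum>y\<in>V - {x}. f x * f y * of_bool ({x, y} = e)) +
      (\<Sum>x\<in>V. \<Sum>y\<in>V - {x}. f x * f y * of_bool ({x, y} \<in> F))"
      unfolding sum.distrib[symmetric] using insert.hyps by (intro sum.cong refl) auto
    also have "(\<Sum>x\<in>V. \<Sum>y\<in>V - {x}. f x * f y * of_bool ({x, y} = e)) =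
      (\<Sum>x\<in>V. (if x = a then f a * f b else 0) + (if x = b then f a * f b else 0))"
    proof (rule sum.cong)
      fix x assume x: "x \<in> V"
      have "(\<Sum>y\<in>V - {x}. f x * f y * of_bool ({x, y} = e)) =
        (\<Sum>y\<in>V - {x}. (if y = b then (if x = a then f a * f b else 0) else 0) +
           (if y = a then (if x = b then f a * f b else 0) else 0))"
        using e by (intro sum.cong) (auto simp: doubleton_eq_iff)
      also have "\<dots> = (if x = a then f a * f b else 0) + (if x = b then f a * f b else 0)"
        using V ab e by (auto simp: sum.distrib)
      finally show "(\<Sum>y\<in>V - {x}. f x * f y * of_bool ({x, y} = e)) =
        (if x = a then f a * f b else 0) + (if x = b then f a * f b else 0)" .
    qed simp
    also have "\<dots> = 2 * (f a * f b)" using V ab by (simp add: sum.distrib)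
    finally show ?case using insert e by simp
  qed
qed

text \<open>Degrees are row sums of the adjacency relation, so this is
  \<open>sum_ordered_pairs\<close> with all weights 1.\<close>

lemma handshake:
  assumes "simple_graph V E"
  shows "(\<Sum>u\<in>V. card {v. {u, v} \<in> E}) = 2 * card E"
proof -
  have V: "finite V" and E: "E \<subseteq> {e. e \<subseteq> V \<and> card e = 2}"
    using assms by (auto simp: simple_graph_def)
  have "card {v. {u, v} \<in> E} = (\<Sum>v\<in>V - {u}. 1 * 1 * of_bool ({u, v} \<in> E))" if "u \<in> V" for u
  proof -
    have "{v. {u, v} \<in> E} = (V - {u}) \<inter> {v. {u, v} \<in> E}"
      using E by (auto simp: card_2_iff)
    then show ?thesis using V by (simp add: sum_of_bool_eq)
  qed
  then show ?thesis
    using sum_ordered_pairs[OF V E, of "\<lambda>_. 1"] by simp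
qed

lemma in_cluster_edges: "x \<noteq> y \<Longrightarrow> {x, y} \<in> cluster_edges C \<longleftrightarrow> (\<exists>X\<in>C. x \<in> X \<and> y \<in> X)"
  by (auto simp: cluster_edges_def)

text \<open>The index set no longer depends on the clustering, only the indicator does; so different
  labellings can be compared pair by pair.\<close>

lemma clustering_cost_ordered_pairs:
  assumes "simple_graph V E" "\<Union>C \<subseteq> V"
  shows "2 * clustering_cost E \<omega> C =
    (\<Sum>x\<in>V. \<Sum>y\<in>V - {x}. \<omega> x * \<omega> y * of_bool (({x, y} \<in> E) \<noteq> (\<exists>X\<in>C. x \<in> X \<and> y \<in> X)))"
proof -
  let ?F = "(E - cluster_edges C) \<union> (cluster_edges C - E)"
  have V: "finite V" and F: "?F \<subseteq> {e. e \<subseteq> V \<and> card e = 2}"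
    using assms by (auto simp: simple_graph_def cluster_edges_def)
  show ?thesis
    unfolding clustering_cost_def
  proof (subst sum_ordered_pairs[OF V F, of \<omega>, symmetric], intro sum.cong refl)
    fix x y assume "y \<in> V - {x}"
    then have "{x, y} \<in> cluster_edges C \<longleftrightarrow> (\<exists>X\<in>C. x \<in> X \<and> y \<in> X)"
      by (intro in_cluster_edges) auto
    then have "{x, y} \<in> ?F \<longleftrightarrow> ({x, y} \<in> E) \<noteq> (\<exists>X\<in>C. x \<in> X \<and> y \<in> X)"
      by blast
    then show "\<omega> x * \<omega> y * of_bool ({x, y} \<in> ?F) =
        \<omega> x * \<omega> y * of_bool (({x, y} \<in> E) \<noteq> (\<exists>X\<in>C. x \<in> X \<and> y \<in> X))"
      by (simp only:)
  qed
qed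

lemma opt_cost_attained:
  assumes "finite V"
  obtains C where "partition_on V C" "opt_cost V E \<omega> = clustering_cost E \<omega> C"
proof -
  let ?S = "{clustering_cost E \<omega> C | C. partition_on V C}"
  have "?S = clustering_cost E \<omega> ` {C. partition_on V C}" by auto
  then have "finite ?S" using finitely_many_partition_on[OF assms] by simp
  moreover have "partition_on V ((\<lambda>x. {x}) ` V)"
    by (auto simp: partition_on_def disjoint_def)
  then have "?S \<noteq> {}" by auto
  ultimately have "Min ?S \<in> ?S" by (rule Min_in)
  then show ?thesis using that unfolding opt_cost_def by auto
qed

definition bad_triangle :: "nat set set \<Rightarrow> nat \<Rightarrow> nat \<Rightarrow> nat \<Rightarrow> bool" where
  "bad_triangle E u x y \<longleftrightarrow> u \<noteq> x \<and> u \<noteq> y \<and> x \<noteq> y \<and>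
     of_bool ({u, x} \<in> E) + of_bool ({u, y} \<in> E) + of_bool ({x, y} \<in> E) = (2 :: nat)"

text \<open>Label \<open>0\<close> marks a vertex without cluster, and the cluster of a pivot \<open>v\<close> has label \<open>v + 1\<close>.\<close>

definition pivot_label :: "nat set set \<Rightarrow> nat \<Rightarrow> (nat \<Rightarrow> nat) \<Rightarrow> nat \<Rightarrow> nat" where
  "pivot_label E v l u = (if u = v \<or> l u = 0 \<and> {v, u} \<in> E then Suc v else l u)"

text \<open>A pair with one labelled end is already final: later pivots hand out fresh labels, so
  its ends will never agree. It pays its true error, and only pairs with both ends unlabelled are
  estimated through \<open>same\<close>.\<close>

definition pair_charge ::
  "nat set set \<Rightarrow> (nat \<Rightarrow> nat \<Rightarrow> bool) \<Rightarrow> (nat \<Rightarrow> nat) \<Rightarrow> nat \<Rightarrow> nat \<Rightarrow> nat" where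
  "pair_charge E same l x y =
     (if l x = 0 \<and> l y = 0 then 3 * of_bool (({x, y} \<in> E) \<noteq> same x y)
      else of_bool (({x, y} \<in> E) \<noteq> (l x = l y)))"

text \<open>
  Twice the cost of the pairs decided so far, plus three times twice the cost that the reference
  clustering \<open>same\<close> pays on the undecided pairs.
\<close>

definition charge ::
  "nat \<Rightarrow> nat set set \<Rightarrow> (nat \<Rightarrow> nat) \<Rightarrow> (nat \<Rightarrow> nat \<Rightarrow> bool) \<Rightarrow> (nat \<Rightarrow> nat) \<Rightarrow> nat" where
  "charge n E \<omega> same l = (\<Sum>x<n. \<Sum>y\<in>{..<n} - {x}. \<omega> x * \<omega> y * pair_charge E same l x y)"

text \<open>If the pivot decides an unlabelled pair, an error arises exactly on a bad triangle,
  while the estimate through \<open>same\<close> is released; if the pair stays undecided, there is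
  no bad triangle. Freshness of \<open>Suc v\<close> protects pairs with a labelled end. The
  released amount stands on the left to avoid subtraction of natural numbers.\<close>

lemma pair_charge_pivot_label:
  assumes v: "l v = 0" and fresh: "l x \<noteq> Suc v" "l y \<noteq> Suc v" and xy: "x \<noteq> y"
  shows "pair_charge E same (pivot_label E v l) x y +
      (if l x = 0 \<and> l y = 0 then 3 * of_bool (bad_triangle E v x y \<and> ({x, y} \<in> E) \<noteq> same x y) else 0)
    \<le> pair_charge E same l x y + (if l x = 0 \<and> l y = 0 then of_bool (bad_triangle E v x y) else 0)"
  using assms
  by (cases "{v, x} \<in> E"; cases "{v, y} \<in> E"; cases "{x, y} \<in> E")
     (auto simp: pair_charge_def pivot_label_def bad_triangle_def insert_commute)

lemma sum_triples_rotate: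
  "(\<Sum>v\<in>S. \<Sum>x\<in>S. \<Sum>y\<in>S. f x y v) = (\<Sum>v\<in>S. \<Sum>x\<in>S. \<Sum>y\<in>S. (f v x y :: nat))"
proof -
  have "(\<Sum>v\<in>S. \<Sum>x\<in>S. \<Sum>y\<in>S. f x y v) = (\<Sum>x\<in>S. \<Sum>v\<in>S. \<Sum>y\<in>S. f x y v)"
    by (rule sum.swap)
  also have "\<dots> = (\<Sum>x\<in>S. \<Sum>y\<in>S. \<Sum>v\<in>S. f x y v)"
    by (intro sum.cong refl sum.swap)
  finally show ?thesis .
qed

text \<open>Each bad triangle contains a pair on which the reference clustering errs.\<close>

lemma bad_triangles_le:
  fixes \<omega> :: "nat \<Rightarrow> nat"
  assumes sym: "\<And>x y. same x y \<Longrightarrow> same y x" and trans: "\<And>x y z. same x y \<Longrightarrow> same y z \<Longrightarrow> same x z"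
  shows "(\<Sum>v\<in>S. \<Sum>x\<in>S. \<Sum>y\<in>S. \<omega> v * \<omega> x * \<omega> y * of_bool (bad_triangle E v x y)) \<le>
    3 * (\<Sum>v\<in>S. \<Sum>x\<in>S. \<Sum>y\<in>S. \<omega> v * \<omega> x * \<omega> y *
      of_bool (bad_triangle E v x y \<and> ({x, y} \<in> E) \<noteq> same x y))"
proof -
  define f where "f v x y = \<omega> v * \<omega> x * \<omega> y *
      of_bool (bad_triangle E v x y \<and> ({x, y} \<in> E) \<noteq> same x y)" for v x y
  have bad: "bad_triangle E x y v = bad_triangle E v x y" for v x y
    by (auto simp: bad_triangle_def insert_commute add_ac)
  have "\<omega> v * \<omega> x * \<omega> y * of_bool (bad_triangle E v x y) \<le> f v x y + f x y v + f y v x" for v x y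
  proof (cases "bad_triangle E v x y")
    case True
    \<comment> \<open>If \<open>same\<close> agreed with \<open>E\<close> on all three pairs, it
      would hold on exactly two of them, against transitivity.\<close>
    have "same x y \<and> same y v \<longrightarrow> same v x" "same y v \<and> same v x \<longrightarrow> same x y"
      "same v x \<and> same x y \<longrightarrow> same y v"
      by (metis sym trans)+
    moreover have "{v, y} = {y, v}" by auto
    ultimately have "({x, y} \<in> E) \<noteq> same x y \<or> ({y, v} \<in> E) \<noteq> same y v \<or> ({v, x} \<in> E) \<noteq> same v x"
      using True by (cases "same x y"; cases "same y v"; cases "same v x")
        (auto simp: bad_triangle_def of_bool_def split: if_splits)
    moreover have "bad_triangle E x y v" "bad_triangle E y v x"
      using True bad[of v x y] bad[of y v x] by simp_all
    ultimately show ?thesis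
      using True by (auto simp: f_def mult_ac)
  qed simp
  then have "(\<Sum>v\<in>S. \<Sum>x\<in>S. \<Sum>y\<in>S. \<omega> v * \<omega> x * \<omega> y * of_bool (bad_triangle E v x y)) \<le>
      (\<Sum>v\<in>S. \<Sum>x\<in>S. \<Sum>y\<in>S. f v x y + f x y v + f y v x)"
    by (intro sum_mono)
  also have "\<dots> = (\<Sum>v\<in>S. \<Sum>x\<in>S. \<Sum>y\<in>S. f v x y) + (\<Sum>v\<in>S. \<Sum>x\<in>S. \<Sum>y\<in>S. f x y v) +
      (\<Sum>v\<in>S. \<Sum>x\<in>S. \<Sum>y\<in>S. f y v x)"
    by (simp add: sum.distrib)
  also have "\<dots> = 3 * (\<Sum>v\<in>S. \<Sum>x\<in>S. \<Sum>y\<in>S. f v x y)"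
    using sum_triples_rotate[of f S] sum_triples_rotate[of "\<lambda>v x y. f x y v" S] by simp
  finally show ?thesis unfolding f_def .
qed

text \<open>Weighting the pivot by \<open>\<omega> v\<close> turns the balance of single pairs into
  sums over ordered triples with the symmetric weight
  \<open>\<omega> v * \<omega> x * \<omega> y\<close>. There \<open>bad_triangles_le\<close> covers
  the losses \<open>?B\<close> by the released \<open>3 * ?D\<close>.\<close>

lemma charge_pivot_le:
  fixes \<omega> :: "nat \<Rightarrow> nat"
  assumes sym: "\<And>x y. same x y \<Longrightarrow> same y x" and trans: "\<And>x y z. same x y \<Longrightarrow> same y z \<Longrightarrow> same x z"
    and fresh: "\<And>v u. v < n \<Longrightarrow> u < n \<Longrightarrow> l v = 0 \<Longrightarrow> l u \<noteq> Suc v"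
  shows "(\<Sum>v | v < n \<and> l v = 0. \<omega> v * charge n E \<omega> same (pivot_label E v l)) \<le>
    (\<Sum>v | v < n \<and> l v = 0. \<omega> v * charge n E \<omega> same l)"
proof -
  define S where "S = {v. v < n \<and> l v = 0}"
  have S: "finite S" "S \<subseteq> {..<n}" by (auto simp: S_def)
  let ?b = "\<lambda>v x y. of_bool (bad_triangle E v x y) :: nat"
  let ?d = "\<lambda>v x y. of_bool (bad_triangle E v x y \<and> ({x, y} \<in> E) \<noteq> same x y) :: nat"
  \<comment> \<open>The diagonal can be added because \<open>h\<close> vanishes on it; the index
    sets then match those of the triple sums.\<close>
  have pairs: "(\<Sum>x<n. \<Sum>y\<in>{..<n} - {x}. \<omega> x * \<omega> y * (if l x = 0 \<and> l y = 0 then h x y else 0)) =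
      (\<Sum>x\<in>S. \<Sum>y\<in>S. \<omega> x * \<omega> y * h x y)" if h: "\<And>x. h x x = 0" for h :: "nat \<Rightarrow> nat \<Rightarrow> nat"
  proof -
    have "(\<Sum>x<n. \<Sum>y\<in>{..<n} - {x}. \<omega> x * \<omega> y * (if l x = 0 \<and> l y = 0 then h x y else 0)) =
       (\<Sum>x<n. \<Sum>y<n. \<omega> x * \<omega> y * (if l x = 0 \<and> l y = 0 then h x y else 0))"
      using h by (intro sum.cong refl sum.mono_neutral_left) auto
    also have "\<dots> = (\<Sum>x\<in>S. \<Sum>y<n. \<omega> x * \<omega> y * (if l x = 0 \<and> l y = 0 then h x y else 0))"
      using S by (intro sum.mono_neutral_right) (auto simp: S_def)
    also have "\<dots> = (\<Sum>x\<in>S. \<Sum>y\<in>S. \<omega> x * \<omega> y * (if l x = 0 \<and> l y = 0 then h x y else 0))"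
      using S by (intro sum.cong refl sum.mono_neutral_right) (auto simp: S_def)
    finally show ?thesis by (simp add: S_def)
  qed
  have step: "charge n E \<omega> same (pivot_label E v l) + 3 * (\<Sum>x\<in>S. \<Sum>y\<in>S. \<omega> x * \<omega> y * ?d v x y) \<le>
      charge n E \<omega> same l + (\<Sum>x\<in>S. \<Sum>y\<in>S. \<omega> x * \<omega> y * ?b v x y)" if v: "v \<in> S" for v
  proof -
    have "3 * (\<Sum>x\<in>S. \<Sum>y\<in>S. \<omega> x * \<omega> y * ?d v x y) =
       (\<Sum>x\<in>S. \<Sum>y\<in>S. \<omega> x * \<omega> y * (3 * ?d v x y))"
      by (simp add: sum_distrib_left mult_ac)
    also have "\<dots> = (\<Sum>x<n. \<Sum>y\<in>{..<n} - {x}. \<omega> x * \<omega> y * (if l x = 0 \<and> l y = 0 then 3 * ?d v x y else 0))"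
      by (rule pairs[symmetric]) (simp add: bad_triangle_def)
    finally have d: "3 * (\<Sum>x\<in>S. \<Sum>y\<in>S. \<omega> x * \<omega> y * ?d v x y) =
      (\<Sum>x<n. \<Sum>y\<in>{..<n} - {x}. \<omega> x * \<omega> y * (if l x = 0 \<and> l y = 0 then 3 * ?d v x y else 0))" .
    have b: "(\<Sum>x\<in>S. \<Sum>y\<in>S. \<omega> x * \<omega> y * ?b v x y) =
      (\<Sum>x<n. \<Sum>y\<in>{..<n} - {x}. \<omega> x * \<omega> y * (if l x = 0 \<and> l y = 0 then ?b v x y else 0))"
      by (rule pairs[symmetric]) (simp add: bad_triangle_def)
    show ?thesis
      unfolding d b charge_def sum.distrib[symmetric] distrib_left[symmetric]
    proof (intro sum_mono mult_left_mono pair_charge_pivot_label)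
      fix x y assume xy: "x \<in> {..<n}" "y \<in> {..<n} - {x}"
      have v: "v < n" "l v = 0" using v by (auto simp: S_def)
      show "l v = 0" by (fact v)
      show "l x \<noteq> Suc v" "l y \<noteq> Suc v" by (rule fresh[OF v(1) _ v(2)]; use xy in simp)+
      show "x \<noteq> y" using xy by auto
    qed simp
  qed
  let ?B = "\<Sum>v\<in>S. \<Sum>x\<in>S. \<Sum>y\<in>S. \<omega> v * \<omega> x * \<omega> y * ?b v x y"
  let ?D = "\<Sum>v\<in>S. \<Sum>x\<in>S. \<Sum>y\<in>S. \<omega> v * \<omega> x * \<omega> y * ?d v x y"
  have "(\<Sum>v\<in>S. \<omega> v * charge n E \<omega> same (pivot_label E v l)) + 3 * ?D =
    (\<Sum>v\<in>S. \<omega> v * (charge n E \<omega> same (pivot_label E v l) + 3 * (\<Sum>x\<in>S. \<Sum>y\<in>S. \<omega> x * \<omega> y * ?d v x y)))"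
    by (simp add: sum.distrib sum_distrib_left distrib_left mult_ac)
  also have "\<dots> \<le> (\<Sum>v\<in>S. \<omega> v * (charge n E \<omega> same l + (\<Sum>x\<in>S. \<Sum>y\<in>S. \<omega> x * \<omega> y * ?b v x y)))"
    by (intro sum_mono mult_left_mono step) auto
  also have "\<dots> = (\<Sum>v\<in>S. \<omega> v * charge n E \<omega> same l) + ?B"
    by (simp add: sum.distrib sum_distrib_left distrib_left mult_ac)
  also have "?B \<le> 3 * ?D" by (rule bad_triangles_le[OF sym trans])
  finally show ?thesis unfolding S_def by simp
qed

section \<open>Random loops that choose pivots\<close>

text \<open>
  The word \<open>r\<close> drawn in an iteration makes \<open>pv r\<close> the next pivot, if any, and a fraction of at
  least \<open>1 / D\<close> of the words decreases \<open>prog\<close>. The potential \<open>pay\<close> amortizes the running time.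
\<close>

locale pivot_loop =
  fixes n :: nat and E :: "nat set set" and \<omega> :: "nat \<Rightarrow> nat"
    and g :: "'s \<Rightarrow> bool" and body :: "'s \<Rightarrow> ('s \<times> nat) spmf"
    and Inv :: "'s \<Rightarrow> bool" and lab :: "'s \<Rightarrow> nat \<Rightarrow> nat" and prog pay :: "'s \<Rightarrow> nat"
    and N D c0 :: nat
  assumes N_pos: "0 < N" and D_pos: "0 < D"
    and step: "Inv s \<Longrightarrow> g s \<Longrightarrow> \<exists>st tm pv q.
      body s = map_spmf (\<lambda>r. (st r, tm r)) (spmf_of_set {0..<N}) \<and>
      (\<forall>r<N. Inv (st r) \<and> 1 + tm r + pay (st r) \<le> pay s + c0 \<and> prog (st r) \<le> prog s \<and>
         (case pv r of None \<Rightarrow> lab (st r) = lab s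
          | Some v \<Rightarrow> v < n \<and> lab s v = 0 \<and> lab (st r) = pivot_label E v (lab s))) \<and>
      (\<forall>v<n. lab s v = 0 \<longrightarrow> card {r. r < N \<and> pv r = Some v} = q * \<omega> v) \<and>
      N \<le> D * card {r. r < N \<and> prog (st r) < prog s}"
    and fresh: "Inv s \<Longrightarrow> v < n \<Longrightarrow> u < n \<Longrightarrow> lab s v = 0 \<Longrightarrow> lab s u \<noteq> Suc v"
begin

lemma Inv_step: "Inv s \<Longrightarrow> g s \<Longrightarrow> (s1, t1) \<in> set_spmf (body s) \<Longrightarrow> Inv s1"
  using step[of s] N_pos by fastforce

lemma lossless_step: "Inv s \<Longrightarrow> g s \<Longrightarrow> lossless_spmf (body s)"
  using step[of s] N_pos by auto

text \<open>Grouping the words by the pivot they choose gives each unlabelled \<open>v\<close>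
  exactly \<open>q * \<omega> v\<close> words, which is the weighting of
  \<open>charge_pivot_le\<close>. Words without a pivot leave the charge as it is.\<close>

lemma charge_step:
  fixes same :: "nat \<Rightarrow> nat \<Rightarrow> bool"
  assumes s: "Inv s" "g s"
    and sym: "\<And>x y. same x y \<Longrightarrow> same y x" and trans: "\<And>x y z. same x y \<Longrightarrow> same y z \<Longrightarrow> same x z"
  shows "(\<integral>\<^sup>+ (s1, t1). of_nat (charge n E \<omega> same (lab s1)) \<partial>measure_spmf (body s)) \<le>
    of_nat (charge n E \<omega> same (lab s))"
proof -
  obtain st tm pv q where body: "body s = map_spmf (\<lambda>r. (st r, tm r)) (spmf_of_set {0..<N})"
    and lab: "\<And>r. r < N \<Longrightarrow> case pv r of None \<Rightarrow> lab (st r) = lab s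
          | Some v \<Rightarrow> v < n \<and> lab s v = 0 \<and> lab (st r) = pivot_label E v (lab s)"
    and card: "\<And>v. v < n \<Longrightarrow> lab s v = 0 \<Longrightarrow> card {r. r < N \<and> pv r = Some v} = q * \<omega> v"
    using step[OF s] by (elim exE conjE) (rule that, assumption, blast, blast)
  define S where "S = {v. v < n \<and> lab s v = 0}"
  define c where "c = charge n E \<omega> same (lab s)"
  define f where "f p = (case p of None \<Rightarrow> c | Some v \<Rightarrow> charge n E \<omega> same (pivot_label E v (lab s)))" for p
  \<comment> \<open>Stated for every \<open>h\<close>, since it is used twice: for the charge after
    the step, and for the constant \<open>c\<close>, which reassembles \<open>N * c\<close>.\<close>
  have split: "(\<Sum>r<N. h (pv r)) = card {r. r < N \<and> pv r = None} * h None + (\<Sum>v\<in>S. q * \<omega> v * h (Some v))"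
    for h :: "nat option \<Rightarrow> nat"
  proof -
    have T: "pv ` {..<N} \<subseteq> insert None (Some ` S)"
    proof
      fix p assume "p \<in> pv ` {..<N}"
      then obtain r where r: "r < N" "p = pv r" by auto
      show "p \<in> insert None (Some ` S)"
        using lab[OF r(1)] unfolding r(2) S_def by (cases "pv r") simp_all
    qed
    have "(\<Sum>r<N. h (pv r)) = (\<Sum>p\<in>insert None (Some ` S). \<Sum>r | r \<in> {..<N} \<and> pv r = p. h (pv r))"
      using T by (subst sum.group) (auto simp: S_def)
    also have "\<dots> = (\<Sum>p\<in>insert None (Some ` S). card {r. r < N \<and> pv r = p} * h p)"
      by (intro sum.cong) auto
    also have "\<dots> = card {r. r < N \<and> pv r = None} * h None + (\<Sum>v\<in>S. card {r. r < N \<and> pv r = Some v} * h (Some v))"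
      by (subst sum.insert) (auto simp: S_def sum.reindex)
    finally show ?thesis using card by (simp add: S_def)
  qed
  have "(\<Sum>r<N. charge n E \<omega> same (lab (st r))) = (\<Sum>r<N. f (pv r))"
  proof (intro sum.cong refl)
    fix r assume "r \<in> {..<N}"
    then have "r < N" by simp
    from lab[OF this] show "charge n E \<omega> same (lab (st r)) = f (pv r)"
      unfolding f_def c_def by (cases "pv r") simp_all
  qed
  also have "\<dots> = card {r. r < N \<and> pv r = None} * c +
      q * (\<Sum>v\<in>S. \<omega> v * charge n E \<omega> same (pivot_label E v (lab s)))"
    unfolding split by (simp add: f_def sum_distrib_left mult_ac)
  also have "\<dots> \<le> card {r. r < N \<and> pv r = None} * c + q * (\<Sum>v\<in>S. \<omega> v * c)"
  proof (intro add_left_mono mult_left_mono)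
    show "(\<Sum>v\<in>S. \<omega> v * charge n E \<omega> same (pivot_label E v (lab s))) \<le> (\<Sum>v\<in>S. \<omega> v * c)"
      unfolding S_def c_def
    proof (rule charge_pivot_le)
      show "same y x" if "same x y" for x y using that by (rule sym)
      show "same x z" if "same x y" "same y z" for x y z using that by (rule trans)
      show "lab s u \<noteq> Suc v" if "v < n" "u < n" "lab s v = 0" for v u using s(1) that by (rule fresh)
    qed
  qed simp
  also have "\<dots> = (\<Sum>r<N. c)"
    unfolding split[of "\<lambda>_. c"] by (simp add: sum_distrib_left mult_ac)
  finally have le: "(\<Sum>r<N. charge n E \<omega> same (lab (st r))) \<le> N * c" by simp
  have "(\<integral>\<^sup>+ (s1, t1). of_nat (charge n E \<omega> same (lab s1)) \<partial>measure_spmf (body s)) =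
    of_nat (\<Sum>r<N. charge n E \<omega> same (lab (st r))) / of_nat N"
    unfolding body by (simp add: nn_integral_spmf_of_set atLeast0LessThan)
  also have "\<dots> \<le> of_nat (N * c) / of_nat N"
    using le by (intro divide_right_mono_ennreal) (simp only: of_nat_le_iff)
  also have "\<dots> = of_nat c"
    using N_pos by (simp add: ennreal_of_nat_eq_real_of_nat divide_ennreal flip: ennreal_mult)
  finally show ?thesis unfolding c_def .
qed

lemma expected_charge_le:
  assumes s: "Inv s"
    and sym: "\<And>x y. same x y \<Longrightarrow> same y x" and trans: "\<And>x y z. same x y \<Longrightarrow> same y z \<Longrightarrow> same x z"
    and final: "\<And>s. Inv s \<Longrightarrow> \<not> g s \<Longrightarrow> F s \<le> of_nat (charge n E \<omega> same (lab s))"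
  shows "(\<integral>\<^sup>+ (s', t'). F s' \<partial>measure_spmf (loop g body s)) \<le> of_nat (charge n E \<omega> same (lab s))"
  by (rule nn_integral_loop_le[where \<Phi> = "\<lambda>s t. of_nat (charge n E \<omega> same (lab s))" and P = Inv
        and F = "\<lambda>s t. F s"])
     (use s charge_step[OF _ _ sym trans] final in \<open>auto intro: Inv_step\<close>)

text \<open>At least \<open>N / D\<close> words lower \<open>prog\<close> and thereby at least halve
  \<open>2 ^ prog\<close>; no word raises it. So the mean shrinks by
  \<open>1 - (1 / D) * (1 / 2)\<close>.\<close>

lemma prog_step:
  assumes s: "Inv s" "g s"
  obtains st tm where "body s = map_spmf (\<lambda>r. (st r, tm r)) (spmf_of_set {0..<N})"
    "\<And>r. r < N \<Longrightarrow> 1 + tm r + pay (st r) \<le> pay s + c0"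
    "(\<Sum>r<N. (2::real) ^ prog (st r)) \<le> N * ((1 - 1 / (2 * real D)) * 2 ^ prog s)"
proof -
  obtain st tm pv q where body: "body s = map_spmf (\<lambda>r. (st r, tm r)) (spmf_of_set {0..<N})"
    and pay: "\<And>r. r < N \<Longrightarrow> 1 + tm r + pay (st r) \<le> pay s + c0"
    and prog: "\<And>r. r < N \<Longrightarrow> prog (st r) \<le> prog s"
    and card: "N \<le> D * card {r. r < N \<and> prog (st r) < prog s}"
    using step[OF s] by (elim exE conjE) (rule that, assumption, blast, blast, assumption)
  let ?A = "{r. r < N \<and> prog (st r) < prog s}"
  have "(2::real) ^ prog (st r) \<le> 2 ^ prog s - of_bool (r \<in> ?A) * (2 ^ prog s / 2)" if r: "r < N" for r
  proof (cases "r \<in> ?A")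
    case True
    then have "(2::real) ^ Suc (prog (st r)) \<le> 2 ^ prog s"
      by (intro power_increasing) auto
    then show ?thesis using True by simp
  next
    case False
    then show ?thesis using prog[OF r] by simp
  qed
  then have "(\<Sum>r<N. (2::real) ^ prog (st r)) \<le>
      (\<Sum>r<N. 2 ^ prog s - of_bool (r \<in> ?A) * (2 ^ prog s / 2))"
    by (intro sum_mono) auto
  also have "\<dots> = real N * 2 ^ prog s - (\<Sum>r<N. of_bool (r \<in> ?A)) * (2 ^ prog s / 2)"
    unfolding sum_subtractf sum_distrib_right by simp
  also have "(\<Sum>r<N. of_bool (r \<in> ?A)) = real (card ?A)"
    by (simp add: sum_of_bool_eq) (rule arg_cong[of _ _ card], auto)
  also have "real N * 2 ^ prog s - real (card ?A) * (2 ^ prog s / 2) \<le>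
      real N * 2 ^ prog s - real N / real D * (2 ^ prog s / 2)"
  proof -
    have "real N \<le> real D * real (card ?A)"
      using card by (metis of_nat_le_iff of_nat_mult)
    then have "real N / real D \<le> real (card ?A)"
      using D_pos by (simp add: field_simps)
    then show ?thesis by (intro diff_left_mono mult_right_mono) auto
  qed
  also have "\<dots> = N * ((1 - 1 / (2 * real D)) * 2 ^ prog s)"
    using D_pos by (simp add: field_simps)
  finally show ?thesis using that body pay by blast
qed

lemma lossless: 
  assumes "Inv s"
  shows "lossless_spmf (loop g body s)"
proof (rule lossless_loop[where \<Phi> = "\<lambda>s. ennreal (2 ^ prog s)" and \<beta> = "1 - 1 / (2 * real D)" and P = Inv])
  fix s assume s: "Inv s" "g s"
  obtain st tm where body: "body s = map_spmf (\<lambda>r. (st r, tm r)) (spmf_of_set {0..<N})"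
    and le: "(\<Sum>r<N. (2::real) ^ prog (st r)) \<le> N * ((1 - 1 / (2 * real D)) * 2 ^ prog s)"
    by (rule prog_step[OF s])
  have "(\<integral>\<^sup>+ (s1, t1). ennreal (2 ^ prog s1) \<partial>measure_spmf (body s)) =
      ennreal ((\<Sum>r<N. 2 ^ prog (st r)) / N)"
    unfolding body using N_pos
    by (simp add: nn_integral_spmf_of_set atLeast0LessThan ennreal_of_nat_eq_real_of_nat sum_nonneg
        divide_ennreal)
  also have "\<dots> \<le> ennreal ((1 - 1 / (2 * real D)) * 2 ^ prog s)"
    using le N_pos by (intro ennreal_leI) (simp add: field_simps)
  also have "\<dots> = ennreal (1 - 1 / (2 * real D)) * ennreal (2 ^ prog s)"
    using D_pos by (intro ennreal_mult) auto
  finally show "(\<integral>\<^sup>+ (s1, t1). ennreal (2 ^ prog s1) \<partial>measure_spmf (body s)) \<le>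
      ennreal (1 - 1 / (2 * real D)) * ennreal (2 ^ prog s)" .
next
  show "0 \<le> 1 - 1 / (2 * real D)" "1 - 1 / (2 * real D) < 1" using D_pos by auto
qed (use assms in \<open>auto intro: Inv_step lossless_step\<close>)

text \<open>Markov's inequality for an exponential of the time. An iteration multiplies
  \<open>z ^ (t + pay s)\<close> by at most \<open>z ^ c0\<close>, and the condition on
  \<open>z\<close> balances this against the shrinking mean of \<open>2 ^ prog\<close>.\<close>

lemma time_tail:
  fixes z :: real
  assumes s: "Inv s" and z: "1 \<le> z" "z ^ c0 * (1 - 1 / (2 * real D)) \<le> 1"
  shows "measure (measure_spmf (loop g body s)) {(s', t'). T < t'} * z ^ T \<le> z ^ pay s * 2 ^ prog s"
proof -
  let ?\<Phi> = "\<lambda>s t. ennreal (z ^ (t + pay s) * 2 ^ prog s)"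
  \<comment> \<open>The exponent is lowered by one because the last evaluation of the guard is not
    covered by the potential; the strict inequality \<open>T < t'\<close> makes up for it.\<close>
  have int: "(\<integral>\<^sup>+ (s', t'). ennreal (z ^ (0 + t' - 1)) \<partial>measure_spmf (loop g body s)) \<le> ?\<Phi> s 0"
  proof (rule nn_integral_loop_le[where \<Phi> = ?\<Phi> and P = Inv and F = "\<lambda>s t. ennreal (z ^ (t - 1))"])
    fix s t assume s: "Inv s" "g s"
    obtain st tm where body: "body s = map_spmf (\<lambda>r. (st r, tm r)) (spmf_of_set {0..<N})"
      and pay: "\<And>r. r < N \<Longrightarrow> 1 + tm r + pay (st r) \<le> pay s + c0"
      and le: "(\<Sum>r<N. (2::real) ^ prog (st r)) \<le> N * ((1 - 1 / (2 * real D)) * 2 ^ prog s)"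
    proof (rule prog_step[OF s])
      fix st tm
      assume "body s = map_spmf (\<lambda>r. (st r, tm r)) (spmf_of_set {0..<N})"
        "\<And>r. r < N \<Longrightarrow> 1 + tm r + pay (st r) \<le> pay s + c0"
        "(\<Sum>r<N. (2::real) ^ prog (st r)) \<le> N * ((1 - 1 / (2 * real D)) * 2 ^ prog s)"
      then show thesis by (rule that[of st tm])
    qed
    have "(\<Sum>r<N. z ^ (1 + t + tm r + pay (st r)) * 2 ^ prog (st r)) \<le>
        (\<Sum>r<N. z ^ (t + pay s + c0) * 2 ^ prog (st r))"
      using pay z by (intro sum_mono mult_right_mono power_increasing) (auto simp: add_ac)
    also have "\<dots> = z ^ (t + pay s + c0) * (\<Sum>r<N. 2 ^ prog (st r))"
      by (simp add: sum_distrib_left)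
    also have "\<dots> \<le> z ^ (t + pay s + c0) * (N * ((1 - 1 / (2 * real D)) * 2 ^ prog s))"
      using z by (intro mult_left_mono le) auto
    also have "\<dots> = (z ^ c0 * (1 - 1 / (2 * real D))) * (N * z ^ (t + pay s) * 2 ^ prog s)"
      by (simp add: power_add)
    also have "\<dots> \<le> 1 * (N * z ^ (t + pay s) * 2 ^ prog s)"
      using z by (intro mult_right_mono) auto
    finally have le: "(\<Sum>r<N. z ^ (1 + t + tm r + pay (st r)) * 2 ^ prog (st r)) / N
        \<le> z ^ (t + pay s) * 2 ^ prog s"
      using N_pos by (simp add: field_simps)
    have "(\<integral>\<^sup>+ (s1, t1). ?\<Phi> s1 (1 + t + t1) \<partial>measure_spmf (body s)) =
       ennreal ((\<Sum>r<N. z ^ (1 + t + tm r + pay (st r)) * 2 ^ prog (st r)) / N)"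
      unfolding body using N_pos z
      by (simp add: nn_integral_spmf_of_set atLeast0LessThan ennreal_of_nat_eq_real_of_nat sum_nonneg
          divide_ennreal)
    also have "\<dots> \<le> ?\<Phi> s t" by (intro ennreal_leI le)
    finally show "(\<integral>\<^sup>+ (s1, t1). ?\<Phi> s1 (1 + t + t1) \<partial>measure_spmf (body s)) \<le> ?\<Phi> s t" .
  next
    fix s t
    have "z ^ t * 1 \<le> z ^ (t + pay s) * 2 ^ prog s"
      using z by (intro mult_mono power_increasing) auto
    then show "ennreal (z ^ (1 + t - 1)) \<le> ?\<Phi> s t" by (intro ennreal_leI) simp
  qed (use s in \<open>auto intro: Inv_step\<close>)
  let ?M = "measure_spmf (loop g body s)"
  have "ennreal (measure ?M {(s', t'). T < t'} * z ^ T) =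
      (\<integral>\<^sup>+ x. ennreal (z ^ T) * indicator {(s', t'). T < t'} x \<partial>?M)"
    using z by (simp add: nn_integral_cmult_indicator measure_spmf.emeasure_eq_measure ennreal_mult mult.commute)
  also have "\<dots> \<le> (\<integral>\<^sup>+ (s', t'). ennreal (z ^ (0 + t' - 1)) \<partial>?M)"
    using z by (intro nn_integral_mono) (auto split: split_indicator intro!: ennreal_leI power_increasing)
  also have "\<dots> \<le> ennreal (z ^ pay s * 2 ^ prog s)" using int by simp
  finally show ?thesis using z by (subst (asm) ennreal_le_iff) auto
qed

end

section \<open>The program\<close>

lemma runs_SkipI: "Q s 1 \<Longrightarrow> runs w Skip s Q"
  by (simp add: runs_Skip)

lemma runs_AssignI: "Q (s\<lparr>reg := (reg s)(x := eval w s e)\<rparr>) 1 \<Longrightarrow> runs w (Assign x e) s Q"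
  by (simp add: runs_def)

lemma runs_StoreI:
  "Q (s\<lparr>arr := (arr s)(a := (arr s a)(eval w s i := eval w s e))\<rparr>) 1 \<Longrightarrow> runs w (Store a i e) s Q"
  by (simp add: runs_def)

lemmas runs_intros = runs_Seq runs_SkipI runs_AssignI runs_StoreI

lemma runs_CondI:
  assumes "eval w s e \<noteq> 0 \<Longrightarrow> runs w p s (\<lambda>s' t. Q s' (1 + t))"
    and "eval w s e = 0 \<Longrightarrow> runs w q s (\<lambda>s' t. Q s' (1 + t))"
  shows "runs w (Cond e p q) s Q"
  using assms by (auto simp: runs_def split: if_splits)

section \<open>Bit lengths of weights\<close>

fun bit_length :: "nat \<Rightarrow> nat" where
  "bit_length m = (if m = 0 then 0 else Suc (bit_length (m div 2)))"

declare bit_length.simps [simp del]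

lemma bit_length_0 [simp]: "bit_length 0 = 0"
  by (simp add: bit_length.simps)

lemma bit_length_pos: "0 < m \<Longrightarrow> bit_length m = Suc (bit_length (m div 2))"
  by (simp add: bit_length.simps[of m])

lemma less_power_bit_length: "m < 2 ^ bit_length m"
proof (induction m rule: bit_length.induct)
  case (1 m)
  then show ?case by (cases "m = 0") (auto simp: bit_length_pos)
qed

lemma power_bit_length_le: "0 < m \<Longrightarrow> 2 ^ bit_length m \<le> 2 * m"
proof (induction m rule: bit_length.induct)
  case (1 m)
  then show ?case
    by (cases "m = 1") (auto simp: bit_length_pos)
qed

lemma bit_length_mono: "k \<le> m \<Longrightarrow> bit_length k \<le> bit_length m"
proof (induction m arbitrary: k rule: bit_length.induct)
  case (1 m)
  show ?case
  proof (cases "k = 0")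
    case False
    then have "bit_length (k div 2) \<le> bit_length (m div 2)"
      using 1 by (intro "1.IH") (auto intro: div_le_mono)
    then show ?thesis using False 1 by (simp add: bit_length_pos)
  qed simp
qed

lemma bit_length_double: "0 < m \<Longrightarrow> bit_length (2 * m) = Suc (bit_length m)"
  by (simp add: bit_length_pos[of "2 * m"])

text \<open>Dividing by \<open>2 ^ k\<close> drops \<open>k\<close> digits at once. This lets the
  class of a weight be found by few divisions by a large base and one table lookup.\<close>

lemma bit_length_div_power: "2 ^ k \<le> m \<Longrightarrow> bit_length m = k + bit_length (m div 2 ^ k)"
proof (induction k arbitrary: m)
  case (Suc k)
  have "0 < m" using Suc.prems by (intro gr0I) simp
  moreover have "2 ^ k \<le> m div 2" using Suc.prems by simp
  then have "bit_length (m div 2) = k + bit_length (m div 2 div 2 ^ k)" by (rule Suc.IH)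
  ultimately show ?case by (simp add: bit_length_pos[of m] div_mult2_eq)
qed simp

lemma bit_length_le: "m < 2 ^ k \<Longrightarrow> bit_length m \<le> k"
proof (induction k arbitrary: m)
  case (Suc k)
  then have "bit_length (m div 2) \<le> k" by auto
  then show ?case by (cases "m = 0") (auto simp: bit_length_pos)
qed simp

section \<open>Registers and arrays of the program\<close>

abbreviation (input) x_n :: nat where "x_n \<equiv> 0"
abbreviation (input) x_base :: nat where "x_base \<equiv> 1"
abbreviation (input) x_bits :: nat where "x_bits \<equiv> 2"
abbreviation (input) x_classes :: nat where "x_classes \<equiv> 3"
abbreviation (input) x_i :: nat where "x_i \<equiv> 4"
abbreviation (input) x_x :: nat where "x_x \<equiv> 5"
abbreviation (input) x_j :: nat where "x_j \<equiv> 6"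
abbreviation (input) x_mass :: nat where "x_mass \<equiv> 7"
abbreviation (input) x_old_mass :: nat where "x_old_mass \<equiv> 8"
abbreviation (input) x_grain :: nat where "x_grain \<equiv> 9"
abbreviation (input) x_cells :: nat where "x_cells \<equiv> 10"
abbreviation (input) x_range :: nat where "x_range \<equiv> 11"
abbreviation (input) x_quot :: nat where "x_quot \<equiv> 12"
abbreviation (input) x_r :: nat where "x_r \<equiv> 13"
abbreviation (input) x_v :: nat where "x_v \<equiv> 14"

abbreviation (input) a_weight :: nat where "a_weight \<equiv> 0"
abbreviation (input) a_off :: nat where "a_off \<equiv> 1"
abbreviation (input) a_nbr :: nat where "a_nbr \<equiv> 2"
abbreviation (input) a_label :: nat where "a_label \<equiv> 3"
abbreviation (input) a_bits :: nat where "a_bits \<equiv> 4"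
abbreviation (input) a_count :: nat where "a_count \<equiv> 5"
abbreviation (input) a_slot :: nat where "a_slot \<equiv> 6"
abbreviation (input) a_width :: nat where "a_width \<equiv> 7"
abbreviation (input) a_start :: nat where "a_start \<equiv> 8"
abbreviation (input) a_cell :: nat where "a_cell \<equiv> 9"

abbreviation seq (infixr ";;" 50) where "p ;; q \<equiv> Seq p q"
abbreviation add (infixl "+\<^sub>e" 65) where "e +\<^sub>e f \<equiv> Bin Add e f"
abbreviation sub (infixl "-\<^sub>e" 65) where "e -\<^sub>e f \<equiv> Bin Sub e f"
abbreviation mul (infixl "*\<^sub>e" 70) where "e *\<^sub>e f \<equiv> Bin Mul e f"
abbreviation quot (infixl "div\<^sub>e" 70) where "e div\<^sub>e f \<equiv> Bin Div e f"
abbreviation rest (infixl "mod\<^sub>e" 70) where "e mod\<^sub>e f \<equiv> Bin Mod e f"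
abbreviation less (infix "<\<^sub>e" 50) where "e <\<^sub>e f \<equiv> Bin Less e f"

section \<open>Word arithmetic without overflow\<close>

lemma eval_Const: "k < 2 ^ w \<Longrightarrow> eval w s (Const k) = k"
  by simp

lemma eval_add: "eval w s e + eval w s f < 2 ^ w \<Longrightarrow> eval w s (e +\<^sub>e f) = eval w s e + eval w s f"
  by simp

lemma eval_mul: "eval w s e * eval w s f < 2 ^ w \<Longrightarrow> eval w s (e *\<^sub>e f) = eval w s e * eval w s f"
  by simp

lemma eval_sub:
  assumes "eval w s f \<le> eval w s e" "eval w s e < 2 ^ w"
  shows "eval w s (e -\<^sub>e f) = eval w s e - eval w s f"
proof -
  have "int (eval w s e) - int (eval w s f) = int (eval w s e - eval w s f)"
    using assms by (simp add: of_nat_diff)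
  moreover have "int (eval w s e - eval w s f) mod 2 ^ w = int ((eval w s e - eval w s f) mod 2 ^ w)"
    by (simp add: zmod_int)
  ultimately show ?thesis using assms by simp
qed

text \<open>The program does not know \<open>w\<close>, so the largest word is no constant of it;
  wrapping around below zero produces it.\<close>

lemma eval_minus_one:
  assumes "(1::nat) < 2 ^ w"
  shows "eval w s (Const 0 -\<^sub>e Const 1) = 2 ^ w - 1"
proof -
  have "(- 1 :: int) mod 2 ^ w = (- 1 + 2 ^ w) mod 2 ^ w" by simp
  also have "\<dots> = 2 ^ w - 1" by (subst mod_pos_pos_trivial) auto
  finally have "(- 1 :: int) mod 2 ^ w = 2 ^ w - 1" .
  moreover have "nat (2 ^ w - 1) = 2 ^ w - 1" by (simp add: nat_diff_distrib nat_power_eq)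
  ultimately show ?thesis using assms by simp
qed

lemma eval_div: "eval w s (e div\<^sub>e f) = eval w s e div eval w s f"
  and eval_mod: "eval w s (e mod\<^sub>e f) = eval w s e mod eval w s f"
  and eval_less: "eval w s (e <\<^sub>e f) = of_bool (eval w s e < eval w s f)"
  and eval_equal: "eval w s (Bin Equal e f) = of_bool (eval w s e = eval w s f)"
  by simp_all

text \<open>With the modular equations withdrawn from the simplifier, additions, products and
  ordinary differences are evaluated only once their bounds are established.\<close>

lemmas eval_rules = eval_Const eval_add eval_mul eval_sub eval_minus_one[unfolded One_nat_def]
  eval_div eval_mod eval_less eval_equal

declare eval.simps(1,4) [simp del]

text \<open>Doubling stops at the first value above \<open>n\<close>, so the base is at most linear
  in \<open>n\<close> and the table indexed by it can be filled in linear time.\<close>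

definition init_base :: com where
  "init_base =
     (Assign x_base (Const 1) ;;
      While (Reg x_base <\<^sub>e Reg x_n +\<^sub>e Const 1)
        (Assign x_base (Reg x_base +\<^sub>e Reg x_base) ;;
         Assign x_bits (Reg x_bits +\<^sub>e Const 1)))"

definition init_bit_lengths :: com where
  "init_bit_lengths =
     (Assign x_x (Const 1) ;;
      While (Reg x_x <\<^sub>e Reg x_base)
        (Store a_bits (Reg x_x) (Read a_bits (Reg x_x div\<^sub>e Const 2) +\<^sub>e Const 1) ;;
         Assign x_x (Reg x_x +\<^sub>e Const 1)))"

text \<open>
  The base is a power of two greater than \<open>n\<close>, so at most \<open>a + c\<close> divisions reduce a weight
  to an index of the table of bit lengths.
\<close>

definition find_class :: com where
  "find_class =
     (Assign x_x (Read a_weight (Reg x_i)) ;;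
      Assign x_j (Const 0) ;;
      While (Bin Equal (Reg x_x <\<^sub>e Reg x_base) (Const 0))
        (Assign x_x (Reg x_x div\<^sub>e Reg x_base) ;;
         Assign x_j (Reg x_j +\<^sub>e Reg x_bits)) ;;
      Assign x_j (Reg x_j +\<^sub>e Read a_bits (Reg x_x)))"

text \<open>Relies on the initial zeros in \<open>x_i\<close>, \<open>x_classes\<close> and the
  counters. At the end \<open>x_classes\<close> exceeds every class in use by at least one; class 0
  stays empty because weights are positive.\<close>

definition init_slots :: com where
  "init_slots =
     While (Reg x_i <\<^sub>e Reg x_n)
       (find_class ;;
        Store a_slot (Reg x_j *\<^sub>e Reg x_n +\<^sub>e Read a_count (Reg x_j)) (Reg x_i) ;;
        Store a_count (Reg x_j) (Read a_count (Reg x_j) +\<^sub>e Const 1) ;;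
        Cond (Reg x_j <\<^sub>e Reg x_classes) Skip (Assign x_classes (Reg x_j +\<^sub>e Const 1)) ;;
        Assign x_i (Reg x_i +\<^sub>e Const 1))"

text \<open>The maximal old mass forces a construction of the cells in the first iteration.\<close>

definition init_mass :: com where
  "init_mass =
     (Assign x_i (Const 0) ;;
      Assign x_x (Const 1) ;;
      While (Reg x_i <\<^sub>e Reg x_classes)
        (Store a_width (Reg x_i) (Reg x_x) ;;
         Assign x_mass (Reg x_mass +\<^sub>e Read a_count (Reg x_i) *\<^sub>e Reg x_x) ;;
         Assign x_x (Reg x_x +\<^sub>e Reg x_x) ;;
         Assign x_i (Reg x_i +\<^sub>e Const 1)) ;;
      Assign x_old_mass (Const 0 -\<^sub>e Const 1))"

text \<open>The grain exceeds \<open>M / L\<close> for mass \<open>M\<close> and \<open>L\<close>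
  classes: full cells number less than \<open>L\<close>, and each class adds at most one partial
  cell. One flat loop either appends a cell or moves on to the next class. The quotient divides
  \<open>2 ^ w - 1\<close>, since \<open>2 ^ w\<close> itself is not a word.\<close>

definition build_cells :: com where
  "build_cells =
     (Assign x_grain (Reg x_mass div\<^sub>e Reg x_classes +\<^sub>e Const 1) ;;
      Assign x_i (Const 0) ;;
      Assign x_cells (Const 0) ;;
      Store a_start (Const 0) (Const 0) ;;
      While (Reg x_i <\<^sub>e Reg x_classes)
        (Cond ((Reg x_cells -\<^sub>e Read a_start (Reg x_i)) *\<^sub>e Reg x_grain
               <\<^sub>e Read a_count (Reg x_i) *\<^sub>e Read a_width (Reg x_i))
           (Store a_cell (Reg x_cells) (Reg x_i) ;;
            Assign x_cells (Reg x_cells +\<^sub>e Const 1))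
           (Assign x_i (Reg x_i +\<^sub>e Const 1) ;;
            Store a_start (Reg x_i) (Reg x_cells))) ;;
      Assign x_range (Reg x_cells *\<^sub>e Reg x_grain) ;;
      Assign x_quot ((Const 0 -\<^sub>e Const 1) div\<^sub>e Reg x_range) ;;
      Assign x_old_mass (Reg x_mass))"

definition make_pivot :: com where
  "make_pivot =
     (Store a_label (Reg x_v) (Reg x_v +\<^sub>e Const 1) ;;
      Assign x_x (Read a_off (Reg x_v)) ;;
      While (Reg x_x <\<^sub>e Read a_off (Reg x_v +\<^sub>e Const 1))
        (Cond (Read a_label (Read a_nbr (Reg x_x))) Skip
           (Store a_label (Read a_nbr (Reg x_x)) (Reg x_v +\<^sub>e Const 1)) ;;
         Assign x_x (Reg x_x +\<^sub>e Const 1)))"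

text \<open>The last slot of the class fills the gap. The counter is lowered before it is read
  again, so it is then the index of that last slot.\<close>

definition delete_slot :: com where
  "delete_slot =
     (Store a_count (Reg x_i) (Read a_count (Reg x_i) -\<^sub>e Const 1) ;;
      Store a_slot (Reg x_i *\<^sub>e Reg x_n +\<^sub>e Reg x_j)
        (Read a_slot (Reg x_i *\<^sub>e Reg x_n +\<^sub>e Read a_count (Reg x_i))) ;;
      Assign x_mass (Reg x_mass -\<^sub>e Read a_width (Reg x_i)))"

definition locate_slot :: com where
  "locate_slot =
     (Assign x_i (Read a_cell (Reg x_x div\<^sub>e Reg x_grain)) ;;
      Assign x_x (Reg x_x -\<^sub>e Read a_start (Reg x_i) *\<^sub>e Reg x_grain) ;;
      Assign x_j (Reg x_x div\<^sub>e Read a_width (Reg x_i)))"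

text \<open>A vertex that gets a label, as pivot or as neighbour, keeps its slot for now; the slot
  is removed only when a later word hits it.\<close>

definition use_slot :: com where
  "use_slot =
     (Assign x_v (Read a_slot (Reg x_i *\<^sub>e Reg x_n +\<^sub>e Reg x_j)) ;;
      Cond (Read a_label (Reg x_v))
        delete_slot
        (Cond (Reg x_x mod\<^sub>e Read a_width (Reg x_i) <\<^sub>e Read a_weight (Reg x_v))
           make_pivot Skip))"

definition use_word :: com where
  "use_word =
     (Assign x_x (Reg x_r div\<^sub>e Reg x_quot) ;;
      Cond (Reg x_x <\<^sub>e Reg x_range)
        (locate_slot ;; Cond (Reg x_j <\<^sub>e Read a_count (Reg x_i)) use_slot Skip)
        Skip)"

definition refresh :: com where
  "refresh = Cond (Reg x_mass +\<^sub>e Reg x_mass <\<^sub>e Reg x_old_mass) build_cells Skip"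

definition pivot_step :: com where
  "pivot_step = (refresh ;; Random x_r ;; use_word)"

definition initialize :: com where
  "initialize = (init_base ;; init_bit_lengths ;; init_slots ;; init_mass)"

definition pivot_program :: com where
  "pivot_program = (initialize ;; While (Reg x_mass) pivot_step)"

definition frame :: "nat set \<Rightarrow> nat set \<Rightarrow> state \<Rightarrow> state \<Rightarrow> bool" where
  "frame R A s s' \<longleftrightarrow> (\<forall>x. x \<notin> R \<longrightarrow> reg s' x = reg s x) \<and> (\<forall>a. a \<notin> A \<longrightarrow> arr s' a = arr s a)"

section \<open>The input and the word size\<close>

locale instance_on_machine =
  fixes n :: nat and E :: "nat set set" and \<omega> off nbr :: "nat \<Rightarrow> nat" and w a c :: nat
  assumes graph: "simple_graph {0..<n} E"
    and weight_pos: "u < n \<Longrightarrow> 0 < \<omega> u"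
    and weight_le: "u < n \<Longrightarrow> \<omega> u \<le> a * n ^ c"
    and adj: "adjacency_lists n E off nbr"
    and word: "(n + 2) ^ (a + c + 10) \<le> 2 ^ w"
begin

text \<open>Common bound on the weights: \<open>a < 2 ^ a\<close> absorbs the factor
  \<open>a\<close> into the exponent.\<close>

definition X :: nat where "X = (n + 2) ^ (a + c)"

lemma X_pos: "0 < X" by (simp add: X_def)

text \<open>Stated for any base, because it bounds the weights by \<open>X\<close> and, with the
  base chosen by the program, the number of divisions in \<open>find_class\<close>.\<close>

lemma less_power_of_base: "2 \<le> b \<Longrightarrow> n \<le> b \<Longrightarrow> u < n \<Longrightarrow> \<omega> u < b ^ (a + c)"
proof -
  assume b: "2 \<le> b" "n \<le> b" and u: "u < n"
  have "a < 2 ^ a" by (rule less_exp)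
  also have "\<dots> \<le> b ^ a" using b by (intro power_mono) auto
  finally have "a < b ^ a" .
  moreover have "n ^ c \<le> b ^ c" using b by (intro power_mono) auto
  moreover have "0 < b ^ c" using b by simp
  ultimately have "a * n ^ c < b ^ a * b ^ c"
    by (meson le_less_trans mult_le_mono2 mult_less_mono1)
  then show ?thesis using weight_le[OF u] by (simp add: power_add)
qed

lemma weight_le_X: "u < n \<Longrightarrow> \<omega> u \<le> X"
  using less_power_of_base[of "n + 2" u] by (simp add: X_def)

text \<open>The factor \<open>64 = 2 ^ 6\<close> comes from six factors \<open>n + 2\<close> of the
  word bound and leaves room for the small multiples that occur in intermediate results.\<close>

lemma word_bounds:
  "64 \<le> (2::nat) ^ w" "64 * n \<le> 2 ^ w" "64 * (n * n) \<le> 2 ^ w" "64 * X \<le> 2 ^ w" "64 * (n * X) \<le> 2 ^ w"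
proof -
  have "64 * (n + 2) ^ 2 * X \<le> (n + 2) ^ 6 * (n + 2) ^ 2 * X"
    using power_mono[of 2 "n + 2" 6] by (intro mult_right_mono) auto
  also have "\<dots> = (n + 2) ^ (a + c + 8)" by (simp add: X_def flip: power_add)
  also have "\<dots> \<le> (n + 2) ^ (a + c + 10)" by (intro power_increasing) auto
  finally have le: "64 * ((n + 2) ^ 2 * X) \<le> 2 ^ w" using word by simp
  have *: "64 * k \<le> 2 ^ w" if "k \<le> (n + 2) ^ 2 * X" for k
    using le that by linarith
  have X: "1 \<le> X" using X_pos by simp
  have sq: "1 \<le> (n + 2) ^ 2" "n \<le> (n + 2) ^ 2" "n * n \<le> (n + 2) ^ 2"
    by (auto simp: power2_eq_square)
  show "64 \<le> (2::nat) ^ w" using *[of 1] mult_le_mono[OF sq(1) X] by simp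
  show "64 * n \<le> 2 ^ w" using *[of n] mult_le_mono[OF sq(2) X] by simp
  show "64 * (n * n) \<le> 2 ^ w" using *[of "n * n"] mult_le_mono[OF sq(3) X] by simp
  show "64 * X \<le> 2 ^ w" using *[of X] mult_le_mono[OF sq(1) order.refl[of X]] by simp
  show "64 * (n * X) \<le> 2 ^ w" using *[of "n * X"] mult_le_mono[OF sq(2) order.refl[of X]] by simp
qed

lemma word_gt_1: "(1::nat) < 2 ^ w" "(0::nat) < 2 ^ w" "Suc 0 < (2::nat) ^ w" "(2::nat) < 2 ^ w"
  using word_bounds(1) by linarith+

lemma runs_init_base:
  assumes s: "reg s x_n = n" "reg s x_bits = 0"
  shows "runs w init_base s (\<lambda>s' t. frame {x_base, x_bits} {} s s' \<and> t \<le> 3 * n + 5 \<and>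
    reg s' x_base = 2 ^ reg s' x_bits \<and> n < reg s' x_base \<and> reg s' x_base \<le> 2 * n + 1)"
proof -
  let ?I = "\<lambda>s'. frame {x_base, x_bits} {} s s' \<and> reg s' x_base = 2 ^ reg s' x_bits \<and> reg s' x_base \<le> 2 * n + 1"
  \<comment> \<open>Doubling a positive base raises it by at least one, which is all that a linear
    time bound asks for.\<close>
  let ?m = "\<lambda>s'. 3 * (n + 1 - reg s' x_base)"
  show ?thesis
    unfolding init_base_def
  proof (intro runs_intros, rule runs_While[where I = ?I and m = ?m], goal_cases)
    case (1 s')
    have b: "reg s' x_base \<le> n" "reg s' x_n = n"
      using 1 s word_gt_1 word_bounds(1,2) by (auto simp: frame_def eval_rules)
    have "reg s' x_bits < 2 ^ reg s' x_bits" by (rule less_exp)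
    then have "reg s' x_bits < n + 1" using 1 b by linarith
    then have w: "reg s' x_base + reg s' x_base < 2 ^ w" "reg s' x_bits + 1 < 2 ^ w"
      using word_bounds b by linarith+
    have "0 < reg s' x_base" using 1 by simp
    then have "3 * (n + 1 - (reg s' x_base + reg s' x_base)) + 3 \<le> 3 * (n + 1 - reg s' x_base)"
      using b by linarith
    then show ?case
      using 1 b w word_gt_1 by (intro runs_intros) (auto simp: frame_def eval_rules)
  next
    case (2 s' t)
    have b: "n < reg s' x_base"
      using 2 s word_gt_1 word_bounds(1,2) by (auto simp: frame_def eval_rules)
    then show ?case using 2 word_gt_1 by (auto simp: eval_rules)
  next
    case 3
    then show ?case using s word_gt_1 by (auto simp: frame_def eval_rules)
  qed
qed

end

section \<open>Weight classes\<close>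

context instance_on_machine
begin

lemma runs_init_bit_lengths:
  assumes s: "1 \<le> reg s x_base" "reg s x_base \<le> 2 * n + 1" "arr s a_bits 0 = 0"
  shows "runs w init_bit_lengths s (\<lambda>s' t. frame {x_x} {a_bits} s s' \<and> t \<le> 6 * n + 5 \<and>
    (\<forall>x<reg s x_base. arr s' a_bits x = bit_length x))"
proof -
  let ?I = "\<lambda>s'. frame {x_x} {a_bits} s s' \<and> 1 \<le> reg s' x_x \<and> reg s' x_x \<le> reg s x_base \<and>
    (\<forall>x<reg s' x_x. arr s' a_bits x = bit_length x)"
  let ?m = "\<lambda>s'. 3 * (reg s x_base - reg s' x_x)"
  show ?thesis
    unfolding init_bit_lengths_def
  proof (intro runs_intros, rule runs_While[where I = ?I and m = ?m], goal_cases)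
    case (1 s')
    have x: "1 \<le> reg s' x_x" "reg s' x_x < reg s x_base" and f: "frame {x_x} {a_bits} s s'"
      and tab: "\<And>x. x < reg s' x_x \<Longrightarrow> arr s' a_bits x = bit_length x"
      using 1 by (auto simp: frame_def eval_rules)
    have "reg s' x_x div 2 < reg s' x_x" using x by simp
    moreover have "bit_length (reg s' x_x div 2) \<le> reg s' x_x div 2"
      by (rule bit_length_le) (rule less_exp)
    ultimately have v: "arr s' a_bits (reg s' x_x div 2) + 1 = bit_length (reg s' x_x)"
        "arr s' a_bits (reg s' x_x div 2) + 1 < 2 ^ w" "reg s' x_x + 1 < 2 ^ w"
      using x tab[of "reg s' x_x div 2"] s word_bounds(1,2) bit_length_pos[of "reg s' x_x"] by linarith+
    have "3 * (reg s x_base - (reg s' x_x + 1)) + 3 \<le> 3 * (reg s x_base - reg s' x_x)"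
      using x by linarith
    then show ?case
      using v x f tab word_gt_1 by (intro runs_intros) (auto simp: frame_def eval_rules less_Suc_eq)
  next
    case (2 s' t)
    then show ?case using s word_gt_1 by (auto simp: eval_rules frame_def)
  next
    case 3
    then show ?case using s word_gt_1 by (auto simp: frame_def eval_rules)
  qed
qed

text \<open>After \<open>k\<close> divisions the quotient is still positive and, multiplied by the
  \<open>k\<close>-th power of the base, at most the weight. As the weight is below the power
  \<open>a + c\<close> of the base, \<open>k\<close> is bounded by a constant.\<close>

lemma runs_find_class:
  assumes u: "u < n" "reg s x_i = u" and arr: "arr s a_weight u = \<omega> u"
    and base: "reg s x_base = 2 ^ reg s x_bits" "n < reg s x_base"
    and tab: "\<And>x. x < reg s x_base \<Longrightarrow> arr s a_bits x = bit_length x"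
  shows "runs w find_class s (\<lambda>s' t. frame {x_x, x_j} {} s s' \<and> t \<le> 3 * (a + c) + 4 \<and>
    reg s' x_j = bit_length (\<omega> u))"
proof -
  let ?b = "reg s x_base" and ?h = "reg s x_bits"
  let ?I = "\<lambda>s'. frame {x_x, x_j} {} s s' \<and> 0 < reg s' x_x \<and>
     bit_length (\<omega> u) = reg s' x_j + bit_length (reg s' x_x) \<and>
     (\<exists>k. reg s' x_j = ?h * k \<and> reg s' x_x * ?b ^ k \<le> \<omega> u)"
  let ?m = "\<lambda>s'. 3 * (a + c - reg s' x_j div ?h)"
  have b2: "2 \<le> ?b" using base u by linarith
  have h: "0 < ?h" using base b2 by (intro gr0I) auto
  have bl: "bit_length (\<omega> u) \<le> X"
    using bit_length_le[OF less_exp[of "\<omega> u"]] weight_le_X[OF u(1)] by linarith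
  show ?thesis
    unfolding find_class_def
  proof (intro runs_intros, rule runs_While[where I = ?I and m = ?m], goal_cases)
    case (1 s')
    then have x: "0 < reg s' x_x" "?b \<le> reg s' x_x" and f: "frame {x_x, x_j} {} s s'"
      and len: "bit_length (\<omega> u) = reg s' x_j + bit_length (reg s' x_x)"
      using word_gt_1 by (auto simp: frame_def eval_rules split: if_splits)
    obtain k where k: "reg s' x_j = ?h * k" "reg s' x_x * ?b ^ k \<le> \<omega> u"
      using 1 by blast
    have len': "bit_length (reg s' x_x) = ?h + bit_length (reg s' x_x div ?b)"
      unfolding base(1) by (rule bit_length_div_power) (use x base in simp)
    have pos: "0 < reg s' x_x div ?b" using x b2 by (simp add: div_greater_zero_iff)
    have "reg s' x_x div ?b * ?b ^ Suc k = (reg s' x_x div ?b * ?b) * ?b ^ k" by simp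
    also have "\<dots> \<le> reg s' x_x * ?b ^ k" by (intro mult_right_mono) auto
    finally have k': "reg s' x_x div ?b * ?b ^ Suc k \<le> \<omega> u" using k by linarith
    moreover have "1 * ?b ^ Suc k \<le> reg s' x_x div ?b * ?b ^ Suc k"
      using pos by (intro mult_right_mono) auto
    ultimately have "?b ^ Suc k < ?b ^ (a + c)"
      using less_power_of_base[OF b2 _ u(1)] base by linarith
    then have "Suc k < a + c" using b2 by (subst (asm) power_strict_increasing_iff) auto
    then have m: "3 * (a + c - (k + 1)) + 3 \<le> 3 * (a + c - k)" by linarith
    have j: "reg s' x_j + ?h < 2 ^ w" using len len' bl word_bounds(4) X_pos by linarith
    have eq: "reg s' x_j + ?h = ?h * (k + 1)" using k by simp
    have div: "reg s' x_j div ?h = k" "(reg s' x_j + ?h) div ?h = k + 1" using k h by auto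
    have ex: "\<exists>k. reg s' x_j + ?h = ?h * k \<and> reg s' x_x div ?b * ?b ^ k \<le> \<omega> u"
      using eq k' by (intro exI[of _ "k + 1"]) simp
    have fs: "reg s' x_base = ?b" "reg s' x_bits = ?h" using f by (auto simp: frame_def)
    show ?case
      using f m j pos len len' ex
      by (intro runs_intros) (simp add: frame_def eval_rules fs div)
  next
    case (2 s' t)
    then have f: "frame {x_x, x_j} {} s s'" and x: "reg s' x_x < ?b" 
      and len: "bit_length (\<omega> u) = reg s' x_j + bit_length (reg s' x_x)"
      using word_gt_1 by (auto simp: frame_def eval_rules split: if_splits)
    have "reg s' x_j + bit_length (reg s' x_x) < 2 ^ w" using len bl word_bounds(4) X_pos by linarith
    then show ?case
      using 2 tab[OF x] f len by (intro runs_intros) (auto simp: frame_def eval_rules)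
  next
    case 3
    then show ?case using u arr word_gt_1 weight_pos[OF u(1)]
      by (auto simp: frame_def eval_rules)
  qed
qed

text \<open>
  The slots of class \<open>i\<close> are \<open>lst (i * n + j)\<close> for \<open>j < cnt i\<close>: since memory is free, every class
  reserves \<open>n\<close> addresses. Only the vertices of \<open>A\<close> must have a slot.
\<close>

definition slots :: "nat \<Rightarrow> nat set \<Rightarrow> nat \<Rightarrow> (nat \<Rightarrow> nat) \<Rightarrow> (nat \<Rightarrow> nat) \<Rightarrow> bool" where
  "slots v A L cnt lst \<longleftrightarrow>
     (\<forall>i. cnt i \<le> v) \<and> (\<forall>i\<ge>L. cnt i = 0) \<and>
     (\<forall>i. \<forall>j<cnt i. lst (i * n + j) < v \<and> bit_length (\<omega> (lst (i * n + j))) = i) \<and>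
     (\<forall>i. inj_on (\<lambda>j. lst (i * n + j)) {..<cnt i}) \<and>
     (\<forall>u\<in>A. \<exists>j<cnt (bit_length (\<omega> u)). lst (bit_length (\<omega> u) * n + j) = u)"

lemma slot_address_inj: "j < n \<Longrightarrow> j' < n \<Longrightarrow> i * n + j = i' * n + j' \<longleftrightarrow> i = i' \<and> j = j'" for i j i' j' :: nat
proof (intro iffI)
  assume *: "j < n" "j' < n" "i * n + j = i' * n + j'"
  have "(i * n + j) div n = i" "(i' * n + j') div n = i'" "(i * n + j) mod n = j" "(i' * n + j') mod n = j'"
    using *(1,2) by simp_all
  then show "i = i' \<and> j = j'" using *(3) by metis
qed simp

lemma slots_insert:
  assumes s: "slots v A L cnt lst" and v: "v < n" and i: "i = bit_length (\<omega> v)" and L: "L \<le> L'" "i < L'"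
  shows "slots (Suc v) (insert v A) L' (cnt(i := cnt i + 1)) (lst(i * n + cnt i := v))"
proof -
  let ?cnt = "cnt(i := cnt i + 1)" and ?lst = "lst(i * n + cnt i := v)"
  have cnt: "cnt k \<le> v" for k using s by (auto simp: slots_def)
  have old: "?lst (k * n + j) = lst (k * n + j)" if "j < cnt k" for k j
    using that cnt[of k] cnt[of i] v slot_address_inj[of j "cnt i" k i] by auto
  have slot: "lst (k * n + j) < v" "bit_length (\<omega> (lst (k * n + j))) = k" if "j < cnt k" for k j
    using s that by (auto simp: slots_def)
  have "inj_on (\<lambda>j. ?lst (k * n + j)) {..<?cnt k}" for k
  proof -
    have inj: "inj_on (\<lambda>j. lst (k * n + j)) {..<cnt k}" using s by (auto simp: slots_def)
    have "inj_on (\<lambda>j. ?lst (k * n + j)) {..<cnt k}"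
      using inj old by (auto simp: inj_on_def)
    moreover have "v \<notin> (\<lambda>j. ?lst (k * n + j)) ` {..<cnt k}"
      using old slot(1) by (metis (no_types, lifting) imageE lessThan_iff less_irrefl)
    ultimately show ?thesis
      by (auto simp: lessThan_Suc)
  qed
  moreover have "?lst (k * n + j) < Suc v \<and> bit_length (\<omega> (?lst (k * n + j))) = k" if "j < ?cnt k" for k j
  proof (cases "j < cnt k")
    case True
    then show ?thesis using slot[OF True] old[OF True] by simp
  next
    case False
    then have "k = i" "j = cnt i" using that by (auto split: if_splits)
    then show ?thesis using i by simp
  qed
  moreover have "\<exists>j<?cnt (bit_length (\<omega> u)). ?lst (bit_length (\<omega> u) * n + j) = u" if "u \<in> insert v A" for u
  proof (cases "u = v")
    case True
    then show ?thesis using i by (intro exI[of _ "cnt i"]) simp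
  next
    case False
    then have "u \<in> A" using that by simp
    then obtain j where "j < cnt (bit_length (\<omega> u))" "lst (bit_length (\<omega> u) * n + j) = u"
      using s unfolding slots_def by blast
    then show ?thesis using old by (intro exI[of _ j]) auto
  qed
  moreover have "?cnt k \<le> Suc v" for k using cnt[of k] by auto
  moreover have "?cnt k = 0" if "L' \<le> k" for k using that L s by (auto simp: slots_def)
  ultimately show ?thesis unfolding slots_def by blast
qed

lemma slots_delete:
  assumes s: "slots n A L cnt lst" and j: "j < cnt i" and A: "lst (i * n + j) \<notin> A"
  shows "slots n A L (cnt(i := cnt i - 1)) (lst(i * n + j := lst (i * n + (cnt i - 1))))"
proof -
  let ?cnt = "cnt(i := cnt i - 1)" and ?lst = "lst(i * n + j := lst (i * n + (cnt i - 1)))"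
  \<comment> \<open>Translates a slot index after the deletion into the index that the same entry
    had before: position \<open>j\<close> now holds the former last entry.\<close>
  let ?\<sigma> = "\<lambda>k l. if k = i \<and> l = j then cnt i - 1 else l"
  have cnt: "cnt k \<le> n" for k using s by (auto simp: slots_def)
  have \<sigma>: "?lst (k * n + l) = lst (k * n + ?\<sigma> k l)" if "l < ?cnt k" for k l
    using that cnt[of k] cnt[of i] j slot_address_inj[of l j k i] by (auto split: if_splits)
  have \<sigma>_less: "?\<sigma> k l < cnt k" if "l < ?cnt k" for k l
    using that j by (auto split: if_splits)
  have slot: "lst (k * n + l) < n" "bit_length (\<omega> (lst (k * n + l))) = k" if "l < cnt k" for k l
    using s that by (auto simp: slots_def)
  have "inj_on (\<lambda>l. ?lst (k * n + l)) {..<?cnt k}" for k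
  proof (rule inj_onI)
    fix x y assume xy: "x \<in> {..<?cnt k}" "y \<in> {..<?cnt k}" "?lst (k * n + x) = ?lst (k * n + y)"
    have inj: "inj_on (\<lambda>j. lst (k * n + j)) {..<cnt k}" using s by (auto simp: slots_def)
    have "lst (k * n + ?\<sigma> k x) = lst (k * n + ?\<sigma> k y)" using xy \<sigma> by (metis lessThan_iff)
    then have "?\<sigma> k x = ?\<sigma> k y"
      by (rule inj_onD[OF inj]) (use \<sigma>_less[of x k] \<sigma>_less[of y k] xy in auto)
    then show "x = y" using xy by (auto split: if_splits)
  qed
  moreover have "?lst (k * n + l) < n \<and> bit_length (\<omega> (?lst (k * n + l))) = k" if "l < ?cnt k" for k l
    using \<sigma>[OF that] slot[OF \<sigma>_less[OF that]] by metis
  moreover have "\<exists>l<?cnt (bit_length (\<omega> u)). ?lst (bit_length (\<omega> u) * n + l) = u" if u: "u \<in> A" for u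
  proof -
    let ?k = "bit_length (\<omega> u)"
    obtain l where l: "l < cnt ?k" "lst (?k * n + l) = u" using u s unfolding slots_def by blast
    have ne: "\<not> (?k = i \<and> l = j)" using l A u by auto
    show ?thesis
    proof (cases "?k = i \<and> l = cnt i - 1")
      case True
      then have "j < ?cnt ?k" using ne j l by auto
      then show ?thesis using \<sigma>[of j ?k] True l by (intro exI[of _ j]) auto
    next
      case False
      then have "l < ?cnt ?k" using l by auto
      then show ?thesis using \<sigma>[of l ?k] ne l by (intro exI[of _ l]) auto
    qed
  qed
  moreover have "?cnt k \<le> n" for k using cnt[of k] by auto
  moreover have "?cnt k = 0" if "L \<le> k" for k using that s by (auto simp: slots_def)
  ultimately show ?thesis unfolding slots_def by blast
qed

lemma slots_mono: "slots v A L cnt lst \<Longrightarrow> B \<subseteq> A \<Longrightarrow> slots v B L cnt lst"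
  by (auto simp: slots_def)

text \<open>Sending a slot to its vertex is injective: the bit length of the weight recovers the
  class, and within a class no vertex repeats.\<close>

lemma sum_slots_le:
  assumes s: "slots v A L cnt lst"
  shows "(\<Sum>i<L. cnt i) \<le> v"
proof -
  let ?P = "SIGMA i:{..<L}. {..<cnt i}"
  let ?f = "\<lambda>(i, j). lst (i * n + j)"
  have "inj_on ?f ?P"
  proof (rule inj_onI)
    fix p q assume *: "p \<in> ?P" "q \<in> ?P" "?f p = ?f q"
    obtain i j i' j' where [simp]: "p = (i, j)" "q = (i', j')" by (cases p, cases q) auto
    have "i = bit_length (\<omega> (?f p))" "i' = bit_length (\<omega> (?f q))"
      using s *(1,2) by (simp_all add: slots_def)
    then have "i = i'" using *(3) by metis
    moreover have "inj_on (\<lambda>j. lst (i * n + j)) {..<cnt i}" using s by (auto simp: slots_def)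
    ultimately show "p = q" using * by (auto dest: inj_onD)
  qed
  moreover have "?f ` ?P \<subseteq> {..<v}" using s by (auto simp: slots_def)
  ultimately have "card ?P \<le> card {..<v}" by (intro card_inj_on_le) auto
  then show ?thesis by simp
qed

text \<open>A nonempty class contains a vertex whose weight is at least half of the slot width; so
  widths are at most \<open>2 * X\<close>, and there are at most \<open>n\<close> slots.\<close>

lemma mass_le:
  assumes s: "slots n A L cnt lst"
  shows "(\<Sum>i<L. cnt i * 2 ^ i) \<le> 2 * (n * X)"
proof -
  have "cnt i * 2 ^ i \<le> cnt i * (2 * X)" for i
  proof (cases "cnt i = 0")
    case False
    let ?v = "lst (i * n + 0)"
    have v: "?v < n" "bit_length (\<omega> ?v) = i" using False s unfolding slots_def by blast+
    have "2 ^ i \<le> 2 * \<omega> ?v" using power_bit_length_le[OF weight_pos[OF v(1)]] v by simp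
    also have "\<dots> \<le> 2 * X" using weight_le_X[OF v(1)] by simp
    finally show ?thesis by simp
  qed simp
  then have "(\<Sum>i<L. cnt i * 2 ^ i) \<le> (\<Sum>i<L. cnt i * (2 * X))" by (intro sum_mono)
  also have "\<dots> = (\<Sum>i<L. cnt i) * (2 * X)" by (simp add: sum_distrib_right)
  also have "\<dots> \<le> n * (2 * X)" by (intro mult_right_mono sum_slots_le[OF s]) simp
  finally show ?thesis by simp
qed

lemma power_class_le: "u < n \<Longrightarrow> 2 ^ bit_length (\<omega> u) \<le> 2 * X"
  using power_bit_length_le[OF weight_pos, of u] weight_le_X[of u] by linarith

text \<open>Bounding \<open>2 ^ reg s' x_classes\<close> instead of the number of classes serves
  slot widths, slot addresses and the comparison of that number with \<open>w\<close> alike.\<close>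

lemma runs_init_slots:
  assumes n: "reg s x_n = n" and zero: "reg s x_i = 0" "reg s x_classes = 0" "\<And>i. arr s a_count i = 0"
    and arr: "\<And>u. u < n \<Longrightarrow> arr s a_weight u = \<omega> u"
    and base: "reg s x_base = 2 ^ reg s x_bits" "n < reg s x_base"
    and tab: "\<And>x. x < reg s x_base \<Longrightarrow> arr s a_bits x = bit_length x"
  shows "runs w init_slots s (\<lambda>s' t. frame {x_i, x_x, x_j, x_classes} {a_slot, a_count} s s' \<and>
    slots n {..<n} (reg s' x_classes) (arr s' a_count) (arr s' a_slot) \<and>
    2 ^ reg s' x_classes \<le> 4 * X \<and> t \<le> (3 * (a + c) + 10) * n + 1)"
proof -
  let ?I = "\<lambda>s'. frame {x_i, x_x, x_j, x_classes} {a_slot, a_count} s s' \<and> reg s' x_i \<le> n \<and>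
    slots (reg s' x_i) {..<reg s' x_i} (reg s' x_classes) (arr s' a_count) (arr s' a_slot) \<and>
    2 ^ reg s' x_classes \<le> 4 * X"
  let ?m = "\<lambda>s'. (3 * (a + c) + 10) * (n - reg s' x_i)"
  show ?thesis
    unfolding init_slots_def
  proof (rule runs_While[where I = ?I and m = ?m], goal_cases)
    case (1 s1)
    define v where "v = reg s1 x_i"
    have v: "v < n" and f1: "frame {x_i, x_x, x_j, x_classes} {a_slot, a_count} s s1"
      and L1: "2 ^ reg s1 x_classes \<le> 4 * X"
      and slots1: "slots v {..<v} (reg s1 x_classes) (arr s1 a_count) (arr s1 a_slot)"
      using 1 n by (auto simp: v_def frame_def eval_rules split: if_splits)
    have m: "(3 * (a + c) + 10) * (n - Suc v) + (3 * (a + c) + 9) + 1 \<le> (3 * (a + c) + 10) * (n - v)"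
    proof -
      have "n - v = Suc (n - Suc v)" using v by simp
      then show ?thesis by simp
    qed
    have cls: "runs w find_class s1 (\<lambda>s' t. frame {x_x, x_j} {} s1 s' \<and> t \<le> 3 * (a + c) + 4 \<and>
        reg s' x_j = bit_length (\<omega> v))"
      by (rule runs_find_class[OF v]) (use v f1 arr base tab in \<open>auto simp: frame_def v_def\<close>)
    show ?case
    proof (intro runs_Seq, rule runs_mono[OF cls], goal_cases)
      case (1 s2 t2)
      then have f2: "frame {x_x, x_j} {} s1 s2" and t2: "t2 \<le> 3 * (a + c) + 4"
        and i: "reg s2 x_j = bit_length (\<omega> v)" by simp_all
      define i where "i = bit_length (\<omega> v)"
      define L where "L = reg s1 x_classes"
      have cnt: "arr s1 a_count k \<le> v" for k using slots1 by (auto simp: slots_def)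
      have lt: "i < 2 ^ i" by (rule less_exp)
      have iX: "2 ^ i \<le> 2 * X" unfolding i_def by (rule power_class_le[OF v])
      have i2X: "i \<le> 2 * X" using lt iX by linarith
      have "i * n \<le> 2 * X * n" using i2X by (rule mult_right_mono) simp
      then have "i * n \<le> 2 * (n * X)" by (simp add: mult_ac)
      then have addr: "i * n < 2 ^ w" "i * n + arr s1 a_count i < 2 ^ w" "arr s1 a_count i + 1 < 2 ^ w"
          "i + 1 < 2 ^ w" "v + 1 < 2 ^ w"
        using cnt[of i] v i2X word_bounds X_pos by linarith+
      have r2: "reg s2 x_j = i" "reg s2 x_n = n" "reg s2 x_i = v" "reg s2 x_classes = L"
        "arr s2 = arr s1"
        using f1 f2 i n by (auto simp: frame_def i_def v_def L_def)
      have ins: "slots (Suc v) {..<Suc v} L' ((arr s1 a_count)(i := arr s1 a_count i + 1))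
          ((arr s1 a_slot)(i * n + arr s1 a_count i := v))" if "L \<le> L'" "i < L'" for L'
        using slots_insert[OF slots1 v i_def] that unfolding L_def lessThan_Suc by blast
      show ?case
      proof (intro runs_intros runs_CondI, goal_cases)
        case 1
        then have "i < L" using r2 addr by (simp add: eval_rules)
        then show ?case
          using ins[of L] f1 f2 r2 addr v t2 m L1 word_gt_1
          by (auto simp: eval_rules frame_def v_def[symmetric] L_def[symmetric])
      next
        case 2
        then have "L \<le> i" using r2 addr by (simp add: eval_rules)
        then show ?case
          using ins[of "Suc i"] f1 f2 r2 addr v t2 m iX word_gt_1
          by (auto simp: eval_rules frame_def v_def[symmetric] L_def[symmetric])
      qed
    qed
  next
    case (2 s' t)
    then show ?case using n zero(1) by (auto simp: frame_def eval_rules)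
  next
    case 3
    have "1 \<le> 4 * X" using X_pos by simp
    then show ?case using zero by (auto simp: frame_def slots_def)
  qed
qed

lemma runs_init_mass:
  assumes L: "2 ^ reg s x_classes \<le> 4 * X" and zero: "reg s x_mass = 0"
    and le: "(\<Sum>i<reg s x_classes. arr s a_count i * 2 ^ i) \<le> 2 * (n * X)"
  shows "runs w init_mass s (\<lambda>s' t. frame {x_i, x_x, x_mass, x_old_mass} {a_width} s s' \<and>
    reg s' x_mass = (\<Sum>i<reg s x_classes. arr s a_count i * 2 ^ i) \<and>
    (\<forall>i<reg s x_classes. arr s' a_width i = 2 ^ i) \<and> reg s' x_old_mass = 2 ^ w - 1 \<and>
    t \<le> 5 * reg s x_classes + 4)"
proof -
  define L where "L = reg s x_classes"
  define cnt where "cnt = arr s a_count"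
  let ?I = "\<lambda>s'. frame {x_i, x_x, x_mass} {a_width} s s' \<and> reg s' x_i \<le> L \<and>
    reg s' x_x = 2 ^ reg s' x_i \<and> reg s' x_mass = (\<Sum>i<reg s' x_i. cnt i * 2 ^ i) \<and>
    (\<forall>i<reg s' x_i. arr s' a_width i = 2 ^ i)"
  let ?m = "\<lambda>s'. 5 * (L - reg s' x_i)"
  show ?thesis
    unfolding init_mass_def L_def[symmetric] cnt_def[symmetric]
  proof (intro runs_intros, rule runs_While[where I = ?I and m = ?m], goal_cases)
    case (1 s')
    define i where "i = reg s' x_i"
    have i: "i < L" and f: "frame {x_i, x_x, x_mass} {a_width} s s'" and x: "reg s' x_x = 2 ^ i"
      and M: "reg s' x_mass = (\<Sum>k<i. cnt k * 2 ^ k)" and tab: "\<And>k. k < i \<Longrightarrow> arr s' a_width k = 2 ^ k"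
      using 1 by (auto simp: frame_def eval_rules L_def i_def)
    have "(\<Sum>k<Suc i. cnt k * 2 ^ k) \<le> (\<Sum>k<L. cnt k * 2 ^ k)"
      using i by (intro sum_mono2) auto
    then have M': "(\<Sum>k<i. cnt k * 2 ^ k) + cnt i * 2 ^ i < 2 ^ w" "cnt i * 2 ^ i < 2 ^ w"
      using le word_bounds by (auto simp: L_def cnt_def)
    have "2 ^ i + 2 ^ i \<le> (2::nat) ^ L" using power_increasing[of "Suc i" L "2::nat"] i by simp
    then have p: "2 ^ i + 2 ^ i < (2::nat) ^ w" using L word_bounds(4) X_pos by (auto simp: L_def)
    have "i < 2 ^ i" by (rule less_exp)
    then have i': "i + 1 < 2 ^ w" using p by linarith
    have m: "5 * (L - (i + 1)) + 5 \<le> 5 * (L - i)" using i by linarith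
    have c: "arr s' a_count i = cnt i" using f by (auto simp: frame_def cnt_def)
    show ?case
      using f x M tab M' p i' m i c word_gt_1
      by (intro runs_intros) (auto simp: frame_def eval_rules i_def[symmetric] less_Suc_eq)
  next
    case (2 s' t)
    then have "reg s' x_i = L" by (auto simp: frame_def eval_rules L_def)
    then show ?case using 2 word_gt_1
      by (intro runs_intros) (auto simp: frame_def eval_rules)
  next
    case 3
    then show ?case using zero word_gt_1 by (auto simp: frame_def eval_rules)
  qed
qed

text \<open>The part of the invariant that holds whether or not a table of cells exists. The last
  clause says that a label comes from a vertex that carries it itself; it makes the label of an
  unlabelled vertex fresh.\<close>

definition base_inv :: "state \<Rightarrow> bool" where
  "base_inv s \<longleftrightarrow>
     reg s x_n = n \<and> (\<forall>u<n. arr s a_weight u = \<omega> u) \<and> (\<forall>u\<le>n. arr s a_off u = off u) \<and>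
     (\<forall>k<off n. arr s a_nbr k = nbr k) \<and>
     2 ^ reg s x_classes \<le> 4 * X \<and> (\<forall>i<reg s x_classes. arr s a_width i = 2 ^ i) \<and>
     slots n {u. u < n \<and> arr s a_label u = 0} (reg s x_classes) (arr s a_count) (arr s a_slot) \<and>
     reg s x_mass = (\<Sum>i<reg s x_classes. arr s a_count i * 2 ^ i) \<and> reg s x_old_mass < 2 ^ w \<and>
     (\<forall>u<n. arr s a_label u \<noteq> 0 \<longrightarrow>
        (\<exists>p<n. arr s a_label u = Suc p \<and> arr s a_label p = Suc p))"

lemma runs_initialize:
  "runs w initialize (input_state n \<omega> off nbr) (\<lambda>s t. base_inv s \<and>
     2 * reg s x_mass < reg s x_old_mass \<and> (\<forall>u. arr s a_label u = 0) \<and>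
     t \<le> (3 * (a + c) + 19) * n + 5 * reg s x_classes + 20)"
proof -
  let ?s = "input_state n \<omega> off nbr"
  have s0: "reg ?s x_n = n" "\<And>x. x \<noteq> x_n \<Longrightarrow> reg ?s x = 0" "\<And>a. a \<notin> {0, 1, 2} \<Longrightarrow> arr ?s a = (\<lambda>_. 0)"
    "\<And>u. u < n \<Longrightarrow> arr ?s a_weight u = \<omega> u" "\<And>u. u \<le> n \<Longrightarrow> arr ?s a_off u = off u"
    "\<And>k. k < off n \<Longrightarrow> arr ?s a_nbr k = nbr k"
    by (auto simp: input_state_def)
  show ?thesis
    unfolding initialize_def
  proof (intro runs_Seq, rule runs_mono[OF runs_init_base], goal_cases)
    case (3 s1 t1)
    then have f1: "frame {x_base, x_bits} {} ?s s1" and t1: "t1 \<le> 3 * n + 5" and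
      b: "reg s1 x_base = 2 ^ reg s1 x_bits" "n < reg s1 x_base" "reg s1 x_base \<le> 2 * n + 1" by simp_all
    show ?case
    proof (intro runs_Seq, rule runs_mono[OF runs_init_bit_lengths], goal_cases)
      case (4 s2 t2)
      then have f2: "frame {x_x} {a_bits} s1 s2" and t2: "t2 \<le> 6 * n + 5" and
        tab: "\<And>x. x < reg s1 x_base \<Longrightarrow> arr s2 a_bits x = bit_length x" by simp_all
      show ?case
      proof (intro runs_Seq, rule runs_mono[OF runs_init_slots], goal_cases)
        case (9 s3 t3)
        then have f3: "frame {x_i, x_x, x_j, x_classes} {a_slot, a_count} s2 s3"
          and slots: "slots n {..<n} (reg s3 x_classes) (arr s3 a_count) (arr s3 a_slot)"
          and L: "2 ^ reg s3 x_classes \<le> 4 * X" and t3: "t3 \<le> (3 * (a + c) + 10) * n + 1" by simp_all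
        have mass: "(\<Sum>i<reg s3 x_classes. arr s3 a_count i * 2 ^ i) \<le> 2 * (n * X)"
          by (rule mass_le[OF slots])
        show ?case
        proof (rule runs_mono[OF runs_init_mass], goal_cases)
          case (4 s4 t4)
          then have f4: "frame {x_i, x_x, x_mass, x_old_mass} {a_width} s3 s4"
            and M: "reg s4 x_mass = (\<Sum>i<reg s3 x_classes. arr s3 a_count i * 2 ^ i)"
            and wd: "\<And>i. i < reg s3 x_classes \<Longrightarrow> arr s4 a_width i = 2 ^ i"
            and old: "reg s4 x_old_mass = 2 ^ w - 1"
            and t4: "t4 \<le> 5 * reg s3 x_classes + 4" by simp_all
          have lab: "arr s4 a_label u = 0" for u
            using f1 f2 f3 f4 s0 by (simp add: frame_def)
          have slots4: "slots n {u. u < n \<and> arr s4 a_label u = 0} (reg s4 x_classes) (arr s4 a_count) (arr s4 a_slot)"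
            using slots f4 lab by (auto simp: frame_def lessThan_def)
          have "base_inv s4"
            unfolding base_inv_def using slots4 f1 f2 f3 f4 s0 L M wd old lab by (auto simp: frame_def)
          moreover have "2 * reg s4 x_mass < reg s4 x_old_mass"
            using M mass old word_bounds(1,5) by linarith
          moreover have "t1 + (t2 + (t3 + t4)) \<le> (3 * (a + c) + 19) * n + 5 * reg s4 x_classes + 20"
          proof -
            have "reg s4 x_classes = reg s3 x_classes" using f4 by (simp add: frame_def)
            moreover have "(3 * (a + c) + 19) * n = (3 * (a + c) + 10) * n + 9 * n" by (simp add: algebra_simps)
            ultimately show ?thesis using t1 t2 t3 t4 by linarith
          qed
          ultimately show ?case using lab by simp
        qed (use f1 f2 f3 s0 L mass in \<open>simp_all add: frame_def\<close>)
      qed (use f1 f2 s0 b tab in \<open>simp_all add: frame_def\<close>)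
    qed (use f1 s0 b in \<open>auto simp: frame_def\<close>)
  qed (use s0 in \<open>simp_all add: frame_def\<close>)
qed

end

section \<open>The table of cells\<close>

text \<open>
  State of \<^const>\<open>build_cells\<close>: classes below \<open>i\<close> are laid out, \<open>Q\<close> cells of size \<open>G\<close> are in
  use, and class \<open>k\<close> has total slot width \<open>c k\<close> and starts at cell \<open>S k\<close>.
\<close>

definition cells_inv ::
  "(nat \<Rightarrow> nat) \<Rightarrow> nat \<Rightarrow> nat \<Rightarrow> nat \<Rightarrow> (nat \<Rightarrow> nat) \<Rightarrow> (nat \<Rightarrow> nat) \<Rightarrow> bool" where
  "cells_inv c G i Q S cell \<longleftrightarrow>
     S 0 = 0 \<and> (\<forall>k\<le>i. S k \<le> Q) \<and>
     (\<forall>k<i. S k \<le> S (Suc k) \<and> c k \<le> (S (Suc k) - S k) * G \<and>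
        (\<forall>q. S k \<le> q \<and> q < S (Suc k) \<longrightarrow> cell q = k)) \<and>
     (\<forall>q. S i \<le> q \<and> q < Q \<longrightarrow> cell q = i) \<and>
     S i * G \<le> (\<Sum>k<i. c k) + i * G \<and> Q * G \<le> S i * G + c i + G \<and>
     S i \<le> (\<Sum>k<i. c k) \<and> Q \<le> S i + c i"

text \<open>The guard limits the overshoot of a class to one grain. Since \<open>G\<close> is
  positive, it also keeps the number of cells of a class below \<open>c i\<close> before the
  addition, which is the better bound if the mass is smaller than the number of classes.\<close>

lemma cells_inv_add:
  assumes inv: "cells_inv c G i Q S cell" and lt: "(Q - S i) * G < c i" and G: "0 < G"
  shows "cells_inv c G i (Suc Q) S (cell(Q := i))"
proof -
  have S: "S k \<le> Q" if "k \<le> i" for k using inv that by (simp add: cells_inv_def)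
  have "Q * G = S i * G + (Q - S i) * G"
    using S[of i] by (simp add: diff_mult_distrib)
  then have 1: "Suc Q * G \<le> S i * G + c i + G" using lt by simp
  have "(Q - S i) * 1 \<le> (Q - S i) * G" using G by (intro mult_le_mono) auto
  then have "Q - S i < c i" using lt by linarith
  then have 2: "Suc Q \<le> S i + c i" by linarith
  have 3: "(cell(Q := i)) q = k" if "k < i" "S k \<le> q" "q < S (Suc k)" for k q
  proof -
    have "q < Q" using that S[of "Suc k"] by simp
    then show ?thesis using that inv by (auto simp: cells_inv_def)
  qed
  show ?thesis
    using inv 1 2 3 unfolding cells_inv_def by (auto simp: less_Suc_eq)
qed

lemma cells_inv_next:
  assumes inv: "cells_inv c G i Q S cell" and le: "c i \<le> (Q - S i) * G"
  shows "cells_inv c G (Suc i) Q (S(Suc i := Q)) cell"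
proof -
  have 1: "Q * G \<le> (\<Sum>k<Suc i. c k) + Suc i * G" and 2: "Q \<le> (\<Sum>k<Suc i. c k)"
    using inv by (auto simp: cells_inv_def)
  have 3: "\<forall>k<Suc i. (S(Suc i := Q)) k \<le> (S(Suc i := Q)) (Suc k) \<and>
      c k \<le> ((S(Suc i := Q)) (Suc k) - (S(Suc i := Q)) k) * G \<and>
        (\<forall>q. (S(Suc i := Q)) k \<le> q \<and> q < (S(Suc i := Q)) (Suc k) \<longrightarrow> cell q = k)"
    using inv le by (auto simp: cells_inv_def less_Suc_eq)
  show ?thesis
    using inv 1 2 3 unfolding cells_inv_def by (auto simp: le_Suc_eq)
qed

context instance_on_machine
begin

text \<open>Classes have to fit into their cells, not fill them, so the table survives deletions.
  The bounds on \<open>reg s x_range\<close> limit the share of wasted words: one against the mass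
  at construction time, one against the rounding in \<open>x_quot\<close>.\<close>

definition table_inv :: "state \<Rightarrow> bool" where
  "table_inv s \<longleftrightarrow>
     0 < reg s x_grain \<and> arr s a_start 0 = 0 \<and>
     (\<forall>i<reg s x_classes. arr s a_start i \<le> arr s a_start (Suc i) \<and>
        arr s a_count i * 2 ^ i \<le> (arr s a_start (Suc i) - arr s a_start i) * reg s x_grain \<and>
        (\<forall>q. arr s a_start i \<le> q \<and> q < arr s a_start (Suc i) \<longrightarrow> arr s a_cell q = i)) \<and>
     reg s x_range = arr s a_start (reg s x_classes) * reg s x_grain \<and>
     0 < reg s x_range \<and> reg s x_range \<le> 3 * reg s x_old_mass \<and> 2 * reg s x_range \<le> 2 ^ w \<and>
     reg s x_quot = (2 ^ w - 1) div reg s x_range"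

lemma runs_build_cells:
  assumes base: "base_inv s" and mass: "0 < reg s x_mass"
  shows "runs w build_cells s (\<lambda>s' t.
    frame {x_grain, x_i, x_cells, x_range, x_quot, x_old_mass} {a_start, a_cell} s s' \<and>
    reg s' x_old_mass = reg s x_mass \<and> table_inv s' \<and> t \<le> 12 * reg s x_classes + 10)"
proof -
  define L where "L = reg s x_classes"
  define M where "M = reg s x_mass"
  define c where "c k = arr s a_count k * 2 ^ k" for k
  define G where "G = M div L + 1"
  have slots: "slots n {u. u < n \<and> arr s a_label u = 0} L (arr s a_count) (arr s a_slot)"
    and L4: "2 ^ L \<le> 4 * X" and width: "\<And>i. i < L \<Longrightarrow> arr s a_width i = 2 ^ i"
    and M: "M = (\<Sum>k<L. c k)"
    using base by (auto simp: base_inv_def L_def M_def c_def)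
  have M_le: "M \<le> 2 * (n * X)" unfolding M c_def by (rule mass_le[OF slots])
  have L0: "0 < L" using mass M by (cases L) (auto simp: M_def)
  \<comment> \<open>At the exit the invariant speaks of class \<open>L\<close>, past the last one;
    its zero width forces the layout to end at \<open>S L\<close>.\<close>
  have cL: "c L = 0" using slots by (auto simp: slots_def c_def)
  have L_le: "L < 4 * X" using less_exp[of L] L4 by linarith
  have GM: "G \<le> M + 1" unfolding G_def by (simp add: div_le_dividend)
  have LG: "L * G \<le> M + L" and MLG: "M < L * G"
  proof -
    have "L * (M div L) \<le> M" by simp
    then show "L * G \<le> M + L" by (simp add: G_def)
    have "M < L + L * (M div L)" using L0 by (metis add.commute dividend_less_times_div)
    then show "M < L * G" by (simp add: G_def)
  qed
  have c_le: "(\<Sum>k<i. c k) + c i \<le> M" if "i < L" for i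
  proof -
    have "(\<Sum>k<Suc i. c k) \<le> (\<Sum>k<L. c k)" using that by (intro sum_mono2) auto
    then show ?thesis by (simp add: M)
  qed
  let ?F = "frame {x_grain, x_i, x_cells} {a_start, a_cell}"
  let ?I = "\<lambda>s'. ?F s s' \<and> reg s' x_grain = G \<and> reg s' x_i \<le> L \<and>
    cells_inv c G (reg s' x_i) (reg s' x_cells) (arr s' a_start) (arr s' a_cell)"
  \<comment> \<open>An iteration completes one of \<open>L\<close> classes or adds one of at most
    \<open>2 * L\<close> cells.\<close>
  let ?m = "\<lambda>s'. 4 * ((L - reg s' x_i) + (2 * L - reg s' x_cells))"
  show ?thesis
    unfolding build_cells_def L_def[symmetric] M_def[symmetric]
  proof (intro runs_intros, rule runs_While[where I = ?I and m = ?m], goal_cases)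
    case (1 s')
    define i where "i = reg s' x_i"
    define Q where "Q = reg s' x_cells"
    define S where "S = arr s' a_start"
    have f: "?F s s'" and G: "reg s' x_grain = G" and i: "i < L"
      and inv: "cells_inv c G i Q S (arr s' a_cell)"
      using 1 by (auto simp: i_def Q_def S_def frame_def eval_rules L_def)
    have "c i \<le> M" using c_le[OF i] by linarith
    have SQ: "S i \<le> Q" and QG: "Q * G \<le> S i * G + c i + G" and SG: "S i * G \<le> (\<Sum>k<i. c k) + i * G"
      using inv by (auto simp: cells_inv_def)
    have "(Q - S i) * G \<le> c i + G" using QG by (simp add: diff_mult_distrib)
    then have w1: "(Q - S i) * G < 2 ^ w" "c i < 2 ^ w"
      using \<open>c i \<le> M\<close> GM M_le word_bounds(1,5) by linarith+
    have regs: "arr s' a_count i = arr s a_count i" "arr s' a_width i = 2 ^ i" "reg s' x_classes = L"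
      using f i width by (auto simp: frame_def L_def)
    have "Q * G \<le> (\<Sum>k<i. c k) + i * G + c i + G" using QG SG by linarith
    also have "\<dots> \<le> M + L * G"
    proof -
      have "Suc i * G \<le> L * G" using i by (intro mult_le_mono) auto
      then show ?thesis using c_le[OF i] by simp
    qed
    also have "\<dots> < 2 * L * G" using MLG by (simp add: mult_ac)
    finally have Q: "Q < 2 * L" by simp
    have w2: "Q < 2 ^ w" "Q + 1 < 2 ^ w" "i + 1 < 2 ^ w"
      using Q L_le i word_bounds(4) by linarith+
    show ?case
    proof (intro runs_intros runs_CondI, goal_cases)
      case 1
      then have lt: "(Q - S i) * G < c i"
        using regs w1 w2 SQ G by (simp add: eval_rules i_def[symmetric] Q_def[symmetric] S_def[symmetric] c_def)
      have "cells_inv c G i (Suc Q) S ((arr s' a_cell)(Q := i))"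
        by (rule cells_inv_add[OF inv lt]) (simp add: G_def)
      moreover have "4 * ((L - i) + (2 * L - Suc Q)) + 4 \<le> 4 * ((L - i) + (2 * L - Q))"
        using Suc_diff_Suc[OF Q] by simp
      ultimately show ?case
        using f G i w2 word_gt_1
        by (simp add: frame_def eval_rules i_def[symmetric] Q_def[symmetric] S_def[symmetric])
    next
      case 2
      then have le: "c i \<le> (Q - S i) * G"
        using regs w1 w2 SQ G by (simp add: eval_rules i_def[symmetric] Q_def[symmetric] S_def[symmetric] c_def)
      have "cells_inv c G (Suc i) Q (S(Suc i := Q)) (arr s' a_cell)"
        by (rule cells_inv_next[OF inv le])
      moreover have "4 * ((L - Suc i) + (2 * L - Q)) + 4 \<le> 4 * ((L - i) + (2 * L - Q))"
        using Suc_diff_Suc[OF i] by simp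
      ultimately show ?case
        using f G i w2 word_gt_1
        by (simp add: frame_def eval_rules i_def[symmetric] Q_def[symmetric] S_def[symmetric])
    qed
  next
    case (2 s' t)
    define Q where "Q = reg s' x_cells"
    define S where "S = arr s' a_start"
    have f: "?F s s'" and G: "reg s' x_grain = G" and i: "reg s' x_i = L"
      and inv: "cells_inv c G L Q S (arr s' a_cell)" and t: "t \<le> 12 * L + 1"
      using 2 word_gt_1 by (auto simp: Q_def S_def frame_def eval_rules L_def)
    have SQ: "S L = Q" using inv cL by (auto simp: cells_inv_def)
    then have "Q * G \<le> M + L * G" and QM: "Q \<le> M"
      using inv by (auto simp: cells_inv_def M)
    then have QG: "Q * G \<le> 2 * M + L" using LG by linarith
    have R3: "Q * G \<le> 3 * M"
    proof (cases "M < L")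
      case True
      then show ?thesis using QM by (simp add: G_def)
    next
      case False
      then show ?thesis using QG by linarith
    qed
    then have w1: "2 * (Q * G) \<le> 2 ^ w" "Q * G < 2 ^ w" using M_le word_bounds(1,5) by linarith+
    have "0 < Q"
    proof (rule ccontr)
      assume "\<not> 0 < Q"
      then have "c k = 0" if "k < L" for k using inv that by (fastforce simp: cells_inv_def)
      then show False using M mass by (simp add: M_def)
    qed
    then have pos: "0 < Q * G" by (simp add: G_def)
    have "reg s' x_classes = L" "arr s' a_count = arr s a_count" "reg s' x_mass = M"
      using f by (auto simp: frame_def L_def M_def)
    moreover have "\<forall>i<L. S i \<le> S (Suc i) \<and> c i \<le> (S (Suc i) - S i) * G \<and>
        (\<forall>q. S i \<le> q \<and> q < S (Suc i) \<longrightarrow> arr s' a_cell q = i)" "S 0 = 0"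
      using inv by (auto simp: cells_inv_def)
    moreover have "0 < G" by (simp add: G_def)
    ultimately show ?case
      using f G pos w1 R3 t SQ word_gt_1
      by (intro runs_intros)
        (auto simp: frame_def eval_rules table_inv_def Q_def[symmetric] S_def[symmetric] c_def)
  next
    case 3
    have w1: "M div L + 1 < 2 ^ w" using GM M_le word_bounds(1,5) unfolding G_def by linarith
    then show ?case using L0 word_gt_1
      by (auto simp: frame_def eval_rules cells_inv_def L_def[symmetric] M_def[symmetric] G_def)
  qed
qed

end

section \<open>Sampling a pivot\<close>

context instance_on_machine
begin

section \<open>Adjacency lists and labelling the cluster of a pivot\<close>

definition neighbours :: "nat \<Rightarrow> nat set" where "neighbours u = {v. {u, v} \<in> E}"

lemma neighbours_less: "v \<in> neighbours u \<Longrightarrow> v < n"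
  using graph by (auto simp: neighbours_def simple_graph_def)

lemma adjacency:
  assumes "u < n"
  shows "off u \<le> off (Suc u)" "bij_betw nbr {off u..<off (Suc u)} (neighbours u)"
    "off (Suc u) = off u + card (neighbours u)"
proof -
  show le: "off u \<le> off (Suc u)" and bij: "bij_betw nbr {off u..<off (Suc u)} (neighbours u)"
    using adj assms by (auto simp: adjacency_lists_def neighbours_def)
  show "off (Suc u) = off u + card (neighbours u)"
    using bij_betw_same_card[OF bij] le by simp
qed

lemma off_eq_sum: "m \<le> n \<Longrightarrow> off m = (\<Sum>u<m. card (neighbours u))"
proof (induction m)
  case 0
  then show ?case using adj by (simp add: adjacency_lists_def)
next
  case (Suc m)
  then show ?case using adjacency(3)[of m] by simp
qed

lemma off_mono: "k \<le> m \<Longrightarrow> m \<le> n \<Longrightarrow> off k \<le> off m"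
  using off_eq_sum[of k] off_eq_sum[of m] by (auto intro!: sum_mono2)

lemma sum_degrees: "(\<Sum>u<n. card (neighbours u)) = 2 * card E"
  using handshake[OF graph] by (simp add: neighbours_def atLeast0LessThan)

lemma off_le: "off n \<le> n * n"
proof -
  have "card (neighbours u) \<le> card {..<n}" for u
    by (intro card_mono) (auto dest: neighbours_less)
  then have "(\<Sum>u<n. card (neighbours u)) \<le> (\<Sum>u<n. n)" by (intro sum_mono) simp
  then show ?thesis using off_eq_sum[of n] by simp
qed

lemma runs_make_pivot:
  assumes base: "base_inv s" and v: "v < n" "reg s x_v = v" "arr s a_label v = 0"
  shows "runs w make_pivot s (\<lambda>s' t. frame {x_x} {a_label} s s' \<and>
    arr s' a_label = pivot_label E v (arr s a_label) \<and> t \<le> 4 * card (neighbours v) + 3)"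
proof -
  define l where "l = arr s a_label"
  let ?I = "\<lambda>s'. frame {x_x} {a_label} s s' \<and> off v \<le> reg s' x_x \<and> reg s' x_x \<le> off (Suc v) \<and>
    arr s' a_label = (\<lambda>u. if u = v \<or> l u = 0 \<and> u \<in> nbr ` {off v..<reg s' x_x} then Suc v else l u)"
  let ?m = "\<lambda>s'. 4 * (off (Suc v) - reg s' x_x)"
  have offs: "arr s a_off v = off v" "arr s a_off (Suc v) = off (Suc v)" 
    and nbrs: "\<And>k. k < off n \<Longrightarrow> arr s a_nbr k = nbr k"
    using base v by (auto simp: base_inv_def)
  have v': "v + 1 < 2 ^ w" using v word_bounds(1,2) by linarith
  have img: "nbr ` {off v..<off (Suc v)} = neighbours v"
    using adjacency(2)[OF v(1)] by (simp add: bij_betw_def)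
  show ?thesis
    unfolding make_pivot_def
  proof (intro runs_intros, rule runs_While[where I = ?I and m = ?m], goal_cases)
    case (1 s')
    define k where "k = reg s' x_x"
    define l' where "l' = arr s' a_label"
    have f: "frame {x_x} {a_label} s s'" and k: "off v \<le> k" "k < off (Suc v)"
      and l': "l' = (\<lambda>u. if u = v \<or> l u = 0 \<and> u \<in> nbr ` {off v..<k} then Suc v else l u)"
      using 1 offs v v' word_gt_1 by (auto simp: frame_def eval_rules k_def l'_def split: if_splits)
    have kn: "k < off n" using k(2) off_mono[of "Suc v" n] v(1) by linarith
    then have k': "k + 1 < 2 ^ w" using off_le word_bounds(1,3) by linarith
    have r: "arr s' a_nbr k = nbr k" "reg s' x_v = v" using f nbrs kn v by (auto simp: frame_def)
    have m: "4 * (off (Suc v) - Suc k) + 4 \<le> 4 * (off (Suc v) - k)"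
      using Suc_diff_Suc[OF k(2)] by simp
    have ivl: "{off v..<Suc k} = insert k {off v..<k}" using k(1) by auto
    show ?case
    proof (intro runs_intros runs_CondI, goal_cases)
      case 1
      then have "l' (nbr k) \<noteq> 0" using r by (simp add: k_def l'_def)
      then have "l' = (\<lambda>u. if u = v \<or> l u = 0 \<and> u \<in> nbr ` {off v..<Suc k} then Suc v else l u)"
        unfolding ivl using l' by (auto simp: fun_eq_iff split: if_splits)
      then show ?case
        using f k k' m word_gt_1 by (auto simp: frame_def eval_rules k_def[symmetric] l'_def[symmetric])
    next
      case 2
      then have "l' (nbr k) = 0" using r by (simp add: k_def l'_def)
      then have "l'(nbr k := Suc v) = (\<lambda>u. if u = v \<or> l u = 0 \<and> u \<in> nbr ` {off v..<Suc k} then Suc v else l u)"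
        unfolding ivl using l' by (auto simp: fun_eq_iff split: if_splits)
      then show ?case
        using f k k' m r v' word_gt_1 by (auto simp: frame_def eval_rules k_def[symmetric] l'_def[symmetric])
    qed
  next
    case (2 s' t)
    then have f: "frame {x_x} {a_label} s s'" and k: "reg s' x_x = off (Suc v)"
      and l': "arr s' a_label = (\<lambda>u. if u = v \<or> l u = 0 \<and> u \<in> neighbours v then Suc v else l u)"
      using offs v v' word_gt_1 img by (auto simp: frame_def eval_rules split: if_splits)
    have "arr s' a_label = pivot_label E v l"
      unfolding l' by (auto simp: fun_eq_iff pivot_label_def neighbours_def)
    then show ?case using 2 f k adjacency(3)[OF v(1)] offs v by (auto simp: l_def)
  next
    case 3
    show ?case using v v' word_gt_1 offs adjacency(1)[OF v(1)]
      by (auto simp: frame_def eval_rules l_def)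
  qed
qed

text \<open>
  A word \<open>r\<close> with \<open>word_hits s r\<close> addresses the point at height \<open>word_height s r\<close> of slot
  \<open>word_slot s r\<close> of class \<open>word_class s r\<close>.
\<close>

definition word_class :: "state \<Rightarrow> nat \<Rightarrow> nat" where
  "word_class s r = arr s a_cell (r div reg s x_quot div reg s x_grain)"

definition word_pos :: "state \<Rightarrow> nat \<Rightarrow> nat" where
  "word_pos s r = r div reg s x_quot - arr s a_start (word_class s r) * reg s x_grain"

definition word_slot :: "state \<Rightarrow> nat \<Rightarrow> nat" where
  "word_slot s r = word_pos s r div 2 ^ word_class s r"

definition word_height :: "state \<Rightarrow> nat \<Rightarrow> nat" where
  "word_height s r = word_pos s r mod 2 ^ word_class s r"

definition word_hits :: "state \<Rightarrow> nat \<Rightarrow> bool" where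
  "word_hits s r \<longleftrightarrow> r div reg s x_quot < reg s x_range \<and>
     word_slot s r < arr s a_count (word_class s r)"

definition word_vertex :: "state \<Rightarrow> nat \<Rightarrow> nat" where
  "word_vertex s r = arr s a_slot (word_class s r * n + word_slot s r)"

definition word_pivot :: "state \<Rightarrow> nat \<Rightarrow> nat option" where
  "word_pivot s r =
     (if word_hits s r \<and> arr s a_label (word_vertex s r) = 0 \<and>
         word_height s r < \<omega> (word_vertex s r)
      then Some (word_vertex s r) else None)"

lemma interval_of_step_function:
  fixes S :: "nat \<Rightarrow> nat"
  shows "S 0 \<le> y \<Longrightarrow> y < S L \<Longrightarrow> \<exists>i<L. S i \<le> y \<and> y < S (Suc i)"
proof (induction L)
  case (Suc L)
  show ?case
  proof (cases "y < S L")
    case True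
    then show ?thesis using Suc less_SucI by blast
  next
    case False
    then show ?thesis using Suc.prems by (intro exI[of _ L]) simp
  qed
qed simp

lemma table_start_mono:
  assumes t: "table_inv s" and "i \<le> k" "k \<le> reg s x_classes"
  shows "arr s a_start i \<le> arr s a_start k"
  using assms(2,3)
proof (induction k rule: dec_induct)
  case (step k)
  then have "arr s a_start k \<le> arr s a_start (Suc k)" using t by (simp add: table_inv_def)
  then show ?case using step by simp
qed simp

lemma word_class_bounds:
  assumes t: "table_inv s" and r: "r div reg s x_quot < reg s x_range"
  shows "word_class s r < reg s x_classes"
    "arr s a_start (word_class s r) * reg s x_grain \<le> r div reg s x_quot"
proof -
  let ?S = "arr s a_start" and ?G = "reg s x_grain" and ?L = "reg s x_classes"
  let ?y = "r div reg s x_quot div ?G"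
  have G: "0 < ?G" using t by (simp add: table_inv_def)
  have "?y < ?S ?L" using t r by (simp add: table_inv_def less_mult_imp_div_less)
  then obtain i where i: "i < ?L" "?S i \<le> ?y" "?y < ?S (Suc i)"
    using interval_of_step_function[of ?S ?y ?L] t by (auto simp: table_inv_def)
  then have c: "word_class s r = i" using t by (simp add: table_inv_def word_class_def)
  show "word_class s r < ?L" using c i by simp
  have "?S i * ?G \<le> ?y * ?G" using i by simp
  also have "\<dots> \<le> r div reg s x_quot" by (rule div_times_less_eq_dividend)
  finally show "?S (word_class s r) * ?G \<le> r div reg s x_quot" using c by simp
qed

text \<open>These words form the interval from \<open>q * b\<close> to \<open>q * (b + H)\<close>,
  where \<open>b\<close> is the start of the slot in the layout: division by \<open>q\<close> sends
  exactly \<open>q\<close> words to each point, as \<open>q * R\<close> is below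
  \<open>2 ^ w\<close>. This exact count makes the sampling exact.\<close>

lemma words_of_slot:
  assumes t: "table_inv s" and i: "i < reg s x_classes" and j: "j < arr s a_count i" and H: "H \<le> 2 ^ i"
  shows "card {r. r < 2 ^ w \<and> word_hits s r \<and> word_class s r = i \<and> word_slot s r = j \<and> word_height s r < H}
    = reg s x_quot * H"
proof -
  define S where "S = arr s a_start"
  define G where "G = reg s x_grain"
  define q where "q = reg s x_quot"
  define R where "R = reg s x_range"
  define b where "b = S i * G + j * 2 ^ i"
  have R: "R = S (reg s x_classes) * G" "0 < R" "2 * R \<le> 2 ^ w" "q = (2 ^ w - 1) div R"
    and G: "0 < G" and fit: "arr s a_count i * 2 ^ i \<le> (S (Suc i) - S i) * G" and S: "S i \<le> S (Suc i)"
    and cell: "\<And>k. S i \<le> k \<Longrightarrow> k < S (Suc i) \<Longrightarrow> arr s a_cell k = i"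
    using t i by (auto simp: table_inv_def S_def G_def q_def R_def)
  have "R \<le> 2 ^ w - 1" using R(2,3) by linarith
  then have q: "0 < q" unfolding R(4) using R(2) by (simp add: div_greater_zero_iff)
  have qR: "q * R < 2 ^ w"
  proof -
    have "q * R \<le> 2 ^ w - 1" unfolding R(4) by (rule div_times_less_eq_dividend)
    then show ?thesis using R(2,3) by linarith
  qed
  have "Suc j * 2 ^ i \<le> arr s a_count i * 2 ^ i" using j by (intro mult_le_mono) auto
  then have jfit: "j * 2 ^ i + 2 ^ i \<le> (S (Suc i) - S i) * G" using fit by simp
  have b_le: "b + 2 ^ i \<le> S (Suc i) * G"
    using jfit mult_le_mono1[OF S, of G] unfolding b_def diff_mult_distrib by linarith
  also have "\<dots> \<le> R"
    unfolding R(1) using table_start_mono[OF t, of "Suc i" "reg s x_classes"] i by (simp add: S_def)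
  finally have bR: "b + 2 ^ i \<le> R" .
  have "{r. r < 2 ^ w \<and> word_hits s r \<and> word_class s r = i \<and> word_slot s r = j \<and> word_height s r < H}
    = {q * b..<q * (b + H)}"
  proof (intro set_eqI iffI)
    fix r assume "r \<in> {r. r < 2 ^ w \<and> word_hits s r \<and> word_class s r = i \<and> word_slot s r = j \<and>
      word_height s r < H}"
    then have hit: "word_hits s r" and ci: "i = word_class s r" and cj: "j = word_slot s r"
      and h: "word_height s r < H" by auto
    let ?x = "r div q"
    have "S i * G \<le> ?x"
      using word_class_bounds(2)[OF t] hit by (simp add: word_hits_def S_def G_def q_def ci)
    moreover have "word_pos s r = j * 2 ^ i + word_height s r"
      unfolding ci cj word_slot_def word_height_def by (rule div_mult_mod_eq[symmetric])
    ultimately have x: "?x = b + word_height s r"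
      using ci by (simp add: word_pos_def b_def S_def G_def q_def)
    have "q * b \<le> q * ?x" using x by simp
    also have "\<dots> \<le> r" by simp
    finally have 1: "q * b \<le> r" .
    have "r < q + q * ?x" using q by (rule dividend_less_times_div)
    also have "\<dots> = q * (?x + 1)" by simp
    also have "\<dots> \<le> q * (b + H)" using x h by (intro mult_le_mono) auto
    finally show "r \<in> {q * b..<q * (b + H)}" using 1 by simp
  next
    fix r assume "r \<in> {q * b..<q * (b + H)}"
    then have r: "q * b \<le> r" "r < q * (b + H)" by auto
    let ?x = "r div q"
    have x: "b \<le> ?x" "?x < b + H" using r q
      by (simp_all add: less_eq_div_iff_mult_less_eq div_less_iff_less_mult mult.commute)
    define y where "y = ?x - S i * G"
    have xy: "?x = S i * G + y" using x by (simp add: y_def b_def)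
    have y: "j * 2 ^ i \<le> y" "y < j * 2 ^ i + H" using x xy by (simp_all add: b_def)
    have "?x < S (Suc i) * G" using x H b_le by linarith
    then have "?x div G < S (Suc i)" by (simp add: less_mult_imp_div_less)
    moreover have "S i \<le> ?x div G" using xy G by simp
    ultimately have ci: "word_class s r = i" using cell by (simp add: word_class_def q_def G_def)
    have pos: "word_pos s r = y" using ci by (simp add: word_pos_def y_def q_def G_def S_def)
    have div: "y div 2 ^ i = j"
    proof (rule div_nat_eqI)
      show "2 ^ i * j \<le> y" using y by (simp add: mult.commute)
      show "y < 2 ^ i * Suc j" using y H by (simp add: mult.commute)
    qed
    have cj: "word_slot s r = j" using ci pos div by (simp add: word_slot_def)
    have "y = j * 2 ^ i + y mod 2 ^ i" using div by (metis div_mult_mod_eq)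
    then have h: "word_height s r < H" using y ci pos by (simp add: word_height_def)
    have "?x < R" using x H bR by linarith
    moreover have "r < 2 ^ w"
    proof -
      have "q * (b + H) \<le> q * R" using bR H by (intro mult_le_mono) auto
      then show ?thesis using r qR by linarith
    qed
    ultimately show "r \<in> {r. r < 2 ^ w \<and> word_hits s r \<and> word_class s r = i \<and> word_slot s r = j \<and>
      word_height s r < H}"
      using ci cj h j by (simp add: word_hits_def q_def R_def)
  qed
  then show ?thesis by (simp add: q_def flip: diff_mult_distrib2)
qed

lemma word_vertex_props:
  assumes "base_inv s" "table_inv s" "word_hits s r"
  shows "word_vertex s r < n" "bit_length (\<omega> (word_vertex s r)) = word_class s r"
    "word_class s r < reg s x_classes"
proof -
  show "word_class s r < reg s x_classes"
    using word_class_bounds(1) assms by (simp add: word_hits_def)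
  show "word_vertex s r < n" "bit_length (\<omega> (word_vertex s r)) = word_class s r"
    using assms by (auto simp: base_inv_def slots_def word_hits_def word_vertex_def)
qed

text \<open>An unlabelled vertex has exactly one slot: one is guaranteed, and injectivity excludes a
  second. The factor \<open>reg s x_quot\<close> is the same for all vertices, so the choice is
  proportional to the weights.\<close>

lemma card_word_pivot:
  assumes base: "base_inv s" and t: "table_inv s" and v: "v < n" "arr s a_label v = 0"
  shows "card {r. r < 2 ^ w \<and> word_pivot s r = Some v} = reg s x_quot * \<omega> v"
proof -
  let ?i = "bit_length (\<omega> v)"
  have slots: "slots n {u. u < n \<and> arr s a_label u = 0} (reg s x_classes) (arr s a_count) (arr s a_slot)"
    using base by (simp add: base_inv_def)
  obtain j where j: "j < arr s a_count ?i" "arr s a_slot (?i * n + j) = v"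
    using slots v by (auto simp: slots_def)
  have inj: "inj_on (\<lambda>j. arr s a_slot (?i * n + j)) {..<arr s a_count ?i}"
    using slots by (auto simp: slots_def)
  have i: "?i < reg s x_classes"
    using slots j(1) unfolding slots_def by (metis not_less not_less_zero)
  have "word_pivot s r = Some v \<longleftrightarrow>
      word_hits s r \<and> word_class s r = ?i \<and> word_slot s r = j \<and> word_height s r < \<omega> v" for r
  proof
    assume r: "word_pivot s r = Some v"
    then have hit: "word_hits s r" and vtx: "word_vertex s r = v" and h: "word_height s r < \<omega> v"
      by (auto simp: word_pivot_def split: if_splits)
    have c: "word_class s r = ?i" using word_vertex_props(2)[OF base t hit] vtx by simp
    have "arr s a_slot (?i * n + word_slot s r) = arr s a_slot (?i * n + j)"
      using vtx c j by (simp add: word_vertex_def)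
    then have "word_slot s r = j"
      by (rule inj_onD[OF inj]) (use hit c j in \<open>auto simp: word_hits_def\<close>)
    then show "word_hits s r \<and> word_class s r = ?i \<and> word_slot s r = j \<and> word_height s r < \<omega> v"
      using hit c h by simp
  qed (use j v in \<open>auto simp: word_pivot_def word_vertex_def\<close>)
  then show ?thesis
    using words_of_slot[OF t i j(1), of "\<omega> v"] less_power_bit_length[of "\<omega> v"] by simp
qed

text \<open>\<open>24 = 2 * 6 * 2\<close>: rounding in the quotient costs at most a factor 2, the
  range is at most three times the old mass and so six times the present one, and at least half of
  each slot makes progress.\<close>

lemma card_progress_words:
  assumes base: "base_inv s" and t: "table_inv s" and old: "reg s x_old_mass \<le> 2 * reg s x_mass"
  shows "2 ^ w \<le> 24 * card {r. r < 2 ^ w \<and> word_hits s r \<and>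
    (arr s a_label (word_vertex s r) = 0 \<longrightarrow> word_height s r < \<omega> (word_vertex s r))}"
proof -
  let ?P = "{r. r < 2 ^ w \<and> word_hits s r \<and>
    (arr s a_label (word_vertex s r) = 0 \<longrightarrow> word_height s r < \<omega> (word_vertex s r))}"
  define L where "L = reg s x_classes"
  define cnt where "cnt = arr s a_count"
  define q where "q = reg s x_quot"
  define vtx where "vtx i j = arr s a_slot (i * n + j)" for i j
  \<comment> \<open>The height below which a word makes progress: the weight if a pivot can be
    chosen, the full width if the slot is to be deleted.\<close>
  define H where "H i j = (if arr s a_label (vtx i j) = 0 then \<omega> (vtx i j) else 2 ^ i)" for i j
  let ?I = "SIGMA i:{..<L}. {..<cnt i}"
  let ?A = "\<lambda>(i, j). {r. r < 2 ^ w \<and> word_hits s r \<and> word_class s r = i \<and> word_slot s r = j \<and>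
    word_height s r < H i j}"
  have slots: "slots n {u. u < n \<and> arr s a_label u = 0} L cnt (arr s a_slot)"
    and mass: "reg s x_mass = (\<Sum>i<L. cnt i * 2 ^ i)"
    using base by (simp_all add: base_inv_def L_def cnt_def)
  have H: "H i j \<le> 2 ^ i" "2 ^ i \<le> 2 * H i j" if "j < cnt i" for i j
  proof -
    have v: "vtx i j < n" "bit_length (\<omega> (vtx i j)) = i"
      using slots that by (auto simp: slots_def vtx_def)
    show "H i j \<le> 2 ^ i" "2 ^ i \<le> 2 * H i j"
      using less_power_bit_length[of "\<omega> (vtx i j)"] power_bit_length_le[OF weight_pos[OF v(1)]] v(2)
      by (auto simp: H_def)
  qed
  have "(\<Union>p\<in>?I. ?A p) \<subseteq> ?P"
    by (auto simp: H_def word_vertex_def vtx_def)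
  then have "card (\<Union>p\<in>?I. ?A p) \<le> card ?P"
    by (rule card_mono[rotated]) simp
  moreover have "card (\<Union>p\<in>?I. ?A p) = (\<Sum>p\<in>?I. card (?A p))"
    by (rule card_UN_disjoint) auto
  moreover have "(\<Sum>p\<in>?I. card (?A p)) = (\<Sum>p\<in>?I. case p of (i, j) \<Rightarrow> q * H i j)"
  proof (intro sum.cong refl)
    fix p assume "p \<in> ?I"
    then obtain i j where p: "p = (i, j)" "i < L" "j < cnt i" by auto
    then show "card (?A p) = (case p of (i, j) \<Rightarrow> q * H i j)"
      using words_of_slot[OF t, of i j "H i j"] H by (simp add: L_def cnt_def q_def)
  qed
  moreover have "(\<Sum>p\<in>?I. case p of (i, j) \<Rightarrow> q * 2 ^ i) \<le> (\<Sum>p\<in>?I. case p of (i, j) \<Rightarrow> 2 * (q * H i j))"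
    using H by (intro sum_mono) auto
  moreover have "(\<Sum>p\<in>?I. case p of (i, j) \<Rightarrow> q * 2 ^ i) = q * reg s x_mass"
    unfolding mass by (simp add: sum.Sigma[symmetric] sum_distrib_left mult_ac)
  moreover have "(\<Sum>p\<in>?I. case p of (i, j) \<Rightarrow> 2 * (q * H i j)) = 2 * (\<Sum>p\<in>?I. case p of (i, j) \<Rightarrow> q * H i j)"
    by (simp add: sum_distrib_left case_prod_beta')
  ultimately have le: "q * reg s x_mass \<le> 2 * card ?P" by linarith
  define R where "R = reg s x_range"
  have R: "0 < R" "2 * R \<le> 2 ^ w" "q = (2 ^ w - 1) div R" "R \<le> 3 * reg s x_old_mass"
    using t by (auto simp: table_inv_def R_def q_def)
  \<comment> \<open>The remainder of the division is less than \<open>R\<close>, which is at most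
    half of \<open>2 ^ w\<close>; so at least half of all words are usable.\<close>
  have "2 ^ w - 1 < R + R * q" unfolding R(3) using R(1) by (rule dividend_less_times_div)
  then have "2 ^ w \<le> 2 * (R * q)" using R(1,2) by linarith
  also have "R * q \<le> 6 * reg s x_mass * q" using R(4) old by (intro mult_le_mono) auto
  also have "2 * (6 * reg s x_mass * q) \<le> 24 * card ?P" using le by (simp add: mult_ac)
  finally show ?thesis by simp
qed

definition main_inv :: "state \<Rightarrow> bool" where
  \<comment> \<open>The first alternative admits the start, where no table exists: it forces
    \<open>refresh\<close> to build one before it is read.\<close>
  "main_inv s \<longleftrightarrow> base_inv s \<and> (2 * reg s x_mass < reg s x_old_mass \<or> table_inv s)"

text \<open>A pivot lowers the number of unlabelled vertices, a deletion the number of slots; both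
  kinds of useful words thus count in one quantity.\<close>

definition progress :: "state \<Rightarrow> nat" where
  "progress s = (\<Sum>i<reg s x_classes. arr s a_count i) + card {u. u < n \<and> arr s a_label u = 0}"

text \<open>A vertex becomes a pivot at most once, so scanning its neighbours is prepaid while it is
  unlabelled. A rebuild is prepaid by a digit of the old mass.\<close>

definition payment :: "state \<Rightarrow> nat" where
  "payment s = 4 * (\<Sum>u | u < n \<and> arr s a_label u = 0. card (neighbours u)) +
     (12 * reg s x_classes + 12) * bit_length (reg s x_old_mass)"

lemma base_inv_frame:
  assumes "base_inv s" "frame (- {x_n, x_classes, x_mass}) {a_start, a_cell} s s'" "reg s' x_old_mass < 2 ^ w"
  shows "base_inv s'"
  using assms unfolding base_inv_def frame_def by simp

lemma table_inv_frame:
  assumes t: "table_inv s"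
    and f: "frame (- {x_classes, x_old_mass, x_grain, x_range, x_quot}) (- {a_start, a_cell}) s s'"
    and le: "\<And>i. arr s' a_count i \<le> arr s a_count i"
  shows "table_inv s'"
proof -
  have eq: "reg s' x_classes = reg s x_classes" "reg s' x_old_mass = reg s x_old_mass"
    "reg s' x_grain = reg s x_grain" "reg s' x_range = reg s x_range" "reg s' x_quot = reg s x_quot"
    "arr s' a_start = arr s a_start" "arr s' a_cell = arr s a_cell"
    using f by (simp_all add: frame_def)
  have "arr s' a_count i * 2 ^ i \<le> (arr s a_start (Suc i) - arr s a_start i) * reg s x_grain"
    if "i < reg s x_classes" for i
  proof -
    have "arr s' a_count i * 2 ^ i \<le> arr s a_count i * 2 ^ i" by (intro mult_right_mono le) simp
    also have "\<dots> \<le> (arr s a_start (Suc i) - arr s a_start i) * reg s x_grain"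
      using t that by (simp add: table_inv_def)
    finally show ?thesis .
  qed
  then show ?thesis using t unfolding table_inv_def eq by blast
qed

lemma frame_mono: "frame R A s s' \<Longrightarrow> R \<subseteq> R' \<Longrightarrow> A \<subseteq> A' \<Longrightarrow> frame R' A' s s'"
  unfolding frame_def by blast

lemma runs_refresh:
  assumes inv: "main_inv s" and mass: "0 < reg s x_mass"
  shows "runs w refresh s (\<lambda>s' t. base_inv s' \<and> table_inv s' \<and> reg s' x_old_mass \<le> 2 * reg s' x_mass \<and>
    frame {x_grain, x_i, x_cells, x_range, x_quot, x_old_mass} {a_start, a_cell} s s' \<and>
    t + payment s' \<le> payment s + 2)"
proof -
  have base: "base_inv s" using inv by (simp add: main_inv_def)
  have "reg s x_mass \<le> 2 * (n * X)"
    using base mass_le by (auto simp: base_inv_def)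
  then have w: "2 * reg s x_mass < 2 ^ w" "reg s x_mass + reg s x_mass < 2 ^ w" "reg s x_mass < 2 ^ w"
    using word_bounds(1,5) by linarith+
  show ?thesis
    unfolding refresh_def
  proof (rule runs_CondI)
    assume "eval w s (Reg x_mass +\<^sub>e Reg x_mass <\<^sub>e Reg x_old_mass) \<noteq> 0"
    then have lt: "2 * reg s x_mass < reg s x_old_mass" using w by (simp add: eval_rules)
    show "runs w build_cells s (\<lambda>s' t. base_inv s' \<and> table_inv s' \<and> reg s' x_old_mass \<le> 2 * reg s' x_mass \<and>
      frame {x_grain, x_i, x_cells, x_range, x_quot, x_old_mass} {a_start, a_cell} s s' \<and>
      1 + t + payment s' \<le> payment s + 2)"
    proof (rule runs_mono[OF runs_build_cells[OF base mass]], elim conjE)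
      fix s' and t :: nat
      assume f: "frame {x_grain, x_i, x_cells, x_range, x_quot, x_old_mass} {a_start, a_cell} s s'"
        and old: "reg s' x_old_mass = reg s x_mass" and tab: "table_inv s'"
        and t: "t \<le> 12 * reg s x_classes + 10"
      have "base_inv s'"
        by (rule base_inv_frame[OF base]) (use f old w in \<open>auto elim!: frame_mono\<close>)
      moreover have eq: "reg s' x_mass = reg s x_mass" "reg s' x_classes = reg s x_classes" "arr s' a_label = arr s a_label"
        using f by (auto simp: frame_def)
      moreover have "1 + t + payment s' \<le> payment s + 2"
      proof -
        \<comment> \<open>The recorded mass more than halves, so its bit length drops by at least
          one and releases the price of the rebuild.\<close>
        have "Suc (bit_length (reg s x_mass)) = bit_length (2 * reg s x_mass)"
          using bit_length_double[OF mass] by simp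
        also have "\<dots> \<le> bit_length (reg s x_old_mass)" using lt by (intro bit_length_mono) simp
        finally have "(12 * reg s x_classes + 12) * Suc (bit_length (reg s x_mass)) \<le>
            (12 * reg s x_classes + 12) * bit_length (reg s x_old_mass)"
          by (intro mult_left_mono) auto
        then show ?thesis using t old eq by (simp add: payment_def)
      qed
      ultimately show "base_inv s' \<and> table_inv s' \<and> reg s' x_old_mass \<le> 2 * reg s' x_mass \<and>
        frame {x_grain, x_i, x_cells, x_range, x_quot, x_old_mass} {a_start, a_cell} s s' \<and>
        1 + t + payment s' \<le> payment s + 2"
        using f old tab by simp
    qed
  next
    assume "eval w s (Reg x_mass +\<^sub>e Reg x_mass <\<^sub>e Reg x_old_mass) = 0"
    then have le: "reg s x_old_mass \<le> 2 * reg s x_mass" using w by (simp add: eval_rules split: if_splits)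
    then show "runs w Skip s (\<lambda>s' t. base_inv s' \<and> table_inv s' \<and> reg s' x_old_mass \<le> 2 * reg s' x_mass \<and>
      frame {x_grain, x_i, x_cells, x_range, x_quot, x_old_mass} {a_start, a_cell} s s' \<and>
      1 + t + payment s' \<le> payment s + 2)"
      using inv by (auto simp: runs_Skip main_inv_def frame_def)
  qed
qed

lemma runs_locate_slot:
  assumes base: "base_inv s" and t: "table_inv s" and r: "r < 2 ^ w"
    and x: "reg s x_x = r div reg s x_quot" "r div reg s x_quot < reg s x_range"
  shows "runs w locate_slot s (\<lambda>s' t. frame {x_i, x_x, x_j} {} s s' \<and> reg s' x_i = word_class s r \<and>
    reg s' x_x = word_pos s r \<and> reg s' x_j = word_slot s r \<and> t = 3)"
proof -
  have "r div reg s x_quot \<le> r" by (rule div_le_dividend)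
  then have le: "arr s a_start (word_class s r) * reg s x_grain \<le> r div reg s x_quot"
      "arr s a_start (word_class s r) * reg s x_grain < 2 ^ w" "r div reg s x_quot < 2 ^ w"
    using word_class_bounds(2)[OF t x(2)] r by linarith+
  have i: "arr s a_width (word_class s r) = 2 ^ word_class s r"
    using base word_class_bounds(1)[OF t x(2)] by (simp add: base_inv_def)
  have c: "arr s a_cell (r div reg s x_quot div reg s x_grain) = word_class s r"
    by (simp add: word_class_def)
  show ?thesis
    unfolding locate_slot_def
    by (intro runs_intros) (use le i x in \<open>simp add: frame_def eval_rules c word_pos_def word_slot_def\<close>)
qed

lemma runs_delete_slot:
  assumes base: "base_inv s" and i: "reg s x_i = i" "i < reg s x_classes"
    and j: "reg s x_j = j" "j < arr s a_count i" and lab: "arr s a_label (arr s a_slot (i * n + j)) \<noteq> 0"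
  shows "runs w delete_slot s (\<lambda>s' t. base_inv s' \<and> frame {x_mass} {a_count, a_slot} s s' \<and>
    arr s' a_count = (arr s a_count)(i := arr s a_count i - 1) \<and> t = 3)"
proof -
  define L where "L = reg s x_classes"
  define cnt where "cnt = arr s a_count"
  define lst where "lst = arr s a_slot"
  have slots: "slots n {u. u < n \<and> arr s a_label u = 0} L cnt lst"
    and mass: "reg s x_mass = (\<Sum>i<L. cnt i * 2 ^ i)" and wd: "arr s a_width i = 2 ^ i"
    and L4: "2 ^ L \<le> 4 * X" and n: "reg s x_n = n"
    using base i by (auto simp: base_inv_def L_def cnt_def lst_def)
  have cnt: "cnt i \<le> n" using slots by (simp add: slots_def)
  have "i < 4 * X" using i(2) less_exp[of L] L4 unfolding L_def by linarith
  then have "i * n \<le> 4 * X * n" by (intro mult_right_mono) auto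
  then have "i * n \<le> 4 * (n * X)" by (simp add: mult_ac)
  then have w1: "i * n < 2 ^ w" "i * n + j < 2 ^ w" "i * n + (cnt i - 1) < 2 ^ w" "cnt i < 2 ^ w"
    using j cnt word_bounds(1,2,5) unfolding cnt_def by linarith+
  have "reg s x_mass \<le> 2 * (n * X)" unfolding mass by (rule mass_le[OF slots])
  then have w2: "reg s x_mass < 2 ^ w" using word_bounds(1,5) by linarith
  have sum: "(\<Sum>k<L. (cnt(i := cnt i - 1)) k * 2 ^ k) + 2 ^ i = reg s x_mass"
  proof -
    have "(\<Sum>k<L. cnt k * 2 ^ k) = cnt i * 2 ^ i + (\<Sum>k\<in>{..<L} - {i}. cnt k * 2 ^ k)"
      using i by (intro sum.remove) (auto simp: L_def)
    moreover have "(\<Sum>k<L. (cnt(i := cnt i - 1)) k * 2 ^ k) =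
        (cnt i - 1) * 2 ^ i + (\<Sum>k\<in>{..<L} - {i}. (cnt(i := cnt i - 1)) k * 2 ^ k)"
      using i by (subst sum.remove[of _ i]) (auto simp: L_def)
    moreover have "(\<Sum>k\<in>{..<L} - {i}. (cnt(i := cnt i - 1)) k * 2 ^ k) = (\<Sum>k\<in>{..<L} - {i}. cnt k * 2 ^ k)"
      by (intro sum.cong) auto
    moreover have "cnt i * 2 ^ i = (cnt i - 1) * 2 ^ i + 2 ^ i"
      using j by (cases "cnt i") (auto simp: cnt_def)
    ultimately show ?thesis using mass by linarith
  qed
  have del: "slots n {u. u < n \<and> arr s a_label u = 0} L (cnt(i := cnt i - 1))
      (lst(i * n + j := lst (i * n + (cnt i - 1))))"
    by (rule slots_delete[OF slots]) (use j lab in \<open>auto simp: cnt_def lst_def\<close>)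
  have sum': "(\<Sum>k<L. (cnt(i := cnt i - 1)) k * 2 ^ k) = reg s x_mass - 2 ^ i" and le: "2 ^ i \<le> reg s x_mass"
    using sum by linarith+
  have cnt1: "1 \<le> cnt i" using j by (simp add: cnt_def)
  let ?s' = "s\<lparr>arr := (arr s)(a_count := cnt(i := cnt i - 1),
      a_slot := lst(i * n + j := lst (i * n + (cnt i - 1)))), reg := (reg s)(x_mass := reg s x_mass - 2 ^ i)\<rparr>"
  have "runs w delete_slot s (\<lambda>s' t. s' = ?s' \<and> t = 3)"
    unfolding delete_slot_def
  proof (intro runs_intros conjI, goal_cases)
    case 1
    have "arr s a_count i = cnt i" "arr s a_slot = lst" "arr s a_count = cnt"
      by (simp_all add: cnt_def lst_def)
    then show ?case
      using i(1) j(1) n wd w1 w2 le cnt1 word_gt_1 by (simp add: eval_rules)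
  qed simp
  moreover have "base_inv ?s'"
    using base del w2 sum' unfolding base_inv_def by (simp add: L_def)
  moreover have "frame {x_mass} {a_count, a_slot} s ?s'"
    by (simp add: frame_def)
  ultimately show ?thesis
    by (auto elim!: runs_mono simp: cnt_def)
qed

text \<open>Slots are demanded only for unlabelled vertices, so labelling leaves them valid. A new
  label has the pivot as its witness; the witness of an old label is itself labelled and hence not
  relabelled.\<close>

lemma base_inv_make_pivot:
  assumes base: "base_inv s" and f: "frame {x_x} {a_label} s s'" and v: "v < n" "arr s a_label v = 0"
    and lab: "arr s' a_label = pivot_label E v (arr s a_label)"
  shows "base_inv s'"
proof -
  have sub: "{u. u < n \<and> arr s' a_label u = 0} \<subseteq> {u. u < n \<and> arr s a_label u = 0}"
    by (auto simp: lab pivot_label_def split: if_splits)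
  have "slots n {u. u < n \<and> arr s' a_label u = 0} (reg s x_classes) (arr s a_count) (arr s a_slot)"
    by (rule slots_mono[OF _ sub]) (use base in \<open>simp add: base_inv_def\<close>)
  moreover have "\<exists>p<n. arr s' a_label u = Suc p \<and> arr s' a_label p = Suc p"
    if u: "u < n" "arr s' a_label u \<noteq> 0" for u
  proof (cases "arr s' a_label u = Suc v")
    case True
    then show ?thesis using v by (intro exI[of _ v]) (simp add: lab pivot_label_def)
  next
    case False
    then have old: "arr s' a_label u = arr s a_label u" by (auto simp: lab pivot_label_def)
    then obtain p where p: "p < n" "arr s a_label u = Suc p" "arr s a_label p = Suc p"
      using base u unfolding base_inv_def by metis
    then have "arr s' a_label p = Suc p" using v by (auto simp: lab pivot_label_def)
    then show ?thesis using p old by auto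
  qed
  ultimately show ?thesis
    using base f unfolding base_inv_def frame_def by simp
qed

lemma unlabelled_make_pivot:
  assumes v: "v < n" "l v = 0"
  shows "card {u. u < n \<and> pivot_label E v l u = 0} < card {u. u < n \<and> l u = 0}"
    "(\<Sum>u | u < n \<and> pivot_label E v l u = 0. card (neighbours u)) + card (neighbours v)
      \<le> (\<Sum>u | u < n \<and> l u = 0. card (neighbours u))"
proof -
  let ?A = "{u. u < n \<and> l u = 0}" and ?B = "{u. u < n \<and> pivot_label E v l u = 0}"
  have sub: "insert v ?B \<subseteq> ?A" and notin: "v \<notin> ?B"
    using v by (auto simp: pivot_label_def split: if_splits)
  have "card (insert v ?B) \<le> card ?A" by (rule card_mono[OF _ sub]) simp
  then show "card ?B < card ?A" using notin by simp
  have "(\<Sum>u\<in>insert v ?B. card (neighbours u)) \<le> (\<Sum>u\<in>?A. card (neighbours u))"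
    by (rule sum_mono2[OF _ sub]) auto
  then show "(\<Sum>u\<in>?B. card (neighbours u)) + card (neighbours v) \<le> (\<Sum>u\<in>?A. card (neighbours u))"
    using notin by simp
qed

lemma word_frame:
  assumes "frame {x_x, x_i, x_j, x_v, x_r} {} s s'"
  shows "word_class s' = word_class s" "word_pos s' = word_pos s" "word_slot s' = word_slot s"
    "word_height s' = word_height s" "word_hits s' = word_hits s" "word_vertex s' = word_vertex s"
    "word_pivot s' = word_pivot s"
proof -
  show 1: "word_class s' = word_class s"
    using assms by (simp add: fun_eq_iff word_class_def frame_def)
  show 2: "word_pos s' = word_pos s"
    using assms by (simp add: fun_eq_iff word_pos_def 1 frame_def)
  show 3: "word_slot s' = word_slot s" by (simp add: fun_eq_iff word_slot_def 1 2)
  show 4: "word_height s' = word_height s" by (simp add: fun_eq_iff word_height_def 1 2)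
  show 5: "word_hits s' = word_hits s"
    using assms by (simp add: fun_eq_iff word_hits_def 1 3 frame_def)
  show 6: "word_vertex s' = word_vertex s"
    using assms by (simp add: fun_eq_iff word_vertex_def 1 3 frame_def)
  show "word_pivot s' = word_pivot s"
    using assms by (simp add: fun_eq_iff word_pivot_def 4 5 6 frame_def)
qed

definition word_effect :: "state \<Rightarrow> nat \<Rightarrow> state \<Rightarrow> bool" where
  "word_effect s r s' \<longleftrightarrow> main_inv s' \<and> progress s' \<le> progress s \<and>
     (word_hits s r \<and> (arr s a_label (word_vertex s r) = 0 \<longrightarrow>
        word_height s r < \<omega> (word_vertex s r)) \<longrightarrow> progress s' < progress s) \<and>
     (case word_pivot s r of None \<Rightarrow> arr s' a_label = arr s a_label
      | Some v \<Rightarrow> v < n \<and> arr s a_label v = 0 \<and> arr s' a_label = pivot_label E v (arr s a_label))"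

lemma unchanged:
  assumes f: "frame {x_x, x_i, x_j, x_v, x_r} {} s s'"
  shows "base_inv s \<Longrightarrow> base_inv s'" "table_inv s \<Longrightarrow> table_inv s'" "payment s' = payment s"
    "progress s' = progress s" "arr s' = arr s"
proof -
  show "base_inv s'" if b: "base_inv s"
    by (rule base_inv_frame[OF b]) (use f b in \<open>auto elim!: frame_mono simp: base_inv_def frame_def\<close>)
  show "table_inv s'" if "table_inv s"
    by (rule table_inv_frame[OF that]) (use f in \<open>auto elim!: frame_mono simp: frame_def\<close>)
  show "payment s' = payment s" "progress s' = progress s" "arr s' = arr s"
    using f by (auto simp: payment_def progress_def frame_def fun_eq_iff)
qed

lemma runs_use_slot:
  assumes base: "base_inv s" and t: "table_inv s" and hit: "word_hits s r"
    and regs: "reg s x_i = word_class s r" "reg s x_x = word_pos s r" "reg s x_j = word_slot s r"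
  shows "runs w use_slot s (\<lambda>s' t. word_effect s r s' \<and> t + payment s' \<le> payment s + 6)"
proof -
  define v where "v = word_vertex s r"
  define i where "i = word_class s r"
  define j where "j = word_slot s r"
  let ?s1 = "s\<lparr>reg := (reg s)(x_v := v)\<rparr>"
  have v: "v < n" and i: "i < reg s x_classes"
    using word_vertex_props[OF base t hit] by (simp_all add: v_def i_def)
  have j: "j < arr s a_count i" using hit by (simp add: word_hits_def i_def j_def)
  have vtx: "arr s a_slot (i * n + j) = v" by (simp add: v_def i_def j_def word_vertex_def)
  have n: "reg s x_n = n" and width: "arr s a_width i = 2 ^ i" and weight: "arr s a_weight v = \<omega> v"
    and L4: "2 ^ reg s x_classes \<le> 4 * X" and cnt: "arr s a_count i \<le> n"
    using base i v by (auto simp: base_inv_def slots_def)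
  have "i < 4 * X" using i less_exp[of "reg s x_classes"] L4 by linarith
  then have "i * n \<le> 4 * X * n" by (intro mult_right_mono) auto
  then have "i * n \<le> 4 * (n * X)" by (simp add: mult_ac)
  then have w1: "i * n < 2 ^ w" "i * n + j < 2 ^ w"
    using j cnt word_bounds(1,2,5) by linarith+
  have f1: "frame {x_x, x_i, x_j, x_v, x_r} {} s ?s1" by (simp add: frame_def)
  have base1: "base_inv ?s1" and t1: "table_inv ?s1" using unchanged[OF f1] base t by simp_all
  have pay1: "payment ?s1 = payment s" and prog1: "progress ?s1 = progress s" using unchanged[OF f1] by simp_all
  have e1: "s\<lparr>reg := (reg s)(x_v := eval w s (Read a_slot (Reg x_i *\<^sub>e Reg x_n +\<^sub>e Reg x_j)))\<rparr> = ?s1"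
    using regs n w1 vtx by (simp add: eval_rules flip: i_def j_def)
  show ?thesis
    unfolding use_slot_def
  proof (rule runs_Seq, rule runs_AssignI, unfold e1, rule runs_CondI)
    assume "eval w ?s1 (Read a_label (Reg x_v)) \<noteq> 0"
    then have lab: "arr s a_label v \<noteq> 0" by simp
    then have none: "word_pivot s r = None" by (simp add: word_pivot_def v_def)
    have del: "runs w delete_slot ?s1 (\<lambda>s' t. base_inv s' \<and> frame {x_mass} {a_count, a_slot} ?s1 s' \<and>
        arr s' a_count = (arr ?s1 a_count)(i := arr ?s1 a_count i - 1) \<and> t = 3)"
      by (rule runs_delete_slot[OF base1, where j = j]) (use regs i j lab vtx in \<open>auto simp: i_def j_def\<close>)
    show "runs w delete_slot ?s1 (\<lambda>s' t. word_effect s r s' \<and> 1 + (1 + t) + payment s' \<le> payment s + 6)"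
    proof (rule runs_mono[OF del], elim conjE)
      fix s' and t' :: nat
      assume base': "base_inv s'" and f': "frame {x_mass} {a_count, a_slot} ?s1 s'" and time: "t' = 3"
        and cnt': "arr s' a_count = (arr ?s1 a_count)(i := arr ?s1 a_count i - 1)"
      have "table_inv s'"
        by (rule table_inv_frame[OF t1]) (use f' cnt' in \<open>auto elim!: frame_mono\<close>)
      moreover have lab': "arr s' a_label = arr s a_label" "reg s' x_classes = reg s x_classes"
        "reg s' x_old_mass = reg s x_old_mass"
        using f' by (auto simp: frame_def)
      moreover have "payment s' = payment s" by (simp add: payment_def lab')
      moreover have "progress s' < progress s"
      proof -
        have "(\<Sum>k<reg s x_classes. arr s' a_count k) < (\<Sum>k<reg s x_classes. arr s a_count k)"
          using i j by (intro sum_strict_mono_ex1) (auto simp: cnt' intro!: bexI[of _ i])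
        then show ?thesis by (simp add: progress_def lab')
      qed
      ultimately show "word_effect s r s' \<and> 1 + (1 + t') + payment s' \<le> payment s + 6"
        using base' time none by (simp add: word_effect_def main_inv_def)
    qed
  next
    assume "eval w ?s1 (Read a_label (Reg x_v)) = 0"
    then have lab: "arr s a_label v = 0" by simp
    have h: "eval w ?s1 (Reg x_x mod\<^sub>e Read a_width (Reg x_i) <\<^sub>e Read a_weight (Reg x_v)) =
        of_bool (word_height s r < \<omega> v)"
      using regs width weight by (simp add: eval_rules word_height_def flip: i_def)
    show "runs w (Cond (Reg x_x mod\<^sub>e Read a_width (Reg x_i) <\<^sub>e Read a_weight (Reg x_v)) make_pivot Skip) ?s1
      (\<lambda>s' t. word_effect s r s' \<and> 1 + (1 + t) + payment s' \<le> payment s + 6)"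
    proof (rule runs_CondI)
      assume "eval w ?s1 (Reg x_x mod\<^sub>e Read a_width (Reg x_i) <\<^sub>e Read a_weight (Reg x_v)) \<noteq> 0"
      then have "word_height s r < \<omega> v" unfolding h by (simp split: if_splits)
      then have some: "word_pivot s r = Some v" using hit lab by (simp add: word_pivot_def v_def)
      have mp: "runs w make_pivot ?s1 (\<lambda>s' t. frame {x_x} {a_label} ?s1 s' \<and>
          arr s' a_label = pivot_label E v (arr ?s1 a_label) \<and> t \<le> 4 * card (neighbours v) + 3)"
        by (rule runs_make_pivot[OF base1 v]) (simp_all add: lab)
      show "runs w make_pivot ?s1
        (\<lambda>s' t. word_effect s r s' \<and> 1 + (1 + (1 + t)) + payment s' \<le> payment s + 6)"
      proof (rule runs_mono[OF mp], elim conjE)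
        fix s' and t' :: nat
        assume f': "frame {x_x} {a_label} ?s1 s'" and lab': "arr s' a_label = pivot_label E v (arr ?s1 a_label)"
          and time: "t' \<le> 4 * card (neighbours v) + 3"
        have base': "base_inv s'"
          by (rule base_inv_make_pivot[OF base1 f' v _ lab']) (simp add: lab)
        have tab': "table_inv s'"
          by (rule table_inv_frame[OF t1]) (use f' in \<open>auto elim!: frame_mono simp: frame_def\<close>)
        have eq: "reg s' x_classes = reg s x_classes" "reg s' x_old_mass = reg s x_old_mass"
          "arr s' a_count = arr s a_count"
          using f' by (auto simp: frame_def)
        have "progress s' < progress s"
          using unlabelled_make_pivot(1)[of v "arr s a_label", OF v lab] lab' by (simp add: progress_def eq)
        moreover have "1 + (1 + (1 + t')) + payment s' \<le> payment s + 6"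
          using unlabelled_make_pivot(2)[of v "arr s a_label", OF v lab] lab' time by (simp add: payment_def eq)
        ultimately show "word_effect s r s' \<and> 1 + (1 + (1 + t')) + payment s' \<le> payment s + 6"
          using base' tab' some v lab lab' by (simp add: word_effect_def main_inv_def)
      qed
    next
      assume "eval w ?s1 (Reg x_x mod\<^sub>e Read a_width (Reg x_i) <\<^sub>e Read a_weight (Reg x_v)) = 0"
      then have nh: "\<not> word_height s r < \<omega> v" unfolding h by (simp split: if_splits)
      then have none: "word_pivot s r = None" by (simp add: word_pivot_def v_def)
      show "runs w Skip ?s1 (\<lambda>s' t. word_effect s r s' \<and> 1 + (1 + (1 + t)) + payment s' \<le> payment s + 6)"
        using base1 t1 pay1 prog1 none nh lab
        by (simp add: runs_Skip word_effect_def main_inv_def flip: v_def)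
    qed
  qed
qed

lemma runs_use_word:
  assumes base: "base_inv s" and t: "table_inv s" and r: "r < 2 ^ w" "reg s x_r = r"
  shows "runs w use_word s (\<lambda>s' t. word_effect s r s' \<and> t + payment s' \<le> payment s + 12)"
proof -
  let ?s1 = "s\<lparr>reg := (reg s)(x_x := r div reg s x_quot)\<rparr>"
  have f1: "frame {x_x, x_i, x_j, x_v, x_r} {} s ?s1" by (simp add: frame_def)
  have base1: "base_inv ?s1" and t1: "table_inv ?s1" using unchanged[OF f1] base t by simp_all
  have neutral: "word_effect s r s' \<and> payment s' = payment s"
    if f: "frame {x_x, x_i, x_j, x_v, x_r} {} s s'" and no: "\<not> word_hits s r" for s'
  proof -
    have "word_pivot s r = None" using no by (simp add: word_pivot_def)
    then show ?thesis
      using unchanged[OF f] base t no by (simp add: word_effect_def main_inv_def)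
  qed
  have e1: "s\<lparr>reg := (reg s)(x_x := eval w s (Reg x_r div\<^sub>e Reg x_quot))\<rparr> = ?s1"
    using r by (simp add: eval_rules)
  show ?thesis
    unfolding use_word_def
  proof (rule runs_Seq, rule runs_AssignI, unfold e1, rule runs_CondI)
    assume "eval w ?s1 (Reg x_x <\<^sub>e Reg x_range) \<noteq> 0"
    then have x: "r div reg s x_quot < reg s x_range" by (simp add: eval_rules split: if_splits)
    have loc: "runs w locate_slot ?s1 (\<lambda>s' t. frame {x_i, x_x, x_j} {} ?s1 s' \<and> reg s' x_i = word_class ?s1 r \<and>
        reg s' x_x = word_pos ?s1 r \<and> reg s' x_j = word_slot ?s1 r \<and> t = 3)"
      by (rule runs_locate_slot[OF base1 t1 r(1)]) (use x in simp_all)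
    show "runs w (locate_slot ;; Cond (Reg x_j <\<^sub>e Read a_count (Reg x_i)) use_slot Skip) ?s1
      (\<lambda>s' t. word_effect s r s' \<and> 1 + (1 + t) + payment s' \<le> payment s + 12)"
    proof (rule runs_Seq, rule runs_mono[OF loc], elim conjE)
      fix s2 and t2 :: nat
      assume f2: "frame {x_i, x_x, x_j} {} ?s1 s2" and t2: "t2 = 3" and
        regs: "reg s2 x_i = word_class ?s1 r" "reg s2 x_x = word_pos ?s1 r" "reg s2 x_j = word_slot ?s1 r"
      have f: "frame {x_x, x_i, x_j, x_v, x_r} {} s s2" using f2 by (simp add: frame_def)
      note eq = word_frame[OF f] word_frame[OF f1] unchanged(3-5)[OF f]
      have c: "eval w s2 (Reg x_j <\<^sub>e Read a_count (Reg x_i)) = of_bool (word_hits s r)"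
        using regs x eq by (simp add: eval_rules word_hits_def)
      show "runs w (Cond (Reg x_j <\<^sub>e Read a_count (Reg x_i)) use_slot Skip) s2
        (\<lambda>s' t. word_effect s r s' \<and> 1 + (1 + (t2 + t)) + payment s' \<le> payment s + 12)"
      proof (rule runs_CondI)
        assume "eval w s2 (Reg x_j <\<^sub>e Read a_count (Reg x_i)) \<noteq> 0"
        then have hit: "word_hits s r" unfolding c by (simp split: if_splits)
        have "runs w use_slot s2 (\<lambda>s' t. word_effect s2 r s' \<and> t + payment s' \<le> payment s2 + 6)"
          by (rule runs_use_slot) (use unchanged(1,2)[OF f] base t hit regs eq in simp_all)
        then show "runs w use_slot s2
          (\<lambda>s' t. word_effect s r s' \<and> 1 + (1 + (t2 + (1 + t))) + payment s' \<le> payment s + 12)"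
          by (rule runs_mono) (use eq t2 in \<open>simp add: word_effect_def split: option.splits\<close>)
      next
        assume "eval w s2 (Reg x_j <\<^sub>e Read a_count (Reg x_i)) = 0"
        then have "\<not> word_hits s r" unfolding c by (simp split: if_splits)
        then show "runs w Skip s2
          (\<lambda>s' t. word_effect s r s' \<and> 1 + (1 + (t2 + (1 + t))) + payment s' \<le> payment s + 12)"
          using neutral[OF f] t2 by (simp add: runs_Skip)
      qed
    qed
  next
    assume "eval w ?s1 (Reg x_x <\<^sub>e Reg x_range) = 0"
    then have "\<not> word_hits s r" by (simp add: eval_rules word_hits_def split: if_splits)
    then show "runs w Skip ?s1 (\<lambda>s' t. word_effect s r s' \<and> 1 + (1 + t) + payment s' \<le> payment s + 12)"
      using neutral[OF f1] by (simp add: runs_Skip)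
  qed
qed

end

section \<open>Cost and running time of the program\<close>

text \<open>Deterministic code around a single draw: the outcomes become functions of the drawn
  word, which is the form that \<open>pivot_loop\<close> expects.\<close>

lemma exec_random:
  assumes "runs w p s (\<lambda>s1 t1. \<forall>r<2 ^ w.
    runs w q (s1\<lparr>reg := (reg s1)(x := r)\<rparr>) (\<lambda>s2 t2. Q r s2 (t1 + (1 + t2))))"
  shows "\<exists>st tm. exec w (p ;; Random x ;; q) s =
    map_spmf (\<lambda>r. (st r, tm r)) (spmf_of_set {0..<2 ^ w}) \<and> (\<forall>r<2 ^ w. Q r (st r) (tm r))"
proof -
  obtain s1 t1 where p: "exec w p s = return_spmf (s1, t1)"
    and q: "\<forall>r<2 ^ w. \<exists>s2 t2. exec w q (s1\<lparr>reg := (reg s1)(x := r)\<rparr>) = return_spmf (s2, t2) \<and>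
      Q r s2 (t1 + (1 + t2))"
    using assms unfolding runs_def by blast
  obtain st tm where st: "\<forall>r<2 ^ w. exec w q (s1\<lparr>reg := (reg s1)(x := r)\<rparr>) = return_spmf (st r, tm r) \<and>
      Q r (st r) (t1 + (1 + tm r))"
    using q by metis
  have "exec w (p ;; Random x ;; q) s = bind_spmf (spmf_of_set {0..<2 ^ w})
      (\<lambda>r. bind_spmf (exec w q (s1\<lparr>reg := (reg s1)(x := r)\<rparr>))
        (\<lambda>(s2, t2). return_spmf (s2, t1 + (1 + t2))))"
    by (simp add: p map_spmf_conv_bind_spmf case_prod_beta')
  also have "\<dots> = bind_spmf (spmf_of_set {0..<2 ^ w}) (\<lambda>r. return_spmf (st r, t1 + (1 + tm r)))"
    using st by (intro bind_spmf_cong) auto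
  also have "\<dots> = map_spmf (\<lambda>r. (st r, t1 + (1 + tm r))) (spmf_of_set {0..<2 ^ w})"
    by (simp add: map_spmf_conv_bind_spmf)
  finally show ?thesis
    using st by (intro exI[of _ st] exI[of _ "\<lambda>r. t1 + (1 + tm r)"]) simp
qed

context instance_on_machine
begin

text \<open>The vertex behind a label carries it itself; this yields the freshness condition of
  \<open>pivot_loop\<close>.\<close>

lemma base_inv_label:
  assumes "base_inv s" "u < n" "arr s a_label u = Suc v"
  shows "arr s a_label v \<noteq> 0"
  using assms unfolding base_inv_def by (metis Suc_inject nat.distinct(1))

text \<open>Pivots and quotient are read off the state after \<open>refresh\<close>, which alters
  neither labels nor progress. The constant is \<open>16 = 1 + 2 + 1 + 12\<close> for the guard,
  \<open>refresh\<close>, \<open>Random\<close> and \<open>use_word\<close>.\<close>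

lemma pivot_step_outcome:
  assumes inv: "main_inv s" and mass: "0 < reg s x_mass"
  shows "\<exists>st tm pv q.
    exec w pivot_step s = map_spmf (\<lambda>r. (st r, tm r)) (spmf_of_set {0::nat..<2 ^ w}) \<and>
    (\<forall>r<2 ^ w. main_inv (st r) \<and> 1 + tm r + payment (st r) \<le> payment s + 16 \<and>
       progress (st r) \<le> progress s \<and>
       (case pv r of None \<Rightarrow> arr (st r) a_label = arr s a_label
        | Some v \<Rightarrow> v < n \<and> arr s a_label v = 0 \<and> arr (st r) a_label = pivot_label E v (arr s a_label))) \<and>
    (\<forall>v<n. arr s a_label v = 0 \<longrightarrow> card {r. r < 2 ^ w \<and> pv r = Some v} = q * \<omega> v) \<and>
    2 ^ w \<le> 24 * card {r. r < 2 ^ w \<and> progress (st r) < progress s}"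
proof -
  obtain s1 t1 where refresh: "exec w refresh s = return_spmf (s1, t1)"
    and base1: "base_inv s1" and tab1: "table_inv s1" and old1: "reg s1 x_old_mass \<le> 2 * reg s1 x_mass"
    and f1: "frame {x_grain, x_i, x_cells, x_range, x_quot, x_old_mass} {a_start, a_cell} s s1"
    and time1: "t1 + payment s1 \<le> payment s + 2"
    using runs_refresh[OF inv mass] unfolding runs_def by blast
  let ?Q = "\<lambda>r s2 t. word_effect s1 r s2 \<and> 1 + t + payment s2 \<le> payment s + 16"
  have "runs w use_word (s1\<lparr>reg := (reg s1)(x_r := r)\<rparr>) (\<lambda>s2 t2. ?Q r s2 (t1 + (1 + t2)))"
    if r: "r < 2 ^ w" for r
  proof -
    let ?s1 = "s1\<lparr>reg := (reg s1)(x_r := r)\<rparr>"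
    have f: "frame {x_x, x_i, x_j, x_v, x_r} {} s1 ?s1" by (simp add: frame_def)
    have "runs w use_word ?s1 (\<lambda>s' t. word_effect ?s1 r s' \<and> t + payment s' \<le> payment ?s1 + 12)"
      by (rule runs_use_word) (use unchanged(1,2)[OF f] base1 tab1 r in simp_all)
    then show ?thesis
      by (rule runs_mono)
         (use time1 word_frame[OF f] unchanged(3-5)[OF f] in \<open>simp add: word_effect_def split: option.splits\<close>)
  qed
  then have "runs w refresh s (\<lambda>s1 t1. \<forall>r<2 ^ w.
      runs w use_word (s1\<lparr>reg := (reg s1)(x_r := r)\<rparr>) (\<lambda>s2 t2. ?Q r s2 (t1 + (1 + t2))))"
    unfolding runs_def refresh by simp
  from exec_random[OF this] obtain st tm where
    exec: "exec w pivot_step s = map_spmf (\<lambda>r. (st r, tm r)) (spmf_of_set {0::nat..<2 ^ w})"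
    and Q: "\<And>r. r < 2 ^ w \<Longrightarrow> ?Q r (st r) (tm r)"
    unfolding pivot_step_def by blast
  have eq: "arr s1 a_label = arr s a_label" "progress s1 = progress s"
    using f1 by (simp_all add: frame_def progress_def)
  have "card {r. r < 2 ^ w \<and> word_hits s1 r \<and>
      (arr s1 a_label (word_vertex s1 r) = 0 \<longrightarrow> word_height s1 r < \<omega> (word_vertex s1 r))} \<le>
      card {r. r < 2 ^ w \<and> progress (st r) < progress s}"
    using Q by (intro card_mono) (auto simp: word_effect_def eq)
  then have D: "2 ^ w \<le> 24 * card {r. r < 2 ^ w \<and> progress (st r) < progress s}"
    using card_progress_words[OF base1 tab1 old1] by linarith
  show ?thesis
  proof (intro exI conjI allI impI)
    show "exec w pivot_step s = map_spmf (\<lambda>r. (st r, tm r)) (spmf_of_set {0::nat..<2 ^ w})" by (rule exec)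
    fix r :: nat assume r: "r < 2 ^ w"
    show "main_inv (st r)" "1 + tm r + payment (st r) \<le> payment s + 16" "progress (st r) \<le> progress s"
      using Q[OF r] by (simp_all add: word_effect_def eq)
    show "case word_pivot s1 r of None \<Rightarrow> arr (st r) a_label = arr s a_label
        | Some v \<Rightarrow> v < n \<and> arr s a_label v = 0 \<and> arr (st r) a_label = pivot_label E v (arr s a_label)"
      using Q[OF r] by (simp add: word_effect_def eq split: option.splits)
  next
    fix v assume "v < n" "arr s a_label v = 0"
    then show "card {r. r < 2 ^ w \<and> word_pivot s1 r = Some v} = reg s1 x_quot * \<omega> v"
      by (intro card_word_pivot base1 tab1) (simp_all add: eq)
  qed (rule D)
qed

sublocale pivot_loop n E \<omega> "\<lambda>s. eval w s (Reg x_mass) \<noteq> 0" "exec w pivot_step" main_inv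
  "\<lambda>s. arr s a_label" progress payment "2 ^ w" 24 16
proof
  show "(0::nat) < 2 ^ w" "(0::nat) < 24" by simp_all
  show "arr s a_label u \<noteq> Suc v" if "main_inv s" "v < n" "u < n" "arr s a_label v = 0" for s v u
    using that base_inv_label[of s u v] by (auto simp: main_inv_def)
qed (use pivot_step_outcome in auto)

lemma output_cluster_iff:
  assumes "x < n" "y < n"
  shows "(\<exists>Y\<in>output_clustering n s. x \<in> Y \<and> y \<in> Y) \<longleftrightarrow> arr s a_label x = arr s a_label y"
  using assms by (auto simp: output_clustering_def)

text \<open>Mass zero means that no slots are left, and unlabelled vertices always have one. So all
  pairs are decided, the charge is independent of \<open>same\<close>, and only the factor 2 of
  ordered pairs remains.\<close>

lemma cost_of_final_state:
  assumes "main_inv s" "reg s x_mass = 0"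
  shows "2 * clustering_cost E \<omega> (output_clustering n s) = charge n E \<omega> same (arr s a_label)"
proof -
  have slots: "slots n {u. u < n \<and> arr s a_label u = 0} (reg s x_classes) (arr s a_count) (arr s a_slot)"
    and "(\<Sum>i<reg s x_classes. arr s a_count i * 2 ^ i) = 0"
    using assms by (auto simp: main_inv_def base_inv_def)
  then have "arr s a_count i = 0" for i
    by (cases "i < reg s x_classes") (auto simp: slots_def)
  then have lab: "arr s a_label u \<noteq> 0" if "u < n" for u
    using slots that by (auto simp: slots_def)
  have "2 * clustering_cost E \<omega> (output_clustering n s) =
      (\<Sum>x\<in>{0..<n}. \<Sum>y\<in>{0..<n} - {x}. \<omega> x * \<omega> y *
        of_bool (({x, y} \<in> E) \<noteq> (\<exists>Y\<in>output_clustering n s. x \<in> Y \<and> y \<in> Y)))"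
    by (rule clustering_cost_ordered_pairs[OF graph]) (auto simp: output_clustering_def)
  also have "\<dots> = charge n E \<omega> same (arr s a_label)"
    unfolding charge_def atLeast0LessThan
  proof (intro sum.cong refl)
    fix x y assume "x \<in> {..<n}" "y \<in> {..<n} - {x}"
    then have xy: "x < n" "y < n" by auto
    show "\<omega> x * \<omega> y * of_bool (({x, y} \<in> E) \<noteq> (\<exists>Y\<in>output_clustering n s. x \<in> Y \<and> y \<in> Y)) =
        \<omega> x * \<omega> y * pair_charge E same (arr s a_label) x y"
      unfolding output_cluster_iff[OF xy] using lab[OF xy(1)] by (simp add: pair_charge_def)
  qed
  finally show ?thesis .
qed

lemma charge_unlabelled:
  assumes "\<Union>C \<subseteq> {0..<n}" and zero: "\<And>u. l u = 0"
  shows "charge n E \<omega> (\<lambda>x y. \<exists>Y\<in>C. x \<in> Y \<and> y \<in> Y) l = 6 * clustering_cost E \<omega> C"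
proof -
  have "charge n E \<omega> (\<lambda>x y. \<exists>Y\<in>C. x \<in> Y \<and> y \<in> Y) l = 3 * (2 * clustering_cost E \<omega> C)"
    unfolding clustering_cost_ordered_pairs[OF graph assms(1)] charge_def pair_charge_def
    by (simp add: zero sum_distrib_left atLeast0LessThan mult_ac)
  then show ?thesis by simp
qed

lemma exec_pivot_program:
  obtains s t where "exec w pivot_program (input_state n \<omega> off nbr) =
      map_spmf (\<lambda>(s', t'). (s', t + t')) (loop (\<lambda>s. eval w s (Reg x_mass) \<noteq> 0) (exec w pivot_step) s)"
    and "main_inv s" "\<And>u. arr s a_label u = 0" "progress s \<le> 2 * n"
    and "t + payment s \<le> (3 * (a + c) + 19) * n + 8 * card E + 37 * ((w + 1) * (w + 1))"
proof -
  obtain s t where init: "exec w initialize (input_state n \<omega> off nbr) = return_spmf (s, t)"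
    and base: "base_inv s" and old: "2 * reg s x_mass < reg s x_old_mass"
    and lab: "\<And>u. arr s a_label u = 0"
    and t: "t \<le> (3 * (a + c) + 19) * n + 5 * reg s x_classes + 20"
    using runs_initialize unfolding runs_def by blast
  define L where "L = reg s x_classes"
  have slots: "slots n {u. u < n \<and> arr s a_label u = 0} L (arr s a_count) (arr s a_slot)"
    and L4: "2 ^ L \<le> 4 * X" and old_lt: "reg s x_old_mass < 2 ^ w"
    using base by (simp_all add: base_inv_def L_def)
  have "(2::nat) ^ L < 2 ^ w" using L4 word_bounds(4) X_pos by linarith
  then have Lw: "L \<le> w" by simp
  have bl: "bit_length (reg s x_old_mass) \<le> w" by (rule bit_length_le[OF old_lt])
  have all: "{u. u < n \<and> arr s a_label u = 0} = {..<n}" using lab by auto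
  have "payment s = 8 * card E + (12 * L + 12) * bit_length (reg s x_old_mass)"
    unfolding payment_def all sum_degrees by (simp add: L_def)
  also have "\<dots> \<le> 8 * card E + (12 * w + 12) * w"
    using Lw bl by (intro add_left_mono mult_le_mono) auto
  finally have "t + payment s \<le> (3 * (a + c) + 19) * n + 5 * w + 20 + (8 * card E + (12 * w + 12) * w)"
    using t Lw unfolding L_def by linarith
  \<comment> \<open>\<open>37 = 12 + 5 + 20\<close>: each of the terms
    \<open>12 * (w + 1) * w\<close>, \<open>5 * w\<close> and \<open>20\<close> is at most its
    coefficient times \<open>(w + 1) * (w + 1)\<close>.\<close>
  also have "\<dots> \<le> (3 * (a + c) + 19) * n + 8 * card E + 37 * ((w + 1) * (w + 1))"
    by (simp add: algebra_simps)
  finally have time: "t + payment s \<le> (3 * (a + c) + 19) * n + 8 * card E + 37 * ((w + 1) * (w + 1))" .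
  have "exec w pivot_program (input_state n \<omega> off nbr) =
      map_spmf (\<lambda>(s', t'). (s', t + t')) (loop (\<lambda>s. eval w s (Reg x_mass) \<noteq> 0) (exec w pivot_step) s)"
    unfolding pivot_program_def by (simp add: init map_spmf_conv_bind_spmf case_prod_beta')
  moreover have "main_inv s" using base old by (simp add: main_inv_def)
  moreover have "progress s \<le> 2 * n"
    using sum_slots_le[OF slots] by (simp add: progress_def all L_def)
  ultimately show ?thesis using that lab time by blast
qed

lemma lossless_pivot_program: "lossless_spmf (exec w pivot_program (input_state n \<omega> off nbr))"
proof (rule exec_pivot_program)
  fix s t
  assume exec: "exec w pivot_program (input_state n \<omega> off nbr) =
      map_spmf (\<lambda>(s', t'). (s', t + t')) (loop (\<lambda>s. eval w s (Reg x_mass) \<noteq> 0) (exec w pivot_step) s)"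
    and inv: "main_inv s"
  show ?thesis unfolding exec using lossless[OF inv] by simp
qed

text \<open>With an optimal clustering as reference, the charge starts at six times the optimum and
  ends at twice the cost of the output.\<close>

lemma expected_cost_pivot_program:
  "(\<integral>\<^sup>+ (s, t). of_nat (clustering_cost E \<omega> (output_clustering n s))
      \<partial>measure_spmf (exec w pivot_program (input_state n \<omega> off nbr))) \<le> 3 * of_nat (opt_cost {0..<n} E \<omega>)"
proof -
  let ?cost = "\<lambda>s. clustering_cost E \<omega> (output_clustering n s)"
  obtain C where C: "partition_on {0..<n} C" and opt: "opt_cost {0..<n} E \<omega> = clustering_cost E \<omega> C"
    by (rule opt_cost_attained[of "{0..<n}" E \<omega>]) simp_all
  define same where "same x y \<longleftrightarrow> (\<exists>Y\<in>C. x \<in> Y \<and> y \<in> Y)" for x y :: nat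
  have trans: "same x z" if "same x y" "same y z" for x y z
    using that C unfolding same_def partition_on_def disjoint_def by blast
  obtain s t where exec: "exec w pivot_program (input_state n \<omega> off nbr) =
      map_spmf (\<lambda>(s', t'). (s', t + t')) (loop (\<lambda>s. eval w s (Reg x_mass) \<noteq> 0) (exec w pivot_step) s)"
    and inv: "main_inv s" and lab: "\<And>u. arr s a_label u = 0"
    using exec_pivot_program by metis
  let ?loop = "loop (\<lambda>s. eval w s (Reg x_mass) \<noteq> 0) (exec w pivot_step) s"
  have "2 * (\<integral>\<^sup>+ (s', t'). of_nat (?cost s') \<partial>measure_spmf ?loop) =
      (\<integral>\<^sup>+ (s', t'). of_nat (2 * ?cost s') \<partial>measure_spmf ?loop)"
    by (subst nn_integral_cmult[symmetric]) (auto simp: case_prod_beta')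
  also have "\<dots> \<le> of_nat (charge n E \<omega> same (arr s a_label))"
  proof (rule expected_charge_le[OF inv])
    show "same y x" if "same x y" for x y using that by (auto simp: same_def)
    show "same x z" if "same x y" "same y z" for x y z by (rule trans[OF that])
    show "of_nat (2 * ?cost s') \<le> (of_nat (charge n E \<omega> same (arr s' a_label)) :: ennreal)"
      if "main_inv s'" "\<not> eval w s' (Reg x_mass) \<noteq> 0" for s'
      using cost_of_final_state[OF that(1), of same] that(2) by simp
  qed
  also have "charge n E \<omega> same (arr s a_label) = 6 * opt_cost {0..<n} E \<omega>"
    unfolding same_def opt by (rule charge_unlabelled[OF _ lab]) (use C in \<open>auto simp: partition_on_def\<close>)
  also have "(of_nat (6 * opt_cost {0..<n} E \<omega>) :: ennreal) = 2 * (3 * of_nat (opt_cost {0..<n} E \<omega>))"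
    by (simp add: mult.assoc[symmetric])
  finally have "(\<integral>\<^sup>+ (s', t'). of_nat (?cost s') \<partial>measure_spmf ?loop) \<le> 3 * of_nat (opt_cost {0..<n} E \<omega>)"
    by (subst (asm) ennreal_mult_le_mult_iff) auto
  then show ?thesis unfolding exec by (simp add: case_prod_beta' o_def)
qed

text \<open>The number \<open>h\<close> converts powers of two into powers of \<open>z\<close>: the
  initial factor \<open>2 ^ progress\<close> and the desired failure bound together cost
  \<open>h * (2 * n + n * d)\<close> units of time.\<close>

lemma time_pivot_program:
  fixes z :: real
  assumes z: "1 \<le> z" "z ^ 16 * (1 - 1 / 48) \<le> 1" and h: "2 \<le> z ^ h" and n: "1 \<le> n"
    and T: "(3 * (a + c) + 19) * n + 8 * card E + 37 * ((w + 1) * (w + 1)) + h * (2 * n + n * d) \<le> T"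
  shows "1 - 1 / real n ^ d \<le>
    measure (measure_spmf (exec w pivot_program (input_state n \<omega> off nbr))) {(s, t). t \<le> T}"
proof -
  obtain s t where exec: "exec w pivot_program (input_state n \<omega> off nbr) =
      map_spmf (\<lambda>(s', t'). (s', t + t')) (loop (\<lambda>s. eval w s (Reg x_mass) \<noteq> 0) (exec w pivot_step) s)"
    and inv: "main_inv s" and prog: "progress s \<le> 2 * n"
    and time: "t + payment s \<le> (3 * (a + c) + 19) * n + 8 * card E + 37 * ((w + 1) * (w + 1))"
    using exec_pivot_program by metis
  let ?loop = "loop (\<lambda>s. eval w s (Reg x_mass) \<noteq> 0) (exec w pivot_step) s"
  let ?M = "measure_spmf ?loop"
  have tT: "t \<le> T" "payment s + h * (2 * n + n * d) \<le> T - t" using time T by linarith+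
  let ?B = "{(s' :: state, t'). T - t < t'}"
  have tail: "measure ?M ?B * z ^ (T - t) \<le> z ^ payment s * 2 ^ progress s"
    using time_tail[OF inv z(1), of "T - t"] z(2) by simp
  \<comment> \<open>The crude bound of \<open>n\<close> by \<open>2 ^ n\<close> suffices, because
    the resulting \<open>n * d\<close> is still linear in \<open>n\<close>.\<close>
  have "real n ^ d \<le> (2 ^ n) ^ d"
    by (intro power_mono less_imp_le[OF of_nat_less_two_power]) simp
  then have "z ^ payment s * 2 ^ progress s * real n ^ d \<le> z ^ payment s * 2 ^ (2 * n) * (2 ^ n) ^ d"
    using z prog by (intro mult_mono power_increasing) auto
  also have "\<dots> = z ^ payment s * 2 ^ (2 * n + n * d)" by (simp add: power_add power_mult)
  also have "\<dots> \<le> z ^ payment s * (z ^ h) ^ (2 * n + n * d)"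
    using z h by (intro mult_left_mono power_mono) auto
  also have "\<dots> = z ^ (payment s + h * (2 * n + n * d))" by (simp add: power_add power_mult)
  also have "\<dots> \<le> z ^ (T - t)" using z tT by (intro power_increasing) auto
  finally have "z ^ payment s * 2 ^ progress s * real n ^ d \<le> z ^ (T - t)" .
  then have "measure ?M ?B * z ^ (T - t) * real n ^ d \<le> 1 * z ^ (T - t)"
    using mult_right_mono[OF tail, of "real n ^ d"] by simp
  then have "(measure ?M ?B * real n ^ d) * z ^ (T - t) \<le> 1 * z ^ (T - t)" by (simp add: mult_ac)
  then have "measure ?M ?B * real n ^ d \<le> 1" using z by (subst (asm) mult_le_cancel_right) auto
  then have B: "measure ?M ?B \<le> 1 / real n ^ d" using n by (simp add: field_simps)
  have "1 = measure ?M UNIV"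
    using lossless[OF inv] by (simp add: lossless_spmf_def weight_spmf_def space_measure_spmf)
  also have "\<dots> = measure ?M (?B \<union> - ?B)" by simp
  also have "\<dots> \<le> measure ?M ?B + measure ?M (- ?B)" by (rule measure_Un_le) auto
  also have "- ?B = (\<lambda>(s', t'). (s', t + t')) -` {(s, t). t \<le> T}"
    using tT by auto
  finally show ?thesis using B unfolding exec measure_map_spmf by linarith
qed

end

text \<open>Applying \<open>ln y \<le> y\<close> to the square root of \<open>n + 2\<close> bounds
  the logarithm by a multiple of that root, so its square is linear. This absorbs the rebuilding
  cost, quadratic in the word length, into \<open>O(n)\<close>.\<close>

lemma log_squared_le:
  assumes "1 \<le> n"
  shows "(log 2 (real n + 2))\<^sup>2 \<le> 48 * real n" "1 \<le> log 2 (real n + 2)"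
proof -
  let ?y = "sqrt (real n + 2)"
  have y: "0 < ?y" by simp
  have "log 2 (real n + 2) = log 2 (?y ^ 2)" by simp
  also have "\<dots> = 2 * (ln ?y / ln 2)" using y by (subst log_nat_power) (auto simp: log_def)
  also have "ln ?y / ln 2 \<le> 2 * ?y"
  proof -
    have "ln ?y \<le> ?y" using ln_le_minus_one[OF y] by linarith
    also have "?y \<le> 2 * ?y * ln 2" using ln2_ge_two_thirds y by simp
    finally show ?thesis by (simp add: divide_le_eq)
  qed
  finally have le: "log 2 (real n + 2) \<le> 4 * ?y" by simp
  show ge: "1 \<le> log 2 (real n + 2)" by simp
  have "(log 2 (real n + 2))\<^sup>2 \<le> (4 * ?y)\<^sup>2" using le ge by (intro power_mono) auto
  also have "\<dots> = 16 * (real n + 2)" by (simp add: power_mult_distrib)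
  also have "\<dots> \<le> 48 * real n" using assms by simp
  finally show "(log 2 (real n + 2))\<^sup>2 \<le> 48 * real n" .
qed

text \<open>The absolute value is taken because \<open>\<kappa>\<close> may be any real number;
  adding 1 to it accounts for \<open>w + 1\<close>, as the logarithm is at least 1.\<close>

lemma word_length_squared_le:
  assumes n: "1 \<le> n" and w: "real w \<le> \<kappa> * log 2 (real n + 2)"
  shows "(w + 1) * (w + 1) \<le> nat \<lceil>48 * (\<bar>\<kappa>\<bar> + 1)\<^sup>2\<rceil> * n"
proof -
  let ?l = "log 2 (real n + 2)"
  have l: "1 \<le> ?l" by (rule log_squared_le(2)[OF n])
  have "\<kappa> * ?l \<le> \<bar>\<kappa>\<bar> * ?l" using l by (intro mult_right_mono) auto
  then have "real w + 1 \<le> (\<bar>\<kappa>\<bar> + 1) * ?l" using w l unfolding distrib_right by linarith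
  then have "(real w + 1)\<^sup>2 \<le> ((\<bar>\<kappa>\<bar> + 1) * ?l)\<^sup>2" by (intro power_mono) auto
  also have "\<dots> = (\<bar>\<kappa>\<bar> + 1)\<^sup>2 * ?l\<^sup>2" by (rule power_mult_distrib)
  also have "\<dots> \<le> (\<bar>\<kappa>\<bar> + 1)\<^sup>2 * (48 * real n)"
    by (intro mult_left_mono log_squared_le n) simp
  also have "\<dots> = (48 * (\<bar>\<kappa>\<bar> + 1)\<^sup>2) * real n" by simp
  also have "\<dots> \<le> real (nat \<lceil>48 * (\<bar>\<kappa>\<bar> + 1)\<^sup>2\<rceil>) * real n"
    by (intro mult_right_mono real_nat_ceiling_ge) simp
  finally have "real ((w + 1) * (w + 1)) \<le> real (nat \<lceil>48 * (\<bar>\<kappa>\<bar> + 1)\<^sup>2\<rceil> * n)"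
    by (simp add: power2_eq_square algebra_simps)
  then show ?thesis by (simp only: of_nat_le_iff)
qed

lemma power_le_power_word_length:
  assumes "real k * log 2 (real n + 2) \<le> real w"
  shows "(n + 2) ^ k \<le> 2 ^ w"
proof -
  have "real ((n + 2) ^ k) = (real n + 2) powr real k" by (simp add: powr_realpow add.commute)
  also have "\<dots> = (2 powr log 2 (real n + 2)) powr real k" by simp
  also have "\<dots> = 2 powr (real k * log 2 (real n + 2))" unfolding powr_powr by (simp add: mult.commute)
  also have "\<dots> \<le> 2 powr real w" using assms by (intro powr_mono) auto
  also have "\<dots> = real (2 ^ w)" by (simp add: powr_realpow)
  finally show ?thesis by (simp only: of_nat_le_iff)
qed

theorem theorem5:
  shows "\<exists>P :: com. \<forall>a c :: nat. \<exists>\<kappa>\<^sub>0 :: real. \<forall>\<kappa>\<^sub>1 :: real. \<forall>d :: nat. \<exists>K :: nat.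
    \<forall>(n :: nat) (E :: nat set set) (\<omega> :: nat \<Rightarrow> nat) (off :: nat \<Rightarrow> nat) (nbr :: nat \<Rightarrow> nat) (w :: nat).
      simple_graph {0..<n} E \<longrightarrow>
      (\<forall>u<n. 0 < \<omega> u \<and> \<omega> u \<le> a * n ^ c) \<longrightarrow>
      adjacency_lists n E off nbr \<longrightarrow>
      \<kappa>\<^sub>0 * log 2 (real n + 2) \<le> real w \<longrightarrow>
      real w \<le> \<kappa>\<^sub>1 * log 2 (real n + 2) \<longrightarrow>
      (let run = exec w P (input_state n \<omega> off nbr) in
         lossless_spmf run \<and>
         (\<integral>\<^sup>+ (s, t). of_nat (clustering_cost E \<omega> (output_clustering n s)) \<partial>measure_spmf run)
           \<le> 3 * of_nat (opt_cost {0..<n} E \<omega>) \<and>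
         (1 \<le> n \<longrightarrow>
            measure (measure_spmf run) {(s, t). t \<le> K * (n + card E)} \<ge> 1 - 1 / real n ^ d))"
proof -
  \<comment> \<open>Chosen such that \<open>z ^ 16 * (1 - 1 / 48) = 1\<close>: the cost 16 of an
    iteration exactly balances the shrinking factor with \<open>48 = 2 * 24\<close>.\<close>
  define z :: real where "z = root 16 (48 / 47)"
  have z16: "z ^ 16 = 48 / 47" unfolding z_def by (rule real_root_pow_pos2) simp_all
  have z1: "1 < z" unfolding z_def by simp
  obtain h where h: "2 < z ^ h" using real_arch_pow[OF z1] by blast
  show ?thesis
  proof (intro exI[of _ pivot_program] allI, goal_cases)
    case (1 a c)
    show ?case
    \<comment> \<open>This constant turns the lower bound on \<open>w\<close> into the assumption
      \<open>word\<close> of \<open>instance_on_machine\<close>.\<close>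
    proof (intro exI[of _ "real (a + c + 10)"] allI, goal_cases)
      case (1 \<kappa> d)
      let ?B = "nat \<lceil>48 * (\<bar>\<kappa>\<bar> + 1)\<^sup>2\<rceil>"
      let ?K = "3 * (a + c) + 19 + 8 + 37 * ?B + h * (2 + d)"
      show ?case
      proof (intro exI[of _ ?K] allI impI, goal_cases)
        case (1 n E \<omega> off nbr w)
        interpret instance_on_machine n E \<omega> off nbr w a c
          using 1 power_le_power_word_length[of "a + c + 10" n w] by unfold_locales auto
        have "1 - 1 / real n ^ d \<le>
            measure (measure_spmf (exec w pivot_program (input_state n \<omega> off nbr))) {(s, t). t \<le> ?K * (n + card E)}"
          if n: "1 \<le> n"
        proof (rule time_pivot_program[of z h])
          have "(3 * (a + c) + 19) * n + 8 * card E + 37 * ((w + 1) * (w + 1)) + h * (2 * n + n * d) \<le>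
              (3 * (a + c) + 19) * n + 8 * card E + 37 * (?B * n) + h * (2 * n + n * d)"
            using word_length_squared_le[OF n] 1 by (intro add_mono mult_left_mono) auto
          also have "\<dots> \<le> ?K * (n + card E)" by (simp add: algebra_simps)
          finally show "(3 * (a + c) + 19) * n + 8 * card E + 37 * ((w + 1) * (w + 1)) + h * (2 * n + n * d)
              \<le> ?K * (n + card E)" .
        qed (use z1 z16 h n in auto)
        then show ?case
          using lossless_pivot_program expected_cost_pivot_program by (simp add: Let_def)
      qed
    qed
  qed
qed

end
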